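(* In the setting of the context, there is a probability measure $\mu$ on $\mathbb{R}$, independent of $p$, with unbounded support, which is uniquely determined by its moments $M_k=\int x^k\,d\mu(x)=\lim_{N\to\infty}M_k(N)$, such that the empirical spectral measures $\mu_{A,N}$ converge weakly to $\mu$ in probability: for every bounded continuous $f:\mathbb{R}\to\mathbb{R}$ and every $\varepsilon>0$, \[ \lim_{N\to\infty}\mathrm{Prob}\Big(\Big|\int f\,d\mu_{A,N}-\int f\,d\mu\Big|>\varepsilon\Big)=0 . \]
   Context: Let $p$ be a probability density on $\mathbb{R}$ with mean $0$, variance $1$ and finite moments of all orders. For $N\ge 1$, let $b_1,\dots,b_{N-1}$ be independent random variables with density $p$, set $b_0=0$, and let $A=A_N$ be the $N\times N$ real symmetric Toeplitz matrix with entries $a_{ij}=b_{|i-j|}$ ($1\le i,j\le N$). Let $\lambda_1(A),\dots,\lambda_N(A)$ be its eigenvalues. The empirical spectral measure is $\mu_{A,N}=\frac1N\sum_{i=1}^N\delta_{\lambda_i(A)/\sqrt N}$. For an integer $k\ge 0$ define $M_k(A,N)=\int x^k\,d\mu_{A,N}(x)=N^{-(k/2+1)}\,\mathrm{Trace}(A^k)$, and $M_k(N)=\mathbb{E}[M_k(A,N)]$. *)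

theory Defs
  imports "HOL-Probability.Probability" "Jordan_Normal_Form.Char_Poly"
begin

text \<open>The random symmetric Toeplitz matrix: entries a_ij = b_|i-j| with b_0 = 0.
  The random variables b_1,...,b_(N-1) are the coordinates of a point b of the product space.\<close>
definition toeplitz_mat :: "nat \<Rightarrow> (nat \<Rightarrow> real) \<Rightarrow> real mat" where
  "toeplitz_mat N b = mat N N (\<lambda>(i, j).
      (let d = (if i \<le> j then j - i else i - j) in if d = 0 then 0 else b d))"

definition mat_trace :: "real mat \<Rightarrow> real" where
  "mat_trace A = (\<Sum>i<dim_row A. A $$ (i, i))"

definition toeplitz_space :: "(real \<Rightarrow> real) \<Rightarrow> nat \<Rightarrow> (nat \<Rightarrow> real) measure" where
  "toeplitz_space p N = PiM {1..<N} (\<lambda>_. density lborel (\<lambda>x. ennreal (p x)))"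

text \<open>Eigenvalues with multiplicity = (real) roots of the characteristic polynomial
  with multiplicity (a real symmetric matrix has only real eigenvalues).\<close>
definition eigenvalues_ms :: "real mat \<Rightarrow> real multiset" where
  "eigenvalues_ms A = proots (char_poly A)"

definition esm_integral :: "nat \<Rightarrow> (nat \<Rightarrow> real) \<Rightarrow> (real \<Rightarrow> real) \<Rightarrow> real" where
  "esm_integral N b f =
     (1 / real N) * (\<Sum>\<^sub># (image_mset (\<lambda>ev. f (ev / sqrt (real N)))
                                  (eigenvalues_ms (toeplitz_mat N b))))"

definition moment_AN :: "nat \<Rightarrow> nat \<Rightarrow> (nat \<Rightarrow> real) \<Rightarrow> real" where
  "moment_AN k N b = real N powr (- (real k / 2 + 1)) * mat_trace (toeplitz_mat N b ^\<^sub>m k)"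

definition moment_N :: "(real \<Rightarrow> real) \<Rightarrow> nat \<Rightarrow> nat \<Rightarrow> real" where
  "moment_N p k N = integral\<^sup>L (toeplitz_space p N) (moment_AN k N)"

definition admissible_density :: "(real \<Rightarrow> real) \<Rightarrow> bool" where
  "admissible_density p \<longleftrightarrow>
     p \<in> borel_measurable borel \<and> (\<forall>x. 0 \<le> p x) \<and>
     prob_space (density lborel (\<lambda>x. ennreal (p x))) \<and>
     (\<forall>k::nat. integrable (density lborel (\<lambda>x. ennreal (p x))) (\<lambda>x. x ^ k)) \<and>
     (\<integral>x. x \<partial>(density lborel (\<lambda>x. ennreal (p x)))) = 0 \<and>
     (\<integral>x. x ^ 2 \<partial>(density lborel (\<lambda>x. ennreal (p x)))) = 1"

definition msupport :: "real measure \<Rightarrow> real set" where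
  "msupport \<mu> = {x. \<forall>e>0. measure \<mu> (ball x e) > 0}"

end

theory Submission
  imports Defs "Jordan_Normal_Form.Schur_Decomposition"
begin

text \<open>
  The method of moments. The trace of \<open>A ^ k\<close> is a sum over closed walks in \<open>{..<N}\<close>, weighted by the
  entries at the absolute values of the steps. In expectation only the walks whose absolute steps
  coincide exactly in pairs matter, and among these only those whose paired steps are opposite, since
  otherwise the relation that the steps sum to zero removes a degree of freedom. For a fixed pairing
  the surviving walks are the lattice points of a dilated polytope of dimension \<open>k / 2 + 1\<close>, so the
  normalised count converges to a volume that does not depend on \<open>p\<close>. The same count for two walks
  shows that the variance of the empirical moments tends to zero.

  There are at most \<open>(C m) ^ m\<close> pairings of \<open>2 m\<close> steps, hence the limits \<open>M k\<close> satisfy a bound under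
  which they determine a characteristic function; realizations whose moments are close to the \<open>M k\<close>
  are tight and their weak limit is the required measure. The same compactness argument turns
  convergence of moments in probability into weak convergence in probability.

  For the support, restrict the steps to \<open>[- D, D]\<close> with \<open>D\<close> of order \<open>N / m powr (3 / 4)\<close>: a
  fourth moment estimate and a union bound over the \<open>2 m\<close> times show that a fixed proportion of the
  walks stays in range for each of the at least \<open>fact m\<close> pairings. So \<open>M (2 m)\<close> grows faster than
  every \<open>r ^ (2 m)\<close>.
\<close>

section \<open>Eigenvalues, traces and closed walks\<close>

text \<open>Only the leading power of \<open>N\<close> in each count matters, so exceptional
  families of walks are bounded crudely and only the walks with opposite paired steps are counted
  exactly. The growth estimate is more delicate: \<open>fact m\<close> pairings, each of volume
  about \<open>(1 / m) ^ m\<close>, would give only exponential growth, which a compactly supported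
  measure also has. Chebyshev's inequality with second moments and a union bound over the times
  yields just that, since it forces steps of size \<open>N / m\<close>. Fourth moments permit steps
  of size \<open>N / m powr (3 / 4)\<close>, and up to exponential factors the surplus
  \<open>m powr (m / 4)\<close> remains. In the other direction the factorial order is harmless: a
  bound \<open>(C m) ^ m\<close> on the even moments is beaten by \<open>fact (2 * m)\<close> in the
  Taylor error of the characteristic function at every point. Random measures need no theory of
  their own: the moment problem is settled by compactness for deterministic measures, and randomness
  enters through a union bound over finitely many moments.\<close>

lemma symmetric_real_eigenvalue_is_real:
  fixes A :: "real mat"
  assumes A: "A \<in> carrier_mat n n" and symm: "\<And>i j. i < n \<Longrightarrow> j < n \<Longrightarrow> A $$ (i, j) = A $$ (j, i)"
    and ev: "eigenvalue (map_mat complex_of_real A) a"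
  shows "Im a = 0"
proof -
  let ?C = "map_mat complex_of_real A"
  obtain v where v: "v \<in> carrier_vec n" "v \<noteq> 0\<^sub>v n" "?C *\<^sub>v v = a \<cdot>\<^sub>v v"
    using ev A unfolding eigenvalue_def eigenvector_def by auto
  have row: "(\<Sum>j<n. of_real (A $$ (i, j)) * v $ j) = a * v $ i" if "i < n" for i
  proof -
    have "(?C *\<^sub>v v) $ i = (\<Sum>j<n. of_real (A $$ (i, j)) * v $ j)"
      using that A v(1) by (auto simp: scalar_prod_def row_def atLeast0LessThan intro!: sum.cong)
    then show ?thesis using v that by simp
  qed
  define S where "S = (\<Sum>i<n. (cmod (v $ i))\<^sup>2)"
  have "cnj (v $ i) * (\<Sum>j<n. of_real (A $$ (i, j)) * v $ j) = a * of_real ((cmod (v $ i))\<^sup>2)"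
    if "i < n" for i
    unfolding complex_norm_square row[OF that] by (simp add: mult_ac)
  then have "(\<Sum>i<n. cnj (v $ i) * (\<Sum>j<n. of_real (A $$ (i, j)) * v $ j))
      = (\<Sum>i<n. a * of_real ((cmod (v $ i))\<^sup>2))"
    by (intro sum.cong) auto
  also have "\<dots> = a * of_real S"
    by (simp add: S_def sum_distrib_left)
  finally have "(\<Sum>i<n. cnj (v $ i) * (\<Sum>j<n. of_real (A $$ (i, j)) * v $ j)) = a * of_real S" .
  moreover have "cnj (\<Sum>i<n. cnj (v $ i) * (\<Sum>j<n. of_real (A $$ (i, j)) * v $ j))
      = (\<Sum>i<n. cnj (v $ i) * (\<Sum>j<n. of_real (A $$ (i, j)) * v $ j))"
    unfolding cnj_sum complex_cnj_mult sum_distrib_left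
    by (subst sum.swap) (auto intro!: sum.cong simp: symm mult_ac)
  ultimately have "cnj (a * of_real S) = a * of_real S" by metis
  then have "Im (a * of_real S) = 0" by (metis Reals_cnj_iff complex_is_Real_iff)
  then have "Im a * S = 0" by simp
  moreover obtain i where "i < n" "v $ i \<noteq> 0"
    using v(1,2) by (metis carrier_vecD eq_vecI index_zero_vec)
  then have "S > 0" unfolding S_def by (intro sum_pos2[of _ i]) auto
  ultimately show ?thesis by simp
qed

text \<open>The complex characteristic polynomial factors, its roots are eigenvalues and hence real,
  and the embedding of coefficients is injective, so the factorization descends. It ensures that
  \<open>proots\<close> over the reals finds all \<open>n\<close> eigenvalues.\<close>

lemma symmetric_char_poly_splits:
  fixes A :: "real mat"
  assumes A: "A \<in> carrier_mat n n" and symm: "\<And>i j. i < n \<Longrightarrow> j < n \<Longrightarrow> A $$ (i, j) = A $$ (j, i)"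
  obtains es where "char_poly A = (\<Prod>e\<leftarrow>es. [:- e, 1:])" "length es = n"
proof -
  let ?C = "map_mat complex_of_real A"
  have C: "?C \<in> carrier_mat n n" using A by simp
  obtain as where as: "char_poly ?C = (\<Prod>a\<leftarrow>as. [:- a, 1:])" "length as = n"
    using char_poly_factorized[OF C] by blast
  have re: "complex_of_real (Re a) = a" if "a \<in> set as" for a
  proof -
    have "poly (char_poly ?C) a = 0"
      unfolding as using that by (auto simp: poly_prod_list prod_list_zero_iff)
    then have "eigenvalue ?C a" using eigenvalue_root_char_poly[OF C] by simp
    then have "Im a = 0" using symmetric_real_eigenvalue_is_real[OF A symm] by blast
    then show ?thesis by (simp add: complex_eq_iff)
  qed
  interpret of_real_hom: comm_ring_hom complex_of_real by unfold_locales auto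
  interpret of_real_poly_hom: map_poly_inj_comm_ring_hom complex_of_real by unfold_locales auto
  have "map_poly complex_of_real (char_poly A) = (\<Prod>a\<leftarrow>as. [:- a, 1:])"
    using of_real_hom.char_poly_hom[OF A] as(1) by (metis)
  also have "\<dots> = (\<Prod>e\<leftarrow>map Re as. map_poly complex_of_real [:- e, 1:])"
    using re by (auto intro!: arg_cong[of _ _ prod_list])
  also have "\<dots> = map_poly complex_of_real (\<Prod>e\<leftarrow>map Re as. [:- e, 1:])"
    by (simp add: of_real_poly_hom.hom_prod_list o_def)
  finally have "char_poly A = (\<Prod>e\<leftarrow>map Re as. [:- e, 1:])"
    by simp
  then show ?thesis using that[of "map Re as"] as(2) by simp
qed

lemma mat_trace_commute:
  assumes "A \<in> carrier_mat n m" "B \<in> carrier_mat m n"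
  shows "mat_trace (A * B) = mat_trace (B * A)"
proof -
  have "mat_trace (A * B) = (\<Sum>i<n. \<Sum>j<m. A $$ (i, j) * B $$ (j, i))"
    using assms unfolding mat_trace_def
    by (auto intro!: sum.cong simp: scalar_prod_def row_def col_def atLeast0LessThan)
  also have "\<dots> = (\<Sum>j<m. \<Sum>i<n. B $$ (j, i) * A $$ (i, j))"
    by (subst sum.swap) (simp add: mult.commute)
  also have "\<dots> = mat_trace (B * A)"
    using assms unfolding mat_trace_def
    by (auto intro!: sum.cong simp: scalar_prod_def row_def col_def atLeast0LessThan)
  finally show ?thesis .
qed

lemma upper_triangular_mult_index:
  fixes B C :: "'a :: comm_ring_1 mat"
  assumes B: "B \<in> carrier_mat n n" "upper_triangular B" and C: "C \<in> carrier_mat n n" "upper_triangular C"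
    and ij: "i < n" "j < n" "j \<le> i"
  shows "(B * C) $$ (i, j) = (if i = j then B $$ (i, i) * C $$ (i, i) else 0)"
proof -
  have "(B * C) $$ (i, j) = (\<Sum>l<n. B $$ (i, l) * C $$ (l, j))"
    using assms by (auto simp: scalar_prod_def row_def col_def atLeast0LessThan intro!: sum.cong)
  also have "\<dots> = (\<Sum>l<n. if l = i \<and> i = j then B $$ (i, i) * C $$ (i, i) else 0)"
  proof (intro sum.cong refl)
    fix l assume "l \<in> {..<n}"
    consider "l < i" | "l > i" | "l = i" by linarith
    then show "B $$ (i, l) * C $$ (l, j) = (if l = i \<and> i = j then B $$ (i, i) * C $$ (i, i) else 0)"
    proof cases
      case 1 then show ?thesis using upper_triangularD[OF B(2), of l i] B(1) ij by auto
    next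
      case 2 then show ?thesis using upper_triangularD[OF C(2), of j l] C(1) ij \<open>l \<in> _\<close> by auto
    next
      case 3 then show ?thesis using upper_triangularD[OF C(2), of j i] C(1) ij by auto
    qed
  qed
  finally show ?thesis using ij by (auto simp: sum.If_cases)
qed

lemma upper_triangular_power:
  fixes B :: "'a :: comm_ring_1 mat"
  assumes B: "B \<in> carrier_mat n n" "upper_triangular B"
  shows "upper_triangular (B ^\<^sub>m k) \<and> (\<forall>i<n. (B ^\<^sub>m k) $$ (i, i) = B $$ (i, i) ^ k)"
proof (induction k)
  case 0
  then show ?case using B by auto
next
  case (Suc k)
  have P: "B ^\<^sub>m k \<in> carrier_mat n n" using B by auto
  have "upper_triangular (B ^\<^sub>m k)" using Suc by blast
  note mult = upper_triangular_mult_index[OF P this B]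
  have "upper_triangular (B ^\<^sub>m k * B)"
    using mult P B by (intro upper_triangularI) auto
  then show ?case using Suc mult B(1) by (simp add: mult.commute)
qed

text \<open>Schur triangularization replaces the spectral theorem: it needs only the splitting of
  the characteristic polynomial, and the trace of a power is then read off the diagonal.\<close>

lemma mat_trace_power_similar_triangular:
  fixes A :: "real mat"
  assumes A: "A \<in> carrier_mat n n" and cp: "char_poly A = (\<Prod>e\<leftarrow>es. [:- e, 1:])"
  shows "mat_trace (A ^\<^sub>m k) = (\<Sum>e\<leftarrow>es. e ^ k)"
proof -
  obtain B P Q where S: "schur_decomposition A es = (B, P, Q)" by (metis prod_cases3)
  from schur_decomposition[OF A cp S]
  have wit: "similar_mat_wit A B P Q" and B: "upper_triangular B" "diag_mat B = es" by auto
  have c: "B \<in> carrier_mat n n" "P \<in> carrier_mat n n" "Q \<in> carrier_mat n n" "Q * P = 1\<^sub>m n"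
    using wit A unfolding similar_mat_wit_def Let_def by auto
  have ck: "B ^\<^sub>m k \<in> carrier_mat n n" using c by auto
  have "mat_trace (A ^\<^sub>m k) = mat_trace (P * (B ^\<^sub>m k * Q))"
    using similar_mat_wit_pow_id[OF wit, of k] c ck by (simp add: assoc_mult_mat[of P n n _ n Q n])
  also have "\<dots> = mat_trace (B ^\<^sub>m k * Q * P)"
    using c ck by (intro mat_trace_commute[of _ n n]) auto
  also have "B ^\<^sub>m k * Q * P = B ^\<^sub>m k"
    using c ck by (simp add: assoc_mult_mat[of _ n n _ n _ n])
  also have "mat_trace (B ^\<^sub>m k) = (\<Sum>i<n. B $$ (i, i) ^ k)"
    unfolding mat_trace_def using upper_triangular_power[OF c(1) B(1), of k] ck c(1) by (intro sum.cong) auto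
  also have "\<dots> = (\<Sum>e\<leftarrow>es. e ^ k)"
    unfolding B(2)[symmetric] diag_mat_def using c(1)
    by (simp add: sum_list_sum_nth atLeast0LessThan)
  finally show ?thesis .
qed

lemma proots_prod_linear: "proots (\<Prod>e\<leftarrow>es. [:- e, 1:]) = mset (es :: real list)"
proof (induction es)
  case (Cons e es)
  have "(\<Prod>e\<leftarrow>es. [:- e, 1:]) \<noteq> 0" by (auto simp: prod_list_zero_iff)
  then have "proots ([:- e, 1:] * (\<Prod>e\<leftarrow>es. [:- e, 1:])) = proots [:- e, 1:] + mset es"
    using Cons by (subst proots_mult) auto
  then show ?case by (simp only: list.map prod_list.Cons proots_linear_factor) simp
qed simp

text \<open>Points of the product space have coordinates in \<open>{1..<N}\<close> only, so the
  diagonal value 0 is imposed here instead of being read from \<open>b 0\<close>.\<close>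

definition toeplitz_entry :: "(nat \<Rightarrow> real) \<Rightarrow> nat \<Rightarrow> real" where
  "toeplitz_entry b d = (if d = 0 then 0 else b d)"

lemma toeplitz_mat_carrier [simp]: "toeplitz_mat N b \<in> carrier_mat N N"
  by (simp add: toeplitz_mat_def)

lemma toeplitz_mat_index:
  assumes "i < N" "j < N"
  shows "toeplitz_mat N b $$ (i, j) = toeplitz_entry b (nat \<bar>int j - int i\<bar>)"
proof -
  have "nat \<bar>int j - int i\<bar> = (if i \<le> j then j - i else i - j)" by auto
  then show ?thesis using assms by (simp add: toeplitz_mat_def toeplitz_entry_def Let_def)
qed

lemma eigenvalues_ms_toeplitz:
  obtains es where "eigenvalues_ms (toeplitz_mat N b) = mset es" "length es = N"
    "\<And>k. mat_trace (toeplitz_mat N b ^\<^sub>m k) = (\<Sum>e\<leftarrow>es. e ^ k)"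
proof -
  obtain es where es: "char_poly (toeplitz_mat N b) = (\<Prod>e\<leftarrow>es. [:- e, 1:])" "length es = N"
    by (rule symmetric_char_poly_splits[of "toeplitz_mat N b" N])
       (auto simp: toeplitz_mat_index abs_minus_commute)
  show ?thesis
    using that[of es] es mat_trace_power_similar_triangular[of "toeplitz_mat N b" N es]
    by (simp add: eigenvalues_ms_def proots_prod_linear)
qed

section \<open>Traces of matrix powers as sums over closed walks\<close>

definition paths :: "nat \<Rightarrow> nat \<Rightarrow> (nat \<Rightarrow> nat) set" where
  "paths k N = PiE {..k} (\<lambda>_. {..<N})"

lemma finite_paths [simp]: "finite (paths k N)"
  unfolding paths_def by (intro finite_PiE) auto

lemma mat_power_index_paths:
  fixes A :: "'a :: comm_ring_1 mat"
  assumes A: "A \<in> carrier_mat N N"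
  shows "i < N \<Longrightarrow> j < N \<Longrightarrow> (A ^\<^sub>m k) $$ (i, j)
     = (\<Sum>x | x \<in> paths k N \<and> x 0 = i \<and> x k = j. \<Prod>l<k. A $$ (x l, x (Suc l)))"
proof (induction k arbitrary: j)
  case 0
  have "{x \<in> paths 0 N. x 0 = i \<and> x 0 = j} = (if i = j then {\<lambda>l\<in>{0}. i} else {})"
    using 0 by (auto simp: paths_def PiE_def extensional_def fun_eq_iff)
  then show ?case using 0 A by auto
next
  case (Suc k)
  have P: "A ^\<^sub>m k \<in> carrier_mat N N" using A by auto
  let ?X = "\<lambda>m. {x \<in> paths k N. x 0 = i \<and> x k = m}"
  let ?w = "\<lambda>k x. \<Prod>l<k. A $$ (x l, x (Suc l))"
  have "(A ^\<^sub>m Suc k) $$ (i, j) = (\<Sum>m<N. (A ^\<^sub>m k) $$ (i, m) * A $$ (m, j))"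
    using Suc.prems A P by (auto simp: scalar_prod_def row_def col_def atLeast0LessThan intro!: sum.cong)
  also have "\<dots> = (\<Sum>m<N. \<Sum>x\<in>?X m. ?w k x * A $$ (m, j))"
    using Suc by (auto simp: sum_distrib_right intro!: sum.cong)
  also have "\<dots> = (\<Sum>(m, x)\<in>Sigma {..<N} ?X. ?w k x * A $$ (m, j))"
    by (subst sum.Sigma) auto
  also have "\<dots> = (\<Sum>x | x \<in> paths (Suc k) N \<and> x 0 = i \<and> x (Suc k) = j. ?w (Suc k) x)"
  proof (rule sum.reindex_bij_witness[of _ "\<lambda>x. (x k, restrict x {..k})" "\<lambda>(m, x). x(Suc k := j)"])
    fix a assume "a \<in> Sigma {..<N} ?X"
    then obtain m x where a: "a = (m, x)" "m < N" "x \<in> paths k N" "x 0 = i" "x k = m" by auto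
    have xu: "x (Suc k) = undefined" using a(3) by (auto simp: paths_def PiE_def extensional_def)
    show "(((case a of (m, x) \<Rightarrow> x(Suc k := j)) k), restrict (case a of (m, x) \<Rightarrow> x(Suc k := j)) {..k}) = a"
      using a by (auto simp: paths_def PiE_def extensional_def restrict_def fun_eq_iff)
    show "(case a of (m, x) \<Rightarrow> x(Suc k := j)) \<in> {x \<in> paths (Suc k) N. x 0 = i \<and> x (Suc k) = j}"
      using a Suc.prems by (auto simp: paths_def PiE_def extensional_def Pi_def le_Suc_eq)
    show "?w (Suc k) (case a of (m, x) \<Rightarrow> x(Suc k := j)) = (case a of (m, x) \<Rightarrow> ?w k x * A $$ (m, j))"
      using a by auto
  next
    fix x assume "x \<in> {x \<in> paths (Suc k) N. x 0 = i \<and> x (Suc k) = j}"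
    then show "(case (x k, restrict x {..k}) of (m, x) \<Rightarrow> x(Suc k := j)) = x"
      "(x k, restrict x {..k}) \<in> Sigma {..<N} ?X"
      by (auto simp: paths_def PiE_def extensional_def restrict_def fun_eq_iff Pi_def not_le le_Suc_eq)
  qed
  finally show ?case .
qed

definition closed_walks :: "nat \<Rightarrow> nat \<Rightarrow> (nat \<Rightarrow> nat) set" where
  "closed_walks k N = {x \<in> paths k N. x k = x 0}"

definition step :: "(nat \<Rightarrow> nat) \<Rightarrow> nat \<Rightarrow> int" where
  "step x j = int (x (Suc j)) - int (x j)"

lemma finite_closed_walks [simp]: "finite (closed_walks k N)"
  unfolding closed_walks_def by simp

lemma mat_trace_toeplitz_power:
  "mat_trace (toeplitz_mat N b ^\<^sub>m k)
     = (\<Sum>x\<in>closed_walks k N. \<Prod>j<k. toeplitz_entry b (nat \<bar>step x j\<bar>))"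
proof -
  let ?X = "\<lambda>i. {x \<in> paths k N. x 0 = i \<and> x k = i}"
  let ?w = "\<lambda>x. \<Prod>l<k. toeplitz_mat N b $$ (x l, x (Suc l))"
  have "mat_trace (toeplitz_mat N b ^\<^sub>m k) = (\<Sum>i<N. \<Sum>x\<in>?X i. ?w x)"
    unfolding mat_trace_def by (auto simp: mat_power_index_paths[of _ N] toeplitz_mat_def intro!: sum.cong)
  also have "\<dots> = sum ?w (\<Union>i\<in>{..<N}. ?X i)"
    by (subst sum.UNION_disjoint) auto
  also have "(\<Union>i\<in>{..<N}. ?X i) = closed_walks k N"
    by (auto simp: closed_walks_def paths_def PiE_def Pi_def)
  also have "sum ?w (closed_walks k N) = (\<Sum>x\<in>closed_walks k N. \<Prod>j<k. toeplitz_entry b (nat \<bar>step x j\<bar>))"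
    by (intro sum.cong prod.cong refl)
       (auto simp: closed_walks_def paths_def PiE_def Pi_def step_def intro!: toeplitz_mat_index)
  finally show ?thesis .
qed

section \<open>Expectations of products of entries\<close>

definition mult_of :: "'a set \<Rightarrow> ('a \<Rightarrow> nat) \<Rightarrow> nat \<Rightarrow> nat" where
  "mult_of J w v = card {j \<in> J. w j = v}"

text \<open>With \<open>m r\<close> the \<open>r\<close>-th moment of the entries, \<open>wick m J w\<close> is the expectation of the
  product over \<open>j \<in> J\<close> of \<open>b (w j)\<close>, where \<open>b 0 = 0\<close>.\<close>
definition wick :: "(nat \<Rightarrow> real) \<Rightarrow> 'a set \<Rightarrow> ('a \<Rightarrow> nat) \<Rightarrow> real" where
  "wick m J w = (if 0 \<in> w ` J then 0 else \<Prod>v\<in>w ` J. m (mult_of J w v))"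

lemma mult_of_eq_0_iff: "finite J \<Longrightarrow> mult_of J w v = 0 \<longleftrightarrow> v \<notin> w ` J"
  by (auto simp: mult_of_def)

lemma sum_mult_of: "finite J \<Longrightarrow> finite V \<Longrightarrow> w ` J \<subseteq> V \<Longrightarrow> (\<Sum>v\<in>V. mult_of J w v) = card J"
  using sum.group[of J V w "\<lambda>_. 1 :: nat"] by (simp add: mult_of_def)

locale entry_distribution =
  fixes p :: "real \<Rightarrow> real"
  assumes admissible: "admissible_density p"
begin

abbreviation entry :: "real measure" where
  "entry \<equiv> density lborel (\<lambda>x. ennreal (p x))"

definition m :: "nat \<Rightarrow> real" where
  "m r = (\<integral>x. x ^ r \<partial>entry)"

sublocale entry: prob_space entry
  using admissible by (simp add: admissible_density_def)

lemma m_0: "m 0 = 1" and m_1: "m 1 = 0" and m_2: "m 2 = 1"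
  using admissible entry.prob_space by (simp_all add: m_def admissible_density_def)

lemma integrable_power: "integrable entry (\<lambda>x. x ^ r)"
  using admissible by (simp add: admissible_density_def)

sublocale product_prob_space "\<lambda>_::nat. entry"
  by unfold_locales

lemma space_prob: "prob_space (toeplitz_space p N)"
  unfolding toeplitz_space_def by (intro prob_space_PiM entry.prob_space_axioms)

text \<open>Equal values of \<open>w\<close> are collected into one power, and the product is
  extended to all of \<open>{1..<N}\<close> with exponent 0 elsewhere; in this form the independence
  of the coordinates applies.\<close>

lemma prod_entries_eq:
  assumes "finite J" "w ` J \<subseteq> {..<N}"
  shows "(\<Prod>j\<in>J. toeplitz_entry b (w j)) = (if 0 \<in> w ` J then 0 else \<Prod>v\<in>{1..<N}. b v ^ mult_of J w v)"
proof (cases "0 \<in> w ` J")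
  case True
  then have "(\<Prod>j\<in>J. toeplitz_entry b (w j)) = 0"
    using assms(1) by (intro prod_zero) (auto simp: toeplitz_entry_def intro!: bexI)
  then show ?thesis using True by simp
next
  case False
  then have sub: "w ` J \<subseteq> {1..<N}" using assms by (force simp: Suc_le_eq)
  have "(\<Prod>j\<in>J. toeplitz_entry b (w j)) = (\<Prod>j\<in>J. b (w j))"
    using False by (intro prod.cong) (auto simp: toeplitz_entry_def image_iff)
  also have "\<dots> = (\<Prod>v\<in>{1..<N}. \<Prod>j\<in>{j \<in> J. w j = v}. b (w j))"
    using assms sub by (subst prod.group) auto
  also have "\<dots> = (\<Prod>v\<in>{1..<N}. b v ^ mult_of J w v)"
    by (intro prod.cong refl) (simp add: mult_of_def)
  finally show ?thesis using False by simp
qed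

lemma integrable_prod_entries:
  assumes "finite J" "w ` J \<subseteq> {..<N}"
  shows "integrable (toeplitz_space p N) (\<lambda>b. \<Prod>j\<in>J. toeplitz_entry b (w j))"
  unfolding prod_entries_eq[OF assms] toeplitz_space_def
  using product_integrable_prod[of "{1..<N}" "\<lambda>v x. x ^ mult_of J w v"] integrable_power
  by (cases "0 \<in> w ` J") simp_all

lemma integral_prod_entries:
  assumes "finite J" "w ` J \<subseteq> {..<N}"
  shows "(\<integral>b. (\<Prod>j\<in>J. toeplitz_entry b (w j)) \<partial>toeplitz_space p N) = wick m J w"
proof (cases "0 \<in> w ` J")
  case True
  then show ?thesis unfolding prod_entries_eq[OF assms] by (simp add: wick_def)
next
  case False
  then have sub: "w ` J \<subseteq> {1..<N}" using assms by (force simp: Suc_le_eq)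
  have "(\<integral>b. (\<Prod>j\<in>J. toeplitz_entry b (w j)) \<partial>toeplitz_space p N)
      = (\<integral>b. (\<Prod>v\<in>{1..<N}. b v ^ mult_of J w v) \<partial>PiM {1..<N} (\<lambda>_. entry))"
    unfolding prod_entries_eq[OF assms] toeplitz_space_def using False by simp
  also have "\<dots> = (\<Prod>v\<in>{1..<N}. m (mult_of J w v))"
    unfolding m_def by (rule product_integral_prod) (auto intro: integrable_power)
  also have "\<dots> = (\<Prod>v\<in>w ` J. m (mult_of J w v))"
    using sub assms by (intro prod.mono_neutral_right) (auto simp: m_0 mult_of_eq_0_iff[THEN iffD2])
  finally show ?thesis using False by (simp add: wick_def)
qed

end

section \<open>Mean and variance of the empirical moments in terms of walks\<close>

lemma step_bounds:
  assumes "x \<in> closed_walks k N" "j < k"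
  shows "\<bar>step x j\<bar> < int N" "nat \<bar>step x j\<bar> < N"
proof -
  have "x j < N" "x (Suc j) < N" using assms by (auto simp: closed_walks_def paths_def)
  then show "\<bar>step x j\<bar> < int N" "nat \<bar>step x j\<bar> < N" by (auto simp: step_def)
qed

abbreviation gap :: "(nat \<Rightarrow> nat) \<Rightarrow> nat \<Rightarrow> nat" where
  "gap x j \<equiv> nat \<bar>step x j\<bar>"

abbreviation scaling :: "nat \<Rightarrow> nat \<Rightarrow> real" where
  "scaling k N \<equiv> real N powr (- (real k / 2 + 1))"

text \<open>Turns the data of two walks into one family indexed by \<open>{..<2 * k}\<close>, so that second moments
  are again values of \<open>wick\<close>.\<close>
definition append_at :: "nat \<Rightarrow> (nat \<Rightarrow> 'b) \<Rightarrow> (nat \<Rightarrow> 'b) \<Rightarrow> nat \<Rightarrow> 'b" where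
  "append_at k f g j = (if j < k then f j else g (j - k))"

lemma prod_append_at: "(\<Prod>j<2 * k. f (append_at k u v j)) = (\<Prod>j<k. f (u j)) * (\<Prod>j<k. f (v j))"
  for f :: "'b \<Rightarrow> 'c :: comm_monoid_mult"
proof -
  have "(\<Prod>j<2 * k. f (append_at k u v j)) = (\<Prod>j\<in>{..<k} \<union> {k..<2 * k}. f (append_at k u v j))"
    by (intro prod.cong) auto
  also have "\<dots> = (\<Prod>j<k. f (append_at k u v j)) * (\<Prod>j=k..<2 * k. f (append_at k u v j))"
    by (intro prod.union_disjoint) auto
  also have "(\<Prod>j=k..<2 * k. f (append_at k u v j)) = (\<Prod>j<k. f (v j))"
    by (intro prod.reindex_bij_witness[of _ "\<lambda>j. j + k" "\<lambda>j. j - k"]) (auto simp: append_at_def)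
  finally show ?thesis by (simp add: append_at_def)
qed

context entry_distribution
begin

lemma integrable_moment_AN: "integrable (toeplitz_space p N) (moment_AN k N)"
  unfolding moment_AN_def[abs_def] mat_trace_toeplitz_power
  using step_bounds(2) by (intro integrable_mult_right Bochner_Integration.integrable_sum integrable_prod_entries) auto

lemma moment_N_eq:
  "moment_N p k N = scaling k N * (\<Sum>x\<in>closed_walks k N. wick m {..<k} (gap x))"
proof -
  have "(\<integral>b. (\<Prod>j<k. toeplitz_entry b (gap x j)) \<partial>toeplitz_space p N) = wick m {..<k} (gap x)"
    "integrable (toeplitz_space p N) (\<lambda>b. \<Prod>j<k. toeplitz_entry b (gap x j))"
    if "x \<in> closed_walks k N" for x
    using step_bounds(2)[OF that] by (intro integral_prod_entries integrable_prod_entries; auto)+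
  then show ?thesis
    unfolding moment_N_def moment_AN_def[abs_def] mat_trace_toeplitz_power
    by (simp add: Bochner_Integration.integral_sum)
qed

lemma moment_AN_square:
  "(moment_AN k N b)\<^sup>2 = (scaling k N)\<^sup>2 * (\<Sum>x\<in>closed_walks k N. \<Sum>y\<in>closed_walks k N.
      \<Prod>j<2 * k. toeplitz_entry b (append_at k (gap x) (gap y) j))"
  unfolding moment_AN_def mat_trace_toeplitz_power prod_append_at
  by (simp add: power2_eq_square sum_product mult_ac)

lemma append_at_gap_bound:
  assumes "x \<in> closed_walks k N" "y \<in> closed_walks k N"
  shows "append_at k (gap x) (gap y) ` {..<2 * k} \<subseteq> {..<N}"
  using step_bounds(2)[OF assms(1)] step_bounds(2)[OF assms(2)] by (auto simp: append_at_def)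

lemma integrable_moment_AN_square: "integrable (toeplitz_space p N) (\<lambda>b. (moment_AN k N b)\<^sup>2)"
  unfolding moment_AN_square
  using append_at_gap_bound by (intro integrable_mult_right Bochner_Integration.integrable_sum integrable_prod_entries) auto

text \<open>Keeping the difference inside the double sum exhibits the variance as a sum of
  covariances, from which the independent pairs of walks drop out.\<close>

lemma variance_moment_AN:
  "(\<integral>b. (moment_AN k N b - moment_N p k N)\<^sup>2 \<partial>toeplitz_space p N)
     = (scaling k N)\<^sup>2 * (\<Sum>x\<in>closed_walks k N. \<Sum>y\<in>closed_walks k N.
         wick m {..<2 * k} (append_at k (gap x) (gap y)) - wick m {..<k} (gap x) * wick m {..<k} (gap y))"
proof -
  interpret T: prob_space "toeplitz_space p N" by (rule space_prob)
  have "(\<integral>b. (moment_AN k N b - moment_N p k N)\<^sup>2 \<partial>toeplitz_space p N)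
      = (\<integral>b. (moment_AN k N b)\<^sup>2 \<partial>toeplitz_space p N) - (moment_N p k N)\<^sup>2"
    unfolding moment_N_def by (rule T.variance_eq[OF integrable_moment_AN integrable_moment_AN_square])
  also have "(\<integral>b. (moment_AN k N b)\<^sup>2 \<partial>toeplitz_space p N)
      = (scaling k N)\<^sup>2 * (\<Sum>x\<in>closed_walks k N. \<Sum>y\<in>closed_walks k N. wick m {..<2 * k} (append_at k (gap x) (gap y)))"
  proof -
    have "(\<integral>b. (\<Prod>j<2 * k. toeplitz_entry b (append_at k (gap x) (gap y) j)) \<partial>toeplitz_space p N)
          = wick m {..<2 * k} (append_at k (gap x) (gap y))"
      "integrable (toeplitz_space p N) (\<lambda>b. \<Prod>j<2 * k. toeplitz_entry b (append_at k (gap x) (gap y) j))"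
      if "x \<in> closed_walks k N" "y \<in> closed_walks k N" for x y
      using append_at_gap_bound[OF that] by (intro integral_prod_entries integrable_prod_entries; simp)+
    then show ?thesis
      unfolding moment_AN_square by (simp add: Bochner_Integration.integral_sum Bochner_Integration.integrable_sum)
  qed
  also have "(moment_N p k N)\<^sup>2 = (scaling k N)\<^sup>2 * (\<Sum>x\<in>closed_walks k N. \<Sum>y\<in>closed_walks k N.
      wick m {..<k} (gap x) * wick m {..<k} (gap y))"
    unfolding moment_N_eq power_mult_distrib by (simp add: power2_eq_square sum_product)
  finally show ?thesis by (simp add: sum_subtractf right_diff_distrib)
qed

end

section \<open>Pairings and degenerate configurations\<close>

text \<open>Since \<open>c i0\<close> is non-zero, the value of the form and the coordinates other
  than \<open>i0\<close> determine \<open>q\<close>.\<close>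

lemma card_linear_form_le:
  fixes c :: "'i \<Rightarrow> int"
  assumes I: "finite I" "i0 \<in> I" "c i0 \<noteq> 0" and B: "finite B" and T: "finite T"
  shows "card {q \<in> I \<rightarrow>\<^sub>E B. (\<Sum>i\<in>I. c i * q i) \<in> T} \<le> card T * card B ^ (card I - 1)"
proof -
  let ?f = "\<lambda>q. (\<Sum>i\<in>I. c i * q i, restrict q (I - {i0}))"
  have "inj_on ?f (I \<rightarrow>\<^sub>E B)"
  proof (rule inj_onI)
    fix q q' assume q: "q \<in> I \<rightarrow>\<^sub>E B" "q' \<in> I \<rightarrow>\<^sub>E B" and eq: "?f q = ?f q'"
    have off: "q i = q' i" if "i \<in> I - {i0}" for i
      using eq that by (metis (no_types, lifting) prod.inject restrict_apply')
    have "(\<Sum>i\<in>I. c i * q i) = c i0 * q i0 + (\<Sum>i\<in>I - {i0}. c i * q i)" for q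
      using I by (simp add: sum.remove)
    moreover have "(\<Sum>i\<in>I - {i0}. c i * q i) = (\<Sum>i\<in>I - {i0}. c i * q' i)"
      using off by (intro sum.cong) auto
    ultimately have "c i0 * q i0 = c i0 * q' i0" using eq by auto
    then have "q i0 = q' i0" using I by simp
    then show "q = q'" using off q by (intro PiE_ext[of q I _ q']) auto
  qed
  then have "inj_on ?f {q \<in> I \<rightarrow>\<^sub>E B. (\<Sum>i\<in>I. c i * q i) \<in> T}"
    by (rule inj_on_subset) auto
  moreover have "?f ` {q \<in> I \<rightarrow>\<^sub>E B. (\<Sum>i\<in>I. c i * q i) \<in> T} \<subseteq> T \<times> ((I - {i0}) \<rightarrow>\<^sub>E B)"
    by (auto simp: PiE_def)
  ultimately have "card {q \<in> I \<rightarrow>\<^sub>E B. (\<Sum>i\<in>I. c i * q i) \<in> T} \<le> card (T \<times> ((I - {i0}) \<rightarrow>\<^sub>E B))"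
    using I B T by (intro card_inj_on_le) (auto intro!: finite_PiE)
  also have "\<dots> = card T * card B ^ (card I - 1)"
    using I by (simp add: card_cartesian_product card_PiE)
  finally show ?thesis .
qed

abbreviation sym_range :: "nat \<Rightarrow> int set" where
  "sym_range N \<equiv> {- int N<..<int N}"

text \<open>A tuple is encoded by its signs, a list of \<open>r\<close> absolute values and, for
  each position, the place of its value in that list.\<close>

lemma card_few_values_le:
  fixes J :: "'a set"
  assumes J: "finite J" and N: "N > 0"
  shows "card {z \<in> J \<rightarrow>\<^sub>E sym_range N. card ((\<lambda>j. nat \<bar>z j\<bar>) ` J - {0}) \<le> r}
     \<le> 2 ^ card J * Suc r ^ card J * N ^ r"
proof -
  let ?Z = "{z \<in> J \<rightarrow>\<^sub>E sym_range N. card ((\<lambda>j. nat \<bar>z j\<bar>) ` J - {0}) \<le> r}"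
  let ?D = "(J \<rightarrow>\<^sub>E {1, -1 :: int}) \<times> (J \<rightarrow>\<^sub>E {..r}) \<times> ({..<r} \<rightarrow>\<^sub>E {..<N})"
  \<comment> \<open>Label \<open>r\<close> is reserved for the value 0, which accounts for the base
    \<open>Suc r\<close>.\<close>
  let ?dec = "\<lambda>(s, f, g). \<lambda>j\<in>J. s j * (if f j < r then int (g (f j)) else 0)"
  have "?Z \<subseteq> ?dec ` ?D"
  proof
    fix z assume z: "z \<in> ?Z"
    define V where "V = (\<lambda>j. nat \<bar>z j\<bar>) ` J - {0}"
    have V: "finite V" "card V \<le> r" using z J by (auto simp: V_def)
    obtain h where h: "bij_betw h {..<card V} V"
      using ex_bij_betw_nat_finite[OF V(1)] by (auto simp: atLeast0LessThan)
    have Vlt: "v < N" if "v \<in> V" for v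
      using that z by (auto simp: V_def PiE_def Pi_def)
    \<comment> \<open>Places beyond \<open>card V\<close> are filled with 0, which is below
      \<open>N\<close> because \<open>N > 0\<close>.\<close>
    define g where "g = (\<lambda>i\<in>{..<r}. if i < card V then h i else 0)"
    define f where "f = (\<lambda>j\<in>J. if z j = 0 then r else the_inv_into {..<card V} h (nat \<bar>z j\<bar>))"
    define s :: "'a \<Rightarrow> int" where "s = (\<lambda>j\<in>J. if z j < 0 then -1 else 1)"
    have fj: "f j < card V" "g (f j) = nat \<bar>z j\<bar>" if "j \<in> J" "z j \<noteq> 0" for j
    proof -
      have "nat \<bar>z j\<bar> \<in> V" using that by (auto simp: V_def)
      then have "f j < card V" "h (f j) = nat \<bar>z j\<bar>"
        using h that the_inv_into_into[of h "{..<card V}" "nat \<bar>z j\<bar>" "{..<card V}"]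
          f_the_inv_into_f[of h "{..<card V}" "nat \<bar>z j\<bar>"]
        by (auto simp: f_def bij_betw_def)
      then show "f j < card V" "g (f j) = nat \<bar>z j\<bar>" using V by (auto simp: g_def)
    qed
    have f0: "f j = r" if "j \<in> J" "z j = 0" for j using that by (simp add: f_def)
    have "z = ?dec (s, f, g)"
    proof
      fix j show "z j = ?dec (s, f, g) j"
      proof (cases "j \<in> J")
        case True
        then show ?thesis using fj[of j] f0[of j] V by (cases "z j = 0") (auto simp: s_def)
      next
        case False
        then show ?thesis using z by (auto simp: PiE_def extensional_def)
      qed
    qed
    moreover have "(s, f, g) \<in> ?D"
    proof -
      have "f j \<le> r" if "j \<in> J" for j
        using fj(1)[OF that] f0[OF that] V(2) by (cases "z j = 0") auto
      moreover have "g i < N" if "i < r" for i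
        using that h N Vlt by (auto simp: g_def bij_betw_def)
      moreover have "f \<in> extensional J" "g \<in> extensional {..<r}" "s \<in> J \<rightarrow>\<^sub>E {1, -1}"
        unfolding f_def g_def s_def by auto
      ultimately show ?thesis by (auto simp: PiE_def)
    qed
    ultimately show "z \<in> ?dec ` ?D" by blast
  qed
  moreover have "finite ?D" using J by (intro finite_cartesian_product finite_PiE) auto
  ultimately have "card ?Z \<le> card ?D"
    by (meson card_image_le card_mono finite_imageI le_trans)
  also have "card ?D = 2 ^ card J * (Suc r ^ card J * N ^ r)"
    using J by (simp add: card_cartesian_product card_PiE numeral_2_eq_2)
  finally show ?thesis by (simp add: mult_ac)
qed

text \<open>Perfect matchings of \<open>J\<close>, encoded as fixed-point-free involutions;
  extensionality makes them a finite set and lets equality be checked on \<open>J\<close>.\<close>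

definition pairings :: "'a set \<Rightarrow> ('a \<Rightarrow> 'a) set" where
  "pairings J = {\<pi> \<in> J \<rightarrow>\<^sub>E J. \<forall>j\<in>J. \<pi> j \<noteq> j \<and> \<pi> (\<pi> j) = j}"

lemma finite_pairings: "finite J \<Longrightarrow> finite (pairings J)"
  unfolding pairings_def by (auto intro!: finite_PiE)

lemma pairingsD:
  assumes "\<pi> \<in> pairings J" "j \<in> J"
  shows "\<pi> j \<in> J" "\<pi> j \<noteq> j" "\<pi> (\<pi> j) = j"
  using assms by (auto simp: pairings_def)

lemma compatible_pairing_mult_ge_2:
  assumes "finite J" "\<pi> \<in> pairings J" "\<forall>j\<in>J. w (\<pi> j) = w j" "v \<in> w ` J"
  shows "mult_of J w v \<ge> 2"
proof -
  obtain j where j: "j \<in> J" "v = w j" using assms by auto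
  have "card {j, \<pi> j} \<le> mult_of J w v"
    unfolding mult_of_def using assms j pairingsD[OF assms(2) j(1)] by (intro card_mono) auto
  then show ?thesis using pairingsD(2)[OF assms(2) j(1)] by auto
qed

text \<open>The multiplicities are at least 2 and sum to \<open>card J\<close>, while at least
  \<open>card J / 2\<close> non-zero values occur; hence there is no room for the value 0 or for a
  third occurrence.\<close>

lemma exact_pairs:
  assumes J: "finite J" and few: "card J \<le> 2 * card (w ` J - {0 :: nat})"
    and ge2: "\<forall>v\<in>w ` J. mult_of J w v \<ge> 2"
  shows "0 \<notin> w ` J" "\<forall>v\<in>w ` J. mult_of J w v = 2"
proof -
  have s: "(\<Sum>v\<in>w ` J. mult_of J w v) = card J" using J by (intro sum_mult_of) auto
  have "(\<Sum>v\<in>w ` J. 2) \<le> (\<Sum>v\<in>w ` J. mult_of J w v)" using ge2 by (intro sum_mono) auto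
  then have le: "2 * card (w ` J) \<le> card J" using s by simp
  show "0 \<notin> w ` J"
  proof
    assume "0 \<in> w ` J"
    then have "card (w ` J - {0}) < card (w ` J)" using J by (intro psubset_card_mono) auto
    then show False using le few by simp
  qed
  then have "(\<Sum>v\<in>w ` J. mult_of J w v) = (\<Sum>v\<in>w ` J. 2)" using s le few by simp
  then have z: "(\<Sum>v\<in>w ` J. mult_of J w v - 2) = 0" using ge2 by (subst sum_subtractf_nat) auto
  show "\<forall>v\<in>w ` J. mult_of J w v = 2"
  proof
    fix v assume v: "v \<in> w ` J"
    then have "mult_of J w v - 2 = 0" using z J by (meson finite_imageI sum_eq_0_iff)
    moreover have "mult_of J w v \<ge> 2" using ge2 v by blast
    ultimately show "mult_of J w v = 2" by linarith
  qed
qed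

text \<open>Each fibre of \<open>w\<close> has two elements, and exchanging them is the only
  compatible pairing. The second conclusion identifies the partner of an index, which later exposes
  a pair joining two walks.\<close>

lemma exact_pairs_pairing:
  assumes J: "finite J" and two: "\<forall>v\<in>w ` J. mult_of J w v = 2"
  obtains \<pi> where "{\<pi> \<in> pairings J. \<forall>j\<in>J. w (\<pi> j) = w j} = {\<pi>}"
    "\<And>i j. i \<in> J \<Longrightarrow> j \<in> J \<Longrightarrow> i \<noteq> j \<Longrightarrow> w i = w j \<Longrightarrow> \<pi> j = i"
proof -
  have ex: "\<exists>i. {i' \<in> J. w i' = w j} = {j, i} \<and> i \<noteq> j" if "j \<in> J" for j
  proof -
    have "card {i \<in> J. w i = w j} = 2" using two that by (auto simp: mult_of_def)
    then obtain a b where ab: "{i \<in> J. w i = w j} = {a, b}" "a \<noteq> b" by (meson card_2_iff)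
    then have "j = a \<or> j = b" using that by auto
    then show ?thesis using ab by (auto simp: insert_commute)
  qed
  then obtain f where f: "{i' \<in> J. w i' = w j} = {j, f j} \<and> f j \<noteq> j" if "j \<in> J" for j by metis
  define \<pi> where "\<pi> = restrict f J"
  have uniq: "\<pi> j = i" if "i \<in> J" "j \<in> J" "i \<noteq> j" "w i = w j" for i j
    using f[OF that(2)] that by (auto simp: \<pi>_def)
  have fJ: "f j \<in> J" "w (f j) = w j" if "j \<in> J" for j using f[OF that] by auto
  have mem: "\<pi> \<in> pairings J" "\<forall>j\<in>J. w (\<pi> j) = w j"
  proof -
    have "\<pi> (\<pi> j) = j" if "j \<in> J" for j
      using uniq[of j "f j"] fJ[OF that] f[OF that] that by (auto simp: \<pi>_def)
    then show "\<pi> \<in> pairings J" using fJ f by (auto simp: pairings_def \<pi>_def)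
    show "\<forall>j\<in>J. w (\<pi> j) = w j" using fJ by (auto simp: \<pi>_def)
  qed
  have "\<sigma> = \<pi>" if "\<sigma> \<in> pairings J" "\<forall>j\<in>J. w (\<sigma> j) = w j" for \<sigma>
  proof (rule PiE_ext[of _ J "\<lambda>_. J"])
    show "\<sigma> \<in> J \<rightarrow>\<^sub>E J" "\<pi> \<in> J \<rightarrow>\<^sub>E J" using that mem by (auto simp: pairings_def)
    show "\<sigma> j = \<pi> j" if "j \<in> J" for j
      using uniq[of "\<sigma> j" j] pairingsD[OF \<open>\<sigma> \<in> pairings J\<close> that] \<open>\<forall>j\<in>J. w (\<sigma> j) = w j\<close> that by auto
  qed
  then show ?thesis using that[of \<pi>] mem uniq by blast
qed

lemma wick_singleton_eq_0:
  assumes "finite J" "m 1 = 0" "v \<in> w ` J" "mult_of J w v = 1"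
  shows "wick m J w = 0"
  using assms prod_zero[of "w ` J" "\<lambda>v. m (mult_of J w v)"] unfolding wick_def by fastforce

text \<open>If the non-zero values of \<open>w\<close> are numerous enough, then either some value is attained
  only once, or all values are non-zero and are attained exactly twice.\<close>
lemma wick_eq_card_pairings:
  assumes J: "finite J" and m: "m 1 = 0" "m 2 = 1" and few: "card J \<le> 2 * card (w ` J - {0 :: nat})"
  shows "wick m J w = card {\<pi> \<in> pairings J. \<forall>j\<in>J. w (\<pi> j) = w j}"
proof (cases "\<forall>v\<in>w ` J. mult_of J w v \<ge> 2")
  case True
  note ex = exact_pairs[OF J few True]
  obtain \<pi> where "{\<pi> \<in> pairings J. \<forall>j\<in>J. w (\<pi> j) = w j} = {\<pi>}"
    by (rule exact_pairs_pairing[OF J ex(2)])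
  then have "card {\<pi> \<in> pairings J. \<forall>j\<in>J. w (\<pi> j) = w j} = 1" by (metis is_singletonI is_singleton_altdef)
  moreover have "(\<Prod>v\<in>w ` J. m (mult_of J w v)) = 1" using ex(2) m(2) by (intro prod.neutral) simp
  then have "wick m J w = 1" using ex(1) unfolding wick_def by simp
  ultimately show ?thesis by simp
next
  case False
  then obtain v where v: "v \<in> w ` J" "mult_of J w v < 2" by (meson not_le)
  then have "mult_of J w v = 1" using mult_of_eq_0_iff[OF J, of w v] by linarith
  then have "wick m J w = 0" by (rule wick_singleton_eq_0[where m = m, OF J m(1) v(1)])
  moreover have "{\<pi> \<in> pairings J. \<forall>j\<in>J. w (\<pi> j) = w j} = {}"
    using compatible_pairing_mult_ge_2[OF J _ _ v(1)] v(2) by (metis (mono_tags, lifting) Collect_empty_eq not_less)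
  ultimately show ?thesis by (metis card.empty of_nat_0)
qed

text \<open>The summand 1 makes the base at least 1, so the exponent may be \<open>n\<close> even
  when there are fewer distinct values.\<close>

definition wick_bound :: "(nat \<Rightarrow> real) \<Rightarrow> nat \<Rightarrow> real" where
  "wick_bound m n = (1 + (\<Sum>r\<le>n. \<bar>m r\<bar>)) ^ n"

lemma abs_wick_le:
  assumes J: "finite J"
  shows "\<bar>wick m J w\<bar> \<le> wick_bound m (card J)"
proof (cases "0 \<in> w ` J")
  case True
  then show ?thesis by (simp add: wick_def wick_bound_def sum_nonneg)
next
  case False
  let ?B = "1 + (\<Sum>r\<le>card J. \<bar>m r\<bar>)"
  have B1: "?B \<ge> 1" by (simp add: sum_nonneg)
  have "\<bar>wick m J w\<bar> = (\<Prod>v\<in>w ` J. \<bar>m (mult_of J w v)\<bar>)" using False by (simp add: wick_def abs_prod)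
  also have "\<dots> \<le> (\<Prod>v\<in>w ` J. ?B)"
  proof (intro prod_mono conjI)
    fix v
    have "mult_of J w v \<le> card J" unfolding mult_of_def using J by (intro card_mono) auto
    then have "\<bar>m (mult_of J w v)\<bar> \<le> (\<Sum>r\<le>card J. \<bar>m r\<bar>)"
      by (intro member_le_sum[of _ _ "\<lambda>r. \<bar>m r\<bar>"]) auto
    then show "\<bar>m (mult_of J w v)\<bar> \<le> ?B" by simp
  qed auto
  also have "\<dots> \<le> ?B ^ card J"
    using B1 J by (auto intro!: power_increasing card_image_le)
  finally show ?thesis by (simp add: wick_bound_def)
qed

text \<open>Counting compatible pairings will turn a sum over walks into a sum over pairings of
  numbers of walks. When the values are few, both quantities are merely bounded by constants, since
  such configurations will be rare.\<close>

lemma wick_approx: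
  assumes J: "finite J" and m: "m 1 = 0" "m 2 = 1"
  shows "\<bar>wick m J w - card {\<pi> \<in> pairings J. \<forall>j\<in>J. w (\<pi> j) = w j}\<bar>
     \<le> (if 2 * card (w ` J - {0 :: nat}) < card J then wick_bound m (card J) + card (pairings J) else 0)"
proof (cases "2 * card (w ` J - {0}) < card J")
  case True
  have "card {\<pi> \<in> pairings J. \<forall>j\<in>J. w (\<pi> j) = w j} \<le> card (pairings J)"
    using J by (intro card_mono finite_pairings) auto
  then show ?thesis using True abs_wick_le[OF J, of m w] by auto
next
  case False
  then show ?thesis using wick_eq_card_pairings[OF J, of m w] m by simp
qed

text \<open>Choosing one representative per pair lets the values at the representatives parametrize
  the functions compatible with a pairing.\<close>

definition openers :: "('a :: linorder \<Rightarrow> 'a) \<Rightarrow> 'a set \<Rightarrow> 'a set" where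
  "openers \<pi> J = {j \<in> J. j < \<pi> j}"

lemma pairing_split:
  assumes "\<pi> \<in> pairings J"
  shows "openers \<pi> J \<union> \<pi> ` openers \<pi> J = J" "openers \<pi> J \<inter> \<pi> ` openers \<pi> J = {}"
    "inj_on \<pi> (openers \<pi> J)"
proof -
  have "j \<in> \<pi> ` openers \<pi> J" if "j \<in> J" "j \<notin> openers \<pi> J" for j
    using pairingsD[OF assms that(1)] that by (auto simp: openers_def intro!: image_eqI[of _ _ "\<pi> j"])
  then show "openers \<pi> J \<union> \<pi> ` openers \<pi> J = J"
    using pairingsD[OF assms] by (auto simp: openers_def)
  show "openers \<pi> J \<inter> \<pi> ` openers \<pi> J = {}"
    using pairingsD[OF assms] by (force simp: openers_def)
  show "inj_on \<pi> (openers \<pi> J)"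
  proof (rule inj_onI)
    fix i j assume "i \<in> openers \<pi> J" "j \<in> openers \<pi> J" and eq: "\<pi> i = \<pi> j"
    then have "i \<in> J" "j \<in> J" by (auto simp: openers_def)
    then show "i = j" using pairingsD(3)[OF assms] eq by metis
  qed
qed

lemma sum_pairing_split:
  fixes f :: "'a :: linorder \<Rightarrow> 'b :: comm_monoid_add"
  assumes "finite J" "\<pi> \<in> pairings J"
  shows "sum f J = (\<Sum>r\<in>openers \<pi> J. f r + f (\<pi> r))"
proof -
  have "finite (openers \<pi> J)" using assms by (simp add: openers_def)
  then have "sum f (openers \<pi> J \<union> \<pi> ` openers \<pi> J) = (\<Sum>r\<in>openers \<pi> J. f r + f (\<pi> r))"
    using pairing_split(2,3)[OF assms(2)]
    by (subst sum.union_disjoint) (auto simp: sum.reindex sum.distrib)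
  then show ?thesis using pairing_split(1)[OF assms(2)] by simp
qed

lemma card_openers: "finite J \<Longrightarrow> \<pi> \<in> pairings J \<Longrightarrow> card J = 2 * card (openers \<pi> J)"
  using sum_pairing_split[of J \<pi> "\<lambda>_. 1 :: nat"] by simp

text \<open>A compatible \<open>z\<close> is determined by its signs and its values at the openers, and a linear
  relation with a non-zero coefficient removes one of these degrees of freedom.\<close>
lemma card_degenerate_le:
  fixes J :: "'a :: linorder set"
  assumes J: "finite J" and \<pi>: "\<pi> \<in> pairings J" and K: "K \<subseteq> J"
  shows "card {z \<in> J \<rightarrow>\<^sub>E sym_range N. (\<forall>j\<in>J. \<bar>z (\<pi> j)\<bar> = \<bar>z j\<bar>) \<and> sum z K = 0 \<and>
             (\<exists>j\<in>K. \<pi> j \<notin> K \<or> z (\<pi> j) = z j)}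
       \<le> 2 ^ card (openers \<pi> J) * (2 * N) ^ (card (openers \<pi> J) - 1)"
proof -
  let ?R = "openers \<pi> J"
  let ?Z = "{z \<in> J \<rightarrow>\<^sub>E sym_range N. (\<forall>j\<in>J. \<bar>z (\<pi> j)\<bar> = \<bar>z j\<bar>) \<and> sum z K = 0 \<and>
             (\<exists>j\<in>K. \<pi> j \<notin> K \<or> z (\<pi> j) = z j)}"
  have R: "finite ?R" using J by (simp add: openers_def)
  \<comment> \<open>Coefficient of \<open>z r\<close> in \<open>sum z K\<close> after
    \<open>z (\<pi> r)\<close> is replaced by \<open>s r * z r\<close>.\<close>
  define c :: "('a \<Rightarrow> int) \<Rightarrow> 'a \<Rightarrow> int" where
    "c = (\<lambda>s r. of_bool (r \<in> K) + s r * of_bool (\<pi> r \<in> K))"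
  define S where "S = {s \<in> ?R \<rightarrow>\<^sub>E {1, -1}. \<exists>r\<in>?R. c s r \<noteq> 0}"
  define X where "X = (\<lambda>s. {q \<in> ?R \<rightarrow>\<^sub>E sym_range N. (\<Sum>r\<in>?R. c s r * q r) \<in> {0}})"
  define sg :: "('a \<Rightarrow> int) \<Rightarrow> 'a \<Rightarrow> int" where
    "sg = (\<lambda>z. \<lambda>r\<in>?R. if z (\<pi> r) = z r then 1 else -1)"
  have sg: "z (\<pi> r) = sg z r * z r" if "z \<in> ?Z" "r \<in> ?R" for z r
  proof -
    have "\<bar>z (\<pi> r)\<bar> = \<bar>z r\<bar>" using that by (auto simp: openers_def)
    then have "z (\<pi> r) = z r \<or> z (\<pi> r) = - z r" by linarith
    then show ?thesis using that(2) by (auto simp: sg_def)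
  qed
  let ?f = "\<lambda>z. (sg z, restrict z ?R)"
  have inj: "inj_on ?f ?Z"
  proof (rule inj_onI)
    fix z z' assume z: "z \<in> ?Z" "z' \<in> ?Z" and eq: "?f z = ?f z'"
    have sgeq: "sg z = sg z'" and restr: "restrict z ?R = restrict z' ?R"
      using eq by (simp_all only: prod.inject)
    have req: "z r = z' r" if "r \<in> ?R" for r
      using fun_cong[OF restr, of r] that by simp
    have "z j = z' j" if "j \<in> J" for j
    proof -
      have "j \<in> ?R \<union> \<pi> ` ?R" unfolding pairing_split(1)[OF \<pi>] by (rule that)
      then consider "j \<in> ?R" | r where "r \<in> ?R" "j = \<pi> r" by blast
      then show ?thesis
      proof cases
        case 1 then show ?thesis by (rule req)
      next
        case 2
        have "z (\<pi> r) = sg z' r * z' r" unfolding sg[OF z(1) 2(1)] sgeq req[OF 2(1)] ..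
        then show ?thesis unfolding 2(2) sg[OF z(2) 2(1)] .
      qed
    qed
    then show "z = z'" using z by (intro PiE_ext[of z J _ z']) auto
  qed
  have sub: "?f ` ?Z \<subseteq> Sigma S X"
  proof
    fix y assume "y \<in> ?f ` ?Z"
    then obtain z where z: "z \<in> ?Z" "y = ?f z" by blast
    have "sum z K = (\<Sum>j\<in>J. of_bool (j \<in> K) * z j)"
      using sum.inter_restrict[OF J, of z K] K by (auto simp: Int_absorb1 intro!: sum.cong)
    also have "\<dots> = (\<Sum>r\<in>?R. of_bool (r \<in> K) * z r + of_bool (\<pi> r \<in> K) * z (\<pi> r))"
      by (rule sum_pairing_split[OF J \<pi>])
    also have "\<dots> = (\<Sum>r\<in>?R. c (sg z) r * restrict z ?R r)"
      by (intro sum.cong refl) (simp add: sg[OF z(1)] c_def algebra_simps)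
    finally have "(\<Sum>r\<in>?R. c (sg z) r * restrict z ?R r) = 0" using z(1) by simp
    then have "restrict z ?R \<in> X (sg z)"
      using z(1) by (auto simp: X_def openers_def PiE_def)
    moreover have "sg z \<in> S"
    proof -
      obtain j where j: "j \<in> K" "\<pi> j \<notin> K \<or> z (\<pi> j) = z j" using z(1) by blast
      have jJ: "j \<in> J" using j K by auto
      note d = pairingsD[OF \<pi> jJ]
      \<comment> \<open>At the representative of the pair of \<open>j\<close> the coefficient is 1
        or -1 if only \<open>j\<close> lies in \<open>K\<close>, and 2 if both indices do, because
        their entries then agree.\<close>
      have "\<exists>r\<in>?R. c (sg z) r \<noteq> 0"
      proof (cases "j < \<pi> j")
        case True
        then have "j \<in> ?R" using jJ by (simp add: openers_def)
        moreover have "c (sg z) j \<noteq> 0"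
          using j \<open>j \<in> ?R\<close> by (cases "\<pi> j \<in> K"; cases "z (\<pi> j) = z j") (simp_all add: c_def sg_def)
        ultimately show ?thesis by blast
      next
        case False
        then have r: "\<pi> j \<in> ?R" using d by (auto simp: openers_def)
        moreover have "c (sg z) (\<pi> j) \<noteq> 0"
          using j r d by (cases "\<pi> j \<in> K"; cases "z (\<pi> j) = z j") (simp_all add: c_def sg_def)
        ultimately show ?thesis by blast
      qed
      then show ?thesis by (auto simp: S_def sg_def)
    qed
    ultimately show "y \<in> Sigma S X" using z by auto
  qed
  have finS: "finite S" using R by (auto simp: S_def intro!: finite_PiE)
  have finX: "finite (X s)" for s using R by (auto simp: X_def intro!: finite_PiE)
  have "card ?Z \<le> card (Sigma S X)"
    using inj sub finS finX by (intro card_inj_on_le) auto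
  also have "\<dots> = (\<Sum>s\<in>S. card (X s))" using finS finX by (simp add: card_SigmaI)
  also have "\<dots> \<le> (\<Sum>s\<in>S. (2 * N) ^ (card ?R - 1))"
  proof (rule sum_mono)
    fix s assume "s \<in> S"
    then obtain r where r: "r \<in> ?R" "c s r \<noteq> 0" by (auto simp: S_def)
    have "card (X s) \<le> card {0 :: int} * card (sym_range N) ^ (card ?R - 1)"
      unfolding X_def by (rule card_linear_form_le[where c = "c s", OF R r]) auto
    also have "card (sym_range N) ^ (card ?R - 1) \<le> (2 * N) ^ (card ?R - 1)"
      by (rule power_mono) auto
    finally have "card (X s) \<le> card {0 :: int} * (2 * N) ^ (card ?R - 1)" by simp
    then show "card (X s) \<le> (2 * N) ^ (card ?R - 1)" by simp
  qed
  also have "\<dots> = card S * (2 * N) ^ (card ?R - 1)" by simp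
  also have "card S \<le> card (?R \<rightarrow>\<^sub>E {1, -1 :: int})"
    using R by (intro card_mono finite_PiE) (auto simp: S_def)
  also have "\<dots> = 2 ^ card ?R" using R by (simp add: card_PiE numeral_2_eq_2)
  finally show ?thesis by simp
qed

section \<open>Lattice points of dilated polytopes\<close>

text \<open>Integer points of the dilation by \<open>N\<close> of a polytope cut from a box by one
  slab for each partial sum. Half-open intervals let division with remainder by \<open>M\<close>
  split the box of size \<open>N * M\<close> exactly.\<close>

definition lattice_points :: "'i set \<Rightarrow> 'i set set \<Rightarrow> nat \<Rightarrow> ('i \<Rightarrow> int) set" where
  "lattice_points I \<S> N = {q \<in> I \<rightarrow>\<^sub>E {- int N..<int N}. \<forall>S\<in>\<S>. 0 \<le> sum q S \<and> sum q S < int N}"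

lemma finite_lattice_points: "finite I \<Longrightarrow> finite (lattice_points I \<S> N)"
  unfolding lattice_points_def by (auto intro!: finite_PiE)

lemma card_subset_sum_le:
  assumes "finite I" "S \<subseteq> I" "S \<noteq> {}" "finite T"
  shows "card {q \<in> I \<rightarrow>\<^sub>E {- int N..<int N}. sum q S \<in> T} \<le> card T * (2 * N) ^ (card I - 1)"
proof -
  obtain i0 where i0: "i0 \<in> I" "(of_bool (i0 \<in> S) :: int) \<noteq> 0" using assms by auto
  have "(\<Sum>i\<in>I. of_bool (i \<in> S) * q i) = sum q S" for q :: "'a \<Rightarrow> int"
    using sum.inter_restrict[OF assms(1), of q S] assms(2) by (auto simp: Int_absorb1 intro!: sum.cong)
  then show ?thesis
    using card_linear_form_le[where c = "\<lambda>i. of_bool (i \<in> S)" and B = "{- int N..<int N}", OF assms(1) i0 _ assms(4)]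
    by (simp add: mult_2[symmetric] nat_mult_distrib del: sum_of_bool_mult_eq)
qed

text \<open>Writing a point at scale \<open>N * M\<close> as \<open>M * q + r\<close> with \<open>0 \<le> r < M\<close>, the constraints on the
  point and on \<open>q\<close> can only disagree when some \<open>sum q S\<close> is within \<open>card I\<close> of \<open>0\<close> or \<open>N\<close>.\<close>
lemma card_lattice_points_scale:
  assumes I: "finite I" and S: "finite \<S>" "\<And>S. S \<in> \<S> \<Longrightarrow> S \<subseteq> I \<and> S \<noteq> {}" and M: "M > 0"
  shows "\<bar>real (card (lattice_points I \<S> (N * M))) - real M ^ card I * real (card (lattice_points I \<S> N))\<bar>
    \<le> real M ^ card I * (real (card \<S>) * (2 * real (card I) * (2 * real N) ^ (card I - 1)))"
proof -
  define d where "d = card I"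
  let ?Q = "I \<rightarrow>\<^sub>E {- int N..<int N}" and ?R = "I \<rightarrow>\<^sub>E {0..<int M}"
  \<comment> \<open>\<open>G1\<close> is the set at scale \<open>N * M\<close> in quotient and
    remainder coordinates; in \<open>G2\<close> the constraints see only the quotient.\<close>
  define G1 where "G1 = {(q, r) \<in> ?Q \<times> ?R. \<forall>S\<in>\<S>. 0 \<le> int M * sum q S + sum r S \<and> int M * sum q S + sum r S < int (N * M)}"
  define G2 where "G2 = lattice_points I \<S> N \<times> ?R"
  \<comment> \<open>The remainders add between 0 and \<open>d * M\<close> to
    \<open>M * sum q S\<close>, so a constraint can change its truth value only in these layers of
    width \<open>d\<close> below 0 and below \<open>N\<close>.\<close>
  define T where "T = {- int d..<0} \<union> {int N - int d..<int N}"
  define Z where "Z = (\<Union>S\<in>\<S>. {q \<in> ?Q. sum q S \<in> T} \<times> ?R)"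
  have fin: "finite ?Q" "finite ?R" using I by (auto intro!: finite_PiE)
  have cR: "card ?R = M ^ d" using I by (simp add: card_PiE d_def)
  have "bij_betw (\<lambda>(q, r). \<lambda>i\<in>I. int M * q i + r i) G1 (lattice_points I \<S> (N * M))"
  proof (rule bij_betw_byWitness[where f' = "\<lambda>y. (\<lambda>i\<in>I. y i div int M, \<lambda>i\<in>I. y i mod int M)"])
    have sm: "sum (\<lambda>i\<in>I. int M * q i + r i) S = int M * sum q S + sum r S" if "S \<in> \<S>" for q r S
    proof -
      have "sum (\<lambda>i\<in>I. int M * q i + r i) S = (\<Sum>i\<in>S. int M * q i + r i)"
        using S(2)[OF that] by (intro sum.cong) auto
      then show ?thesis by (simp add: sum.distrib sum_distrib_left)
    qed
    show "\<forall>a\<in>G1. (\<lambda>y. (\<lambda>i\<in>I. y i div int M, \<lambda>i\<in>I. y i mod int M)) ((\<lambda>(q, r). \<lambda>i\<in>I. int M * q i + r i) a) = a"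
      using M by (auto simp: G1_def PiE_def Pi_def extensional_def fun_eq_iff restrict_def)
    show "\<forall>y\<in>lattice_points I \<S> (N * M). (\<lambda>(q, r). \<lambda>i\<in>I. int M * q i + r i) (\<lambda>i\<in>I. y i div int M, \<lambda>i\<in>I. y i mod int M) = y"
      by (auto simp: lattice_points_def PiE_def extensional_def fun_eq_iff restrict_def)
    show "(\<lambda>(q, r). \<lambda>i\<in>I. int M * q i + r i) ` G1 \<subseteq> lattice_points I \<S> (N * M)"
    proof clarify
      fix q r assume qr: "(q, r) \<in> G1"
      have "- int (N * M) \<le> int M * q i + r i \<and> int M * q i + r i < int (N * M)" if "i \<in> I" for i
      proof -
        have b: "- int N \<le> q i" "q i + 1 \<le> int N" "0 \<le> r i" "r i < int M"
          using qr that by (auto simp: G1_def PiE_def Pi_def)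
        have "int M * (- int N) \<le> int M * q i" "int M * (q i + 1) \<le> int M * int N"
          using b by (intro mult_left_mono; simp)+
        then show ?thesis using b by (simp add: algebra_simps)
      qed
      then show "(\<lambda>i\<in>I. int M * q i + r i) \<in> lattice_points I \<S> (N * M)"
        using qr sm by (auto simp: lattice_points_def G1_def)
    qed
    show "(\<lambda>y. (\<lambda>i\<in>I. y i div int M, \<lambda>i\<in>I. y i mod int M)) ` lattice_points I \<S> (N * M) \<subseteq> G1"
    proof clarify
      fix y assume y: "y \<in> lattice_points I \<S> (N * M)"
      have "- int N \<le> y i div int M \<and> y i div int M < int N" if "i \<in> I" for i
      proof -
        have b: "- int N * int M \<le> y i" "y i < int N * int M" using y that by (auto simp: lattice_points_def PiE_def Pi_def)
        have "- int N * int M div int M \<le> y i div int M" using b(1) M by (intro zdiv_mono1) auto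
        moreover have "y i div int M < int N" 
        proof -
          have "y i div int M * int M \<le> y i" using M by (simp flip: minus_mod_eq_div_mult)
          then have "y i div int M * int M < int N * int M" using b(2) by linarith
          then show ?thesis using M by simp
        qed
        moreover have "- int N * int M div int M = - int N" using M by (intro nonzero_mult_div_cancel_right) simp
        ultimately show ?thesis by simp
      qed
      moreover have "int M * sum (\<lambda>i\<in>I. y i div int M) S + sum (\<lambda>i\<in>I. y i mod int M) S = sum y S" if "S \<in> \<S>" for S
      proof -
        have "sum (\<lambda>i\<in>I. y i div int M) S = (\<Sum>i\<in>S. y i div int M)"
          "sum (\<lambda>i\<in>I. y i mod int M) S = (\<Sum>i\<in>S. y i mod int M)"
          using S(2)[OF that] by (auto intro!: sum.cong)
        then show ?thesis by (simp add: sum_distrib_left sum.distrib[symmetric])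
      qed
      ultimately show "(\<lambda>i\<in>I. y i div int M, \<lambda>i\<in>I. y i mod int M) \<in> G1"
        using y M unfolding G1_def by (auto simp: lattice_points_def)
    qed
  qed
  then have c1: "card (lattice_points I \<S> (N * M)) = card G1" by (rule bij_betw_same_card[symmetric])
  have c2: "card G2 = M ^ d * card (lattice_points I \<S> N)"
    by (simp add: G2_def card_cartesian_product cR)
  have near: "(q, r) \<in> G1 \<longleftrightarrow> (q, r) \<in> G2" if "q \<in> ?Q" "r \<in> ?R" "(q, r) \<notin> Z" for q r
  proof -
    have "(0 \<le> int M * sum q S + sum r S \<and> int M * sum q S + sum r S < int (N * M)) \<longleftrightarrow> (0 \<le> sum q S \<and> sum q S < int N)"
      if "S \<in> \<S>" for S
    proof -
      define a where "a = sum q S"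
      define \<rho> where "\<rho> = sum r S"
      have fS: "finite S" "card S \<le> d" using S(2)[OF that] I by (auto simp: d_def finite_subset card_mono)
      have "r i \<ge> 0 \<and> r i \<le> int M" if "i \<in> S" for i
        using \<open>r \<in> ?R\<close> S(2)[OF \<open>S \<in> \<S>\<close>] that by (force simp: PiE_def Pi_def)
      then have "0 \<le> \<rho>" "\<rho> \<le> int (card S) * int M"
        unfolding \<rho>_def by (auto intro!: sum_nonneg sum_bounded_above)
      then have \<rho>: "0 \<le> \<rho>" "\<rho> \<le> int d * int M"
        using fS(2) mult_right_mono[of "int (card S)" "int d" "int M"] by linarith+
      have aT: "a \<notin> T" using that \<open>(q, r) \<notin> Z\<close> \<open>q \<in> ?Q\<close> \<open>r \<in> ?R\<close> by (auto simp: Z_def a_def)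
      consider "a < - int d" | "0 \<le> a" "a < int N - int d" | "a \<ge> int N" | "a \<ge> 0 \<and> a < int N \<and> a = int N - int d" using aT unfolding T_def by force
      then have "(0 \<le> int M * a + \<rho> \<and> int M * a + \<rho> < int M * int N) \<longleftrightarrow> (0 \<le> a \<and> a < int N)"
      proof cases
        case 1
        then have "int M * (a + int d) \<le> int M * (- 1)" by (intro mult_left_mono) auto
        then show ?thesis using \<rho> 1 M by (simp add: algebra_simps)
      next
        case 2
        then have "int M * (a + int d) \<le> int M * (int N - 1)" by (intro mult_left_mono) auto
        moreover have "0 \<le> int M * a" using 2 by simp
        ultimately
show ?thesis using \<rho> 2 M by (simp add: algebra_simps)
      next
        case 3
        then have "int M * int N \<le> int M * a" by (intro mult_left_mono) auto
        then show ?thesis using \<rho> 3 by simp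
      next
        case 4
        then have "a \<in> T" unfolding T_def by auto
        then show ?thesis using aT by simp
      qed
      then show ?thesis by (simp add: a_def \<rho>_def mult.commute)
    qed
    then show ?thesis using that by (auto simp: G1_def G2_def lattice_points_def)
  qed
  have sub: "G1 \<subseteq> ?Q \<times> ?R" "G2 \<subseteq> ?Q \<times> ?R" by (auto simp: G1_def G2_def lattice_points_def)
  have finG: "finite G1" "finite G2" using sub fin by (meson finite_SigmaI finite_subset)+
  have finZ: "finite Z" using S fin by (auto simp: Z_def)
  have "card G1 \<le> card (G2 \<union> Z)" using near sub finG finZ by (intro card_mono) auto
  then have u1: "card G1 \<le> card G2 + card Z" using card_Un_le le_trans by blast
  have "card G2 \<le> card (G1 \<union> Z)" using near sub finG finZ by (intro card_mono) auto
  then have u2: "card G2 \<le> card G1 + card Z" using card_Un_le le_trans by blast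
  have "card T \<le> card {- int d..<0} + card {int N - int d..<int N}" unfolding T_def by (rule card_Un_le)
  then have cT: "card T \<le> 2 * d" by simp
  have "card Z \<le> (\<Sum>S\<in>\<S>. card ({q \<in> ?Q. sum q S \<in> T} \<times> ?R))"
    unfolding Z_def by (rule card_UN_le[OF S(1)])
  also have "\<dots> \<le> (\<Sum>S\<in>\<S>. (2 * d * (2 * N) ^ (d - 1)) * M ^ d)"
  proof (rule sum_mono)
    fix S assume "S \<in> \<S>"
    then have "card {q \<in> ?Q. sum q S \<in> T} \<le> card T * (2 * N) ^ (d - 1)"
      unfolding d_def using S(2) I by (intro card_subset_sum_le) (auto simp: T_def)
    also have "\<dots> \<le> 2 * d * (2 * N) ^ (d - 1)" using cT by simp
    finally show "card ({q \<in> ?Q. sum q S \<in> T} \<times> ?R) \<le> (2 * d * (2 * N) ^ (d - 1)) * M ^ d"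
      by (simp add: card_cartesian_product cR)
  qed
  also have "\<dots> = M ^ d * (card \<S> * (2 * d * (2 * N) ^ (d - 1)))" by simp
  finally have cZ: "card Z \<le> M ^ d * (card \<S> * (2 * d * (2 * N) ^ (d - 1)))" .
  have "\<bar>real (card G1) - real (card G2)\<bar> \<le> real (card Z)" using u1 u2 by linarith
  also have "\<dots> \<le> real (M ^ d * (card \<S> * (2 * d * (2 * N) ^ (d - 1))))" using cZ of_nat_le_iff by blast
  finally show ?thesis by (simp add: c1 c2 d_def)
qed

definition lattice_density :: "'i set \<Rightarrow> 'i set set \<Rightarrow> nat \<Rightarrow> real" where
  "lattice_density I \<S> N = real (card (lattice_points I \<S> N)) / real N ^ card I"

text \<open>The Lebesgue volume of the polytope, taken as a limit of normalized counts;
  \<open>lattice_density_tendsto\<close> makes \<open>lim\<close> meaningful.\<close>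

definition lattice_volume :: "'i set \<Rightarrow> 'i set set \<Rightarrow> real" where
  "lattice_volume I \<S> = lim (lattice_density I \<S>)"

text \<open>The scales \<open>m\<close> and \<open>n\<close> are compared through their common
  refinement \<open>m * n\<close>. The points near the boundary number at most a constant times
  \<open>N ^ (card I - 1)\<close>, whence the error \<open>C / N\<close>.\<close>

lemma lattice_density_tendsto:
  assumes I: "finite I" "I \<noteq> {}" and S: "finite \<S>" "\<And>S. S \<in> \<S> \<Longrightarrow> S \<subseteq> I \<and> S \<noteq> {}"
  shows "lattice_density I \<S> \<longlonglongrightarrow> lattice_volume I \<S>"
proof -
  let ?g = "lattice_density I \<S>"
  define d where "d = card I"
  have d: "d > 0" using I by (auto simp: d_def card_gt_0_iff)
  define C where "C = real (card \<S>) * (2 * real d * 2 ^ (d - 1))"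
  have C: "C \<ge> 0" by (simp add: C_def)
  have step: "\<bar>?g (N * M) - ?g N\<bar> \<le> C / real N" if "N > 0" "M > 0" for N M
  proof -
    have Nd: "real N ^ d = real N ^ (d - 1) * real N" using d by (metis Suc_diff_1 power_Suc2)
    let ?P = "real N ^ d * real M ^ d"
    have P: "?P > 0" using that by simp
    have "?g (N * M) - ?g N
        = (real (card (lattice_points I \<S> (N * M))) - real M ^ d * real (card (lattice_points I \<S> N))) / ?P"
      using that by (simp add: lattice_density_def d_def[symmetric] power_mult_distrib field_simps)
    then have "\<bar>?g (N * M) - ?g N\<bar>
        = \<bar>real (card (lattice_points I \<S> (N * M))) - real M ^ d * real (card (lattice_points I \<S> N))\<bar> / ?P"
      using P by simp
    also have "\<dots> \<le> real M ^ d * (real (card \<S>) * (2 * real d * (2 * real N) ^ (d - 1))) / ?P"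
      unfolding d_def using card_lattice_points_scale[OF I(1) S that(2)] P
      by (intro divide_right_mono) (auto simp: d_def)
    also have "\<dots> = C / real N"
      using that by (simp add: C_def Nd power_mult_distrib field_simps)
    finally show ?thesis .
  qed
  have "Cauchy ?g"
  proof (rule CauchyI)
    fix e :: real assume e: "e > 0"
    obtain K :: nat where K: "K > 0" "2 * C / e < real K"
      by (metis gt_ex less_trans not_gr_zero of_nat_0_less_iff reals_Archimedean2 max_less_iff_conj)
    show "\<exists>K. \<forall>m\<ge>K. \<forall>n\<ge>K. norm (?g m - ?g n) < e"
    proof (intro exI[of _ K] allI impI)
      fix m n assume mn: "m \<ge> K" "n \<ge> K"
      have "norm (?g m - ?g n) \<le> C / real m + C / real n"
        using step[of m n] step[of n m] mn K by (simp add: mult.commute)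
      also have "\<dots> \<le> C / real K + C / real K"
        using mn K C by (intro add_mono divide_left_mono) auto
      also have "\<dots> < e" using K e by (simp add: field_simps)
      finally show "norm (?g m - ?g n) < e" .
    qed
  qed
  then show ?thesis unfolding lattice_volume_def
    using Cauchy_convergent_iff convergent_LIMSEQ_iff by blast
qed

section \<open>Convergence of the expected moments\<close>

lemma closed_walk_telescope: "(\<Sum>l<j. step x l) = int (x j) - int (x 0)"
  unfolding step_def by (induction j) auto

lemma closed_walk_eqI:
  assumes "x \<in> closed_walks k N" "y \<in> closed_walks k N" "x 0 = y 0" "\<And>j. j < k \<Longrightarrow> step x j = step y j"
  shows "x = y"
proof (rule PiE_ext[of _ "{..k}" "\<lambda>_. {..<N}"])
  show "x \<in> {..k} \<rightarrow>\<^sub>E {..<N}" "y \<in> {..k} \<rightarrow>\<^sub>E {..<N}" using assms by (auto simp: closed_walks_def paths_def)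
  fix j assume "j \<in> {..k}"
  then have "(\<Sum>l<j. step x l) = (\<Sum>l<j. step y l)" using assms(4) by (intro sum.cong) auto
  then show "x j = y j" using assms(3) by (simp add: closed_walk_telescope)
qed

lemma finite_int_functions: "finite J \<Longrightarrow> finite {z \<in> J \<rightarrow>\<^sub>E sym_range N. P z}"
  by (rule finite_subset[of _ "J \<rightarrow>\<^sub>E sym_range N"]) (auto intro!: finite_PiE)

lemma step_mem_sym_range:
  assumes "x \<in> closed_walks k N" "j < k"
  shows "step x j \<in> sym_range N"
  using step_bounds(1)[OF assms] by (simp add: abs_less_iff minus_less_iff)

lemma restrict_step_mem:
  assumes "x \<in> closed_walks k N"
  shows "restrict (step x) {..<k} \<in> {..<k} \<rightarrow>\<^sub>E sym_range N" "(\<Sum>j<k. restrict (step x) {..<k} j) = 0"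
proof -
  show "restrict (step x) {..<k} \<in> {..<k} \<rightarrow>\<^sub>E sym_range N"
    using step_mem_sym_range[OF assms] by (intro restrict_PiE_iff[THEN iffD2]) auto
  have "(\<Sum>j<k. restrict (step x) {..<k} j) = (\<Sum>j<k. step x j)" by (intro sum.cong) auto
  then show "(\<Sum>j<k. restrict (step x) {..<k} j) = 0"
    using assms by (simp add: closed_walk_telescope closed_walks_def)
qed

text \<open>An upper bound only: starting point and steps determine the walk, while the condition of
  staying in \<open>{..<N}\<close> is dropped. It serves for the exceptional walks.\<close>

lemma card_closed_walks_le:
  "card {x \<in> closed_walks k N. P (restrict (step x) {..<k})}
     \<le> N * card {z \<in> {..<k} \<rightarrow>\<^sub>E sym_range N. sum z {..<k} = 0 \<and> P z}"
proof -
  let ?Z = "{z \<in> {..<k} \<rightarrow>\<^sub>E sym_range N. sum z {..<k} = 0 \<and> P z}"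
  let ?f = "\<lambda>x. (x 0, restrict (step x) {..<k})"
  have "inj_on ?f {x \<in> closed_walks k N. P (restrict (step x) {..<k})}"
  proof (rule inj_onI)
    fix x y assume x: "x \<in> {x \<in> closed_walks k N. P (restrict (step x) {..<k})}"
      "y \<in> {x \<in> closed_walks k N. P (restrict (step x) {..<k})}" and "?f x = ?f y"
    then have eq: "x 0 = y 0" "restrict (step x) {..<k} = restrict (step y) {..<k}" by simp_all
    have "step x j = step y j" if "j < k" for j using fun_cong[OF eq(2), of j] that by simp
    then show "x = y" using closed_walk_eqI x eq(1) by blast
  qed
  moreover have "?f ` {x \<in> closed_walks k N. P (restrict (step x) {..<k})} \<subseteq> {..<N} \<times> ?Z"
  proof (rule image_subsetI)
    fix x assume "x \<in> {x \<in> closed_walks k N. P (restrict (step x) {..<k})}"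
    then have x: "x \<in> closed_walks k N" and P: "P (restrict (step x) {..<k})" by auto
    have "x 0 < N" using x by (auto simp: closed_walks_def paths_def)
    then show "(x 0, restrict (step x) {..<k}) \<in> {..<N} \<times> ?Z"
      using restrict_step_mem[OF x] P by simp
  qed
  ultimately have "card {x \<in> closed_walks k N. P (restrict (step x) {..<k})} \<le> card ({..<N} \<times> ?Z)"
    by (intro card_inj_on_le) (auto intro!: finite_cartesian_product finite_int_functions)
  then show ?thesis by (simp add: card_cartesian_product)
qed

lemma sum_append_at_first: "sum (restrict (append_at k f g) {..<2 * k}) {..<k} = sum f {..<k}"
  by (intro sum.cong) (auto simp: append_at_def)

text \<open>Of the two closing relations only that of the first walk is kept: one lost degree of
  freedom is all that the covariance bound requires.\<close>

lemma card_closed_walk_pairs_le: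
  "card {(x, y) \<in> closed_walks k N \<times> closed_walks k N. P (restrict (append_at k (step x) (step y)) {..<2 * k})}
     \<le> N ^ 2 * card {z \<in> {..<2 * k} \<rightarrow>\<^sub>E sym_range N. sum z {..<k} = 0 \<and> P z}"
proof -
  let ?Z = "{z \<in> {..<2 * k} \<rightarrow>\<^sub>E sym_range N. sum z {..<k} = 0 \<and> P z}"
  let ?X = "{(x, y) \<in> closed_walks k N \<times> closed_walks k N. P (restrict (append_at k (step x) (step y)) {..<2 * k})}"
  let ?f = "\<lambda>(x, y). (x 0, y 0, restrict (append_at k (step x) (step y)) {..<2 * k})"
  have "inj_on ?f ?X"
  proof (rule inj_onI, clarify)
    fix x y x' y'
    assume x: "x \<in> closed_walks k N" "x' \<in> closed_walks k N" and y: "y \<in> closed_walks k N" "y' \<in> closed_walks k N"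
      and eq: "restrict (append_at k (step x) (step y)) {..<2 * k} = restrict (append_at k (step x') (step y')) {..<2 * k}"
      and eq0: "x 0 = x' 0" "y 0 = y' 0"
    have "step x j = step x' j" if "j < k" for j
      using fun_cong[OF eq, of j] that by (simp add: append_at_def)
    moreover have "step y j = step y' j" if "j < k" for j
      using fun_cong[OF eq, of "j + k"] that by (simp add: append_at_def)
    ultimately show "x = x' \<and> y = y'" using closed_walk_eqI x y eq0 by blast
  qed
  moreover have "?f ` ?X \<subseteq> {..<N} \<times> {..<N} \<times> ?Z"
  proof (rule image_subsetI)
    fix v assume "v \<in> ?X"
    then obtain x y where v: "v = (x, y)" and x: "x \<in> closed_walks k N" and y: "y \<in> closed_walks k N"
      and P: "P (restrict (append_at k (step x) (step y)) {..<2 * k})" by auto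
    have "restrict (append_at k (step x) (step y)) {..<2 * k} \<in> {..<2 * k} \<rightarrow>\<^sub>E sym_range N"
      using step_mem_sym_range[OF x] step_mem_sym_range[OF y] by (intro restrict_PiE_iff[THEN iffD2]) (auto simp: append_at_def)
    moreover have "sum (restrict (append_at k (step x) (step y)) {..<2 * k}) {..<k} = 0"
      unfolding sum_append_at_first using x by (simp add: closed_walk_telescope closed_walks_def)
    moreover have "x 0 < N" "y 0 < N" using x y by (auto simp: closed_walks_def paths_def)
    ultimately show "?f v \<in> {..<N} \<times> {..<N} \<times> ?Z"
      using P by (simp add: v)
  qed
  ultimately have "card ?X \<le> card ({..<N} \<times> {..<N} \<times> ?Z)"
    by (intro card_inj_on_le) (auto intro!: finite_cartesian_product finite_int_functions)
  then show ?thesis by (simp add: card_cartesian_product power2_eq_square)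
qed

section \<open>Walks with opposite paired steps as lattice points\<close>

abbreviation walk_openers :: "nat \<Rightarrow> (nat \<Rightarrow> nat) \<Rightarrow> nat set" where
  "walk_openers k \<pi> \<equiv> openers \<pi> {..<k}"

text \<open>A walk with \<open>step x (\<pi> j) = - step x j\<close> is given by its starting point, stored at index \<open>k\<close>,
  and its steps at the openers; \<open>x j\<close> is then the sum over \<open>open_at k \<pi> j\<close>.\<close>
definition open_at :: "nat \<Rightarrow> (nat \<Rightarrow> nat) \<Rightarrow> nat \<Rightarrow> nat set" where
  "open_at k \<pi> j = insert k {r \<in> walk_openers k \<pi>. r < j \<and> j \<le> \<pi> r}"

abbreviation pairing_points :: "nat \<Rightarrow> (nat \<Rightarrow> nat) \<Rightarrow> nat \<Rightarrow> (nat \<Rightarrow> int) set" where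
  "pairing_points k \<pi> \<equiv> lattice_points (insert k (walk_openers k \<pi>)) (open_at k \<pi> ` {..k})"

abbreviation pairing_volume :: "nat \<Rightarrow> (nat \<Rightarrow> nat) \<Rightarrow> real" where
  "pairing_volume k \<pi> \<equiv> lattice_volume (insert k (walk_openers k \<pi>)) (open_at k \<pi> ` {..k})"

text \<open>For odd \<open>k\<close> there are no pairings and the value is 0. The entry
  distribution does not occur, which gives the universality of the limit.\<close>

definition limit_moment :: "nat \<Rightarrow> real" where
  "limit_moment k = (\<Sum>\<pi>\<in>pairings {..<k}. pairing_volume k \<pi>)"

lemma finite_walk_openers [simp]: "finite (walk_openers k \<pi>)"
  by (simp add: openers_def)

lemma open_at_finite: "finite (open_at k \<pi> j)"
  by (simp add: open_at_def)

text \<open>At time \<open>j\<close> either \<open>j\<close> opens its pair or it closes the pair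
  opened at \<open>\<pi> j\<close>; all other pairs keep their status.\<close>

lemma sum_open_at_Suc:
  assumes \<pi>: "\<pi> \<in> pairings {..<k}" and j: "j < k"
  shows "sum q (open_at k \<pi> (Suc j)) = sum q (open_at k \<pi> j)
      + (if j < \<pi> j then q j else - q (\<pi> j) :: int)"
proof -
  note d = pairingsD[OF \<pi>, of j]
  have ne: "\<pi> r \<noteq> j" if "r < k" "r \<noteq> \<pi> j" for r using pairingsD(3)[OF \<pi>, of r] that by auto
  show ?thesis
  proof (cases "j < \<pi> j")
    case True
    have "open_at k \<pi> (Suc j) = insert j (open_at k \<pi> j)"
    proof -
      have "\<pi> r \<noteq> j" if "r < k" "r < j" for r using ne[of r] that True by auto
      then show ?thesis using True j by (force simp: open_at_def openers_def less_Suc_eq)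
    qed
    moreover have "j \<notin> open_at k \<pi> j" using j by (simp add: open_at_def)
    ultimately show ?thesis using True open_at_finite by simp
  next
    case False
    then have lt: "\<pi> j < j" using d j by auto
    have "open_at k \<pi> j = insert (\<pi> j) (open_at k \<pi> (Suc j))"
    proof -
      have "\<pi> j \<in> walk_openers k \<pi>" using d j lt by (simp add: openers_def)
      moreover have "j \<notin> walk_openers k \<pi>" using False by (simp add: openers_def)
      ultimately show ?thesis using ne d j lt
        by (fastforce simp: open_at_def openers_def less_Suc_eq Suc_le_eq le_less)
    qed
    moreover have "\<pi> j \<notin> open_at k \<pi> (Suc j)" using d j lt by (simp add: open_at_def)
    ultimately show ?thesis using False open_at_finite by simp
  qed
qed

lemma open_at_ends: "\<pi> \<in> pairings {..<k} \<Longrightarrow> open_at k \<pi> 0 = {k}" "\<pi> \<in> pairings {..<k} \<Longrightarrow> open_at k \<pi> k = {k}"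
  using pairingsD(1)[of \<pi> "{..<k}"] by (force simp: open_at_def openers_def)+

text \<open>A position is the start plus the steps whose partners are still to come, since closed
  pairs have cancelled. Thus the slab constraints say precisely that every position lies in
  \<open>{..<N}\<close>.\<close>

lemma card_antisymmetric_walks:
  assumes \<pi>: "\<pi> \<in> pairings {..<k}"
  shows "card {x \<in> closed_walks k N. \<forall>j<k. step x (\<pi> j) = - step x j} = card (pairing_points k \<pi> N)"
proof (rule bij_betw_same_card)
  let ?R = "walk_openers k \<pi>"
  let ?X = "{x \<in> closed_walks k N. \<forall>j<k. step x (\<pi> j) = - step x j}"
  let ?f = "\<lambda>x. \<lambda>i\<in>insert k ?R. if i = k then int (x 0) else step x i"
  \<comment> \<open>On lattice points \<open>nat\<close> loses nothing, since the constraints make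
    these sums non-negative.\<close>
  let ?g = "\<lambda>q. \<lambda>j\<in>{..k}. nat (sum q (open_at k \<pi> j))"
  note d = pairingsD[OF \<pi>]
  have kR: "k \<notin> ?R" by (simp add: openers_def)
  have pos: "sum (?f x) (open_at k \<pi> j) = int (x j)" if x: "x \<in> ?X" and "j \<le> k" for x j
    using that(2)
  proof (induction j)
    case 0
    then show ?case using open_at_ends[OF \<pi>] by simp
  next
    case (Suc j)
    then have j: "j < k" by simp
    have "(if j < \<pi> j then ?f x j else - ?f x (\<pi> j)) = step x j"
    proof (cases "j < \<pi> j")
      case True
      then show ?thesis using j by (simp add: openers_def)
    next
      case False
      then have "\<pi> j \<in> ?R" "\<pi> j \<noteq> k" using d[of j] j by (auto simp: openers_def)
      moreover have "step x (\<pi> j) = - step x j" using x j by blast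
      ultimately show ?thesis using False by simp
    qed
    then show ?case using Suc.IH j unfolding sum_open_at_Suc[OF \<pi> j] by (simp add: step_def)
  qed
  have lp: "q \<in> pairing_points k \<pi> N \<longleftrightarrow> q \<in> insert k ?R \<rightarrow>\<^sub>E {- int N..<int N} \<and>
      (\<forall>j\<le>k. 0 \<le> sum q (open_at k \<pi> j) \<and> sum q (open_at k \<pi> j) < int N)" for q
    by (auto simp: lattice_points_def)
  have stepg: "step (?g q) j = (if j < \<pi> j then q j else - q (\<pi> j))"
    if q: "q \<in> pairing_points k \<pi> N" and j: "j < k" for q j
  proof -
    have "0 \<le> sum q (open_at k \<pi> j)" "0 \<le> sum q (open_at k \<pi> (Suc j))"
      using q j unfolding lp by auto
    then have "step (?g q) j = sum q (open_at k \<pi> (Suc j)) - sum q (open_at k \<pi> j)"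
      using j by (simp add: step_def)
    then show ?thesis by (simp add: sum_open_at_Suc[OF \<pi> j])
  qed
  have g0: "int (?g q 0) = q k" "?g q k = ?g q 0" if "q \<in> pairing_points k \<pi> N" for q
  proof -
    have "0 \<le> sum q (open_at k \<pi> 0)" using that unfolding lp by auto
    then show "int (?g q 0) = q k" "?g q k = ?g q 0" using open_at_ends[OF \<pi>] by auto
  qed
  show "bij_betw ?f ?X (pairing_points k \<pi> N)"
  proof (rule bij_betw_byWitness[where f' = ?g])
    show "\<forall>x\<in>?X. ?g (?f x) = x"
    proof
      fix x assume x: "x \<in> ?X"
      show "?g (?f x) = x"
      proof
        fix j
        show "?g (?f x) j = x j"
        proof (cases "j \<le> k")
          case True
          then show ?thesis using pos[OF x True] by (simp only: restrict_apply' atMost_iff nat_int)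
        next
          case False
          then have "x j = undefined" using x by (auto simp: closed_walks_def paths_def PiE_def extensional_def)
          then show ?thesis using False by simp
        qed
      qed
    qed
    show "\<forall>q\<in>pairing_points k \<pi> N. ?f (?g q) = q"
    proof
      fix q assume q: "q \<in> pairing_points k \<pi> N"
      show "?f (?g q) = q"
      proof
        fix i
        consider "i = k" | "i \<in> ?R" "i \<noteq> k" | "i \<notin> insert k ?R" by blast
        then show "?f (?g q) i = q i"
        proof cases
          case 1
          then show ?thesis using g0(1)[OF q] by simp
        next
          case 2
          then have "i < k" "i < \<pi> i" by (auto simp: openers_def)
          then have "step (?g q) i = q i" using stepg[OF q, of i] by simp
          then show ?thesis using 2 by simp
        next
          case 3
          then have "q i = undefined" using q unfolding lp by (auto simp: PiE_def extensional_def)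
          then show ?thesis using 3 by simp
        qed
      qed
    qed
    show "?f ` ?X \<subseteq> pairing_points k \<pi> N"
    proof (rule image_subsetI)
      fix x assume x: "x \<in> ?X"
      then have cw: "x \<in> closed_walks k N" by simp
      have xj: "x j < N" if "j \<le> k" for j using cw that by (auto simp: closed_walks_def paths_def)
      have "?f x \<in> insert k ?R \<rightarrow>\<^sub>E {- int N..<int N}"
      proof (rule restrict_PiE_iff[THEN iffD2], rule ballI)
        fix i assume "i \<in> insert k ?R"
        then have "i = k \<or> i < k" by (auto simp: openers_def)
        then show "(if i = k then int (x 0) else step x i) \<in> {- int N..<int N}"
          using xj[of 0] step_mem_sym_range[OF cw, of i] by auto
      qed
      then show "?f x \<in> pairing_points k \<pi> N"
        unfolding lp using pos[OF x] xj by simp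
    qed
    show "?g ` pairing_points k \<pi> N \<subseteq> ?X"
    proof (rule image_subsetI)
      fix q assume q: "q \<in> pairing_points k \<pi> N"
      have "?g q \<in> {..k} \<rightarrow>\<^sub>E {..<N}"
      proof (rule restrict_PiE_iff[THEN iffD2], rule ballI)
        fix j assume "j \<in> {..k}"
        then have "0 \<le> sum q (open_at k \<pi> j) \<and> sum q (open_at k \<pi> j) < int N" using q unfolding lp by blast
        then show "nat (sum q (open_at k \<pi> j)) \<in> {..<N}" by auto
      qed
      moreover have "step (?g q) (\<pi> j) = - step (?g q) j" if "j < k" for j
        using stepg[OF q that] stepg[OF q, of "\<pi> j"] d[of j] that by auto
      ultimately show "?g q \<in> ?X" using g0(2)[OF q] by (simp add: closed_walks_def paths_def)
    qed
  qed
qed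

lemma pairing_density_tendsto:
  "lattice_density (insert k (walk_openers k \<pi>)) (open_at k \<pi> ` {..k}) \<longlonglongrightarrow> pairing_volume k \<pi>"
  by (intro lattice_density_tendsto) (auto simp: open_at_def)

lemma card_index_set:
  assumes "\<pi> \<in> pairings {..<k}"
  shows "real (card (insert k (walk_openers k \<pi>))) = real k / 2 + 1"
proof -
  have "k = 2 * card (walk_openers k \<pi>)" using card_openers[of "{..<k}" \<pi>] assms by simp
  moreover have "k \<notin> walk_openers k \<pi>" by (simp add: openers_def)
  ultimately show ?thesis by (simp add: field_simps)
qed

lemma scaling_pairing_points:
  assumes "\<pi> \<in> pairings {..<k}" "N > 0"
  shows "scaling k N * real (card (pairing_points k \<pi> N))
    = lattice_density (insert k (walk_openers k \<pi>)) (open_at k \<pi> ` {..k}) N"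
proof -
  have eq: "real N ^ card (insert k (walk_openers k \<pi>)) = real N powr (real k / 2 + 1)"
    using powr_realpow[of "real N" "card (insert k (walk_openers k \<pi>))"] assms(2)
    unfolding card_index_set[OF assms(1)] by simp
  show ?thesis unfolding lattice_density_def eq powr_minus divide_inverse by (rule mult.commute)
qed

text \<open>Fewer than \<open>k / 2\<close> non-zero gaps leave at most \<open>(k - 1) div 2\<close>
  free values, and the starting point adds one. The total is at most \<open>(k + 1) / 2\<close>,
  half a power below the leading order; this comparison fails for \<open>k = 0\<close>, which is
  treated apart.\<close>

lemma card_few_gaps_le:
  "\<exists>C. \<forall>N>0. real (card {x \<in> closed_walks k N. 2 * card (gap x ` {..<k} - {0}) < k})
      \<le> C * real N powr (real k / 2 + 1 / 2)"
proof (cases "k = 0")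
  case True
  then show ?thesis by (intro exI[of _ 0]) simp
next
  case False
  define r where "r = (k - 1) div 2"
  define C :: nat where "C = 2 ^ k * Suc r ^ k"
  let ?P = "\<lambda>z :: nat \<Rightarrow> int. 2 * card ((\<lambda>j. nat \<bar>z j\<bar>) ` {..<k} - {0}) < k"
  have "real (card {x \<in> closed_walks k N. 2 * card (gap x ` {..<k} - {0}) < k})
      \<le> real C * real N powr (real k / 2 + 1 / 2)" if N: "N > 0" for N
  proof -
    have eq: "(\<lambda>j. nat \<bar>restrict (step x) {..<k} j\<bar>) ` {..<k} = gap x ` {..<k}" for x
      by (intro image_cong) auto
    have "card {x \<in> closed_walks k N. 2 * card (gap x ` {..<k} - {0}) < k}
        = card {x \<in> closed_walks k N. ?P (restrict (step x) {..<k})}"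
      unfolding eq ..
    also have "\<dots> \<le> N * card {z \<in> {..<k} \<rightarrow>\<^sub>E sym_range N. sum z {..<k} = 0 \<and> ?P z}"
      by (rule card_closed_walks_le)
    also have "card {z \<in> {..<k} \<rightarrow>\<^sub>E sym_range N. sum z {..<k} = 0 \<and> ?P z}
        \<le> card {z \<in> {..<k} \<rightarrow>\<^sub>E sym_range N. card ((\<lambda>j. nat \<bar>z j\<bar>) ` {..<k} - {0}) \<le> r}"
    proof (rule card_mono[OF finite_int_functions])
      have "n \<le> r" if "2 * n < k" for n using that unfolding r_def by linarith
      then show "{z \<in> {..<k} \<rightarrow>\<^sub>E sym_range N. sum z {..<k} = 0 \<and> ?P z}
          \<subseteq> {z \<in> {..<k} \<rightarrow>\<^sub>E sym_range N. card ((\<lambda>j. nat \<bar>z j\<bar>) ` {..<k} - {0}) \<le> r}"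
        by blast
    qed simp
    also have "\<dots> \<le> C * N ^ r"
      using card_few_values_le[of "{..<k}" N r] N by (simp add: C_def)
    finally have "card {x \<in> closed_walks k N. 2 * card (gap x ` {..<k} - {0}) < k} \<le> C * N ^ Suc r"
      by (simp add: mult_ac)
    then have "real (card {x \<in> closed_walks k N. 2 * card (gap x ` {..<k} - {0}) < k}) \<le> real C * real N ^ Suc r"
      unfolding of_nat_mult[symmetric] of_nat_power[symmetric] of_nat_le_iff .
    also have "real N ^ Suc r = real N powr real (Suc r)" using N by (simp only: powr_realpow of_nat_0_less_iff)
    also have "\<dots> \<le> real N powr (real k / 2 + 1 / 2)"
    proof (rule powr_mono)
      have "2 * Suc r \<le> k + 1" using False by (simp add: r_def)
      then have "real (2 * Suc r) \<le> real (k + 1)" by (simp only: of_nat_le_iff)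
      then show "real (Suc r) \<le> real k / 2 + 1 / 2" by simp
    qed (use N in simp)
    finally show ?thesis by (simp add: mult_left_mono)
  qed
  then show ?thesis by blast
qed

text \<open>A pair of equal steps enters the closing relation with coefficient 2, so
  \<open>card_degenerate_le\<close> with \<open>K\<close> the whole index set leaves
  \<open>k / 2 - 1\<close> free steps besides the starting point.\<close>

lemma card_degenerate_walks_le:
  assumes \<pi>: "\<pi> \<in> pairings {..<k}"
  shows "\<exists>C. \<forall>N>0. real (card {x \<in> closed_walks k N. (\<forall>j<k. gap x (\<pi> j) = gap x j) \<and> (\<exists>j<k. step x (\<pi> j) = step x j)})
      \<le> C * real N powr (real k / 2 + 1 / 2)"
proof (cases "k = 0")
  case True
  then show ?thesis by (intro exI[of _ 0]) simp
next
  case False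
  define m where "m = card (walk_openers k \<pi>)"
  have km: "k = 2 * m" using card_openers[of "{..<k}" \<pi>] \<pi> by (simp add: m_def)
  then have m: "m > 0" using False by simp
  define C :: nat where "C = 2 ^ m * 2 ^ (m - 1)"
  let ?P = "\<lambda>z :: nat \<Rightarrow> int. (\<forall>j\<in>{..<k}. \<bar>z (\<pi> j)\<bar> = \<bar>z j\<bar>) \<and> (\<exists>j\<in>{..<k}. \<pi> j \<notin> {..<k} \<or> z (\<pi> j) = z j)"
  have "real (card {x \<in> closed_walks k N. (\<forall>j<k. gap x (\<pi> j) = gap x j) \<and> (\<exists>j<k. step x (\<pi> j) = step x j)})
      \<le> real C * real N powr (real k / 2 + 1 / 2)" if N: "N > 0" for N
  proof -
    have P: "?P (restrict (step x) {..<k}) \<longleftrightarrow> (\<forall>j<k. gap x (\<pi> j) = gap x j) \<and> (\<exists>j<k. step x (\<pi> j) = step x j)" for x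
      using pairingsD(1)[OF \<pi>] by (auto simp: eq_nat_nat_iff)
    have "card {x \<in> closed_walks k N. (\<forall>j<k. gap x (\<pi> j) = gap x j) \<and> (\<exists>j<k. step x (\<pi> j) = step x j)}
        = card {x \<in> closed_walks k N. ?P (restrict (step x) {..<k})}"
      unfolding P ..
    also have "\<dots> \<le> N * card {z \<in> {..<k} \<rightarrow>\<^sub>E sym_range N. sum z {..<k} = 0 \<and> ?P z}"
      by (rule card_closed_walks_le)
    also have "{z \<in> {..<k} \<rightarrow>\<^sub>E sym_range N. sum z {..<k} = 0 \<and> ?P z}
        = {z \<in> {..<k} \<rightarrow>\<^sub>E sym_range N. (\<forall>j\<in>{..<k}. \<bar>z (\<pi> j)\<bar> = \<bar>z j\<bar>) \<and> sum z {..<k} = 0 \<and>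
             (\<exists>j\<in>{..<k}. \<pi> j \<notin> {..<k} \<or> z (\<pi> j) = z j)}"
      by blast
    also have "card \<dots> \<le> 2 ^ m * (2 * N) ^ (m - 1)"
      unfolding m_def by (rule card_degenerate_le[OF _ \<pi>]) auto
    finally have "card {x \<in> closed_walks k N. (\<forall>j<k. gap x (\<pi> j) = gap x j) \<and> (\<exists>j<k. step x (\<pi> j) = step x j)}
        \<le> N * (2 ^ m * (2 * N) ^ (m - 1))" by simp
    also have "\<dots> = C * N ^ m"
    proof -
      have "N ^ m = N * N ^ (m - 1)" using m by (metis Suc_diff_1 power_Suc)
      then show ?thesis by (simp add: C_def power_mult_distrib)
    qed
    finally have "real (card {x \<in> closed_walks k N. (\<forall>j<k. gap x (\<pi> j) = gap x j) \<and> (\<exists>j<k. step x (\<pi> j) = step x j)})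
        \<le> real C * real N ^ m"
      unfolding of_nat_mult[symmetric] of_nat_power[symmetric] of_nat_le_iff .
    also have "real N ^ m = real N powr real m" using N by (simp add: powr_realpow)
    also have "\<dots> \<le> real N powr (real k / 2 + 1 / 2)"
      using N by (intro powr_mono) (auto simp: km)
    finally show ?thesis by (simp add: mult_left_mono)
  qed
  then show ?thesis by blast
qed

lemma gap_eq_iff: "gap x i = gap x j \<longleftrightarrow> step x i = - step x j \<or> step x i = step x j"
  by (auto simp: eq_nat_nat_iff abs_eq_iff)

text \<open>Two replacements, each with an error of order \<open>N powr (k / 2 + 1 / 2)\<close>: the
  expectation by the number of compatible pairings, which allows the sums to be exchanged, and then
  the walks with equal paired gaps by those with opposite paired steps.\<close>

lemma wick_sum_approx:
  assumes m: "m 1 = 0" "m 2 = 1"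
  shows "\<exists>C. \<forall>N>0. \<bar>(\<Sum>x\<in>closed_walks k N. wick m {..<k} (gap x)) - (\<Sum>\<pi>\<in>pairings {..<k}. real (card (pairing_points k \<pi> N)))\<bar>
     \<le> C * real N powr (real k / 2 + 1 / 2)"
proof -
  let ?J = "{..<k}"
  let ?cw = "closed_walks k"
  let ?E = "\<lambda>N. real N powr (real k / 2 + 1 / 2)"
  let ?few = "\<lambda>N. {x \<in> ?cw N. 2 * card (gap x ` ?J - {0}) < k}"
  let ?deg = "\<lambda>\<pi> N. {x \<in> ?cw N. (\<forall>j<k. gap x (\<pi> j) = gap x j) \<and> (\<exists>j<k. step x (\<pi> j) = step x j)}"
  let ?com = "\<lambda>\<pi> N. {x \<in> ?cw N. \<forall>j<k. gap x (\<pi> j) = gap x j}"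
  let ?anti = "\<lambda>\<pi> N. {x \<in> ?cw N. \<forall>j<k. step x (\<pi> j) = - step x j}"
  obtain C1 where C1: "\<And>N. N > 0 \<Longrightarrow> real (card (?few N)) \<le> C1 * ?E N" using card_few_gaps_le by blast
  have "\<exists>C. \<forall>\<pi>\<in>pairings ?J. \<forall>N>0. real (card (?deg \<pi> N)) \<le> C \<pi> * ?E N"
    using card_degenerate_walks_le by (intro bchoice) blast
  then obtain C2 where C2: "\<And>\<pi> N. \<pi> \<in> pairings ?J \<Longrightarrow> N > 0 \<Longrightarrow> real (card (?deg \<pi> N)) \<le> C2 \<pi> * ?E N" by blast
  define B where "B = wick_bound m k + real (card (pairings ?J))"
  have B: "B \<ge> 0" by (simp add: B_def wick_bound_def sum_nonneg)
  have fp: "finite (pairings ?J)" by (intro finite_pairings) auto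
  have "\<bar>(\<Sum>x\<in>?cw N. wick m ?J (gap x)) - (\<Sum>\<pi>\<in>pairings ?J. real (card (pairing_points k \<pi> N)))\<bar>
     \<le> (B * C1 + sum C2 (pairings ?J)) * ?E N" if N: "N > 0" for N
  proof -
    let ?c = "\<lambda>x. real (card {\<pi> \<in> pairings ?J. \<forall>j\<in>?J. gap x (\<pi> j) = gap x j})"
    have "(\<Sum>x\<in>?cw N. ?c x) = (\<Sum>x\<in>?cw N. \<Sum>\<pi>\<in>pairings ?J. if \<forall>j<k. gap x (\<pi> j) = gap x j then 1 else 0)"
      using fp by (auto intro!: sum.cong simp: sum.If_cases Int_def lessThan_iff[symmetric] Ball_def simp del: lessThan_iff)
    also have "\<dots> = (\<Sum>\<pi>\<in>pairings ?J. real (card (?com \<pi> N)))"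
      by (subst sum.swap) (auto intro!: sum.cong simp: sum.If_cases Int_def)
    finally have swap: "(\<Sum>x\<in>?cw N. ?c x) = (\<Sum>\<pi>\<in>pairings ?J. real (card (?com \<pi> N)))" .
    have "\<bar>(\<Sum>x\<in>?cw N. wick m ?J (gap x)) - (\<Sum>x\<in>?cw N. ?c x)\<bar> \<le> (\<Sum>x\<in>?cw N. \<bar>wick m ?J (gap x) - ?c x\<bar>)"
      by (simp flip: sum_subtractf add: sum_abs)
    also have "\<dots> \<le> (\<Sum>x\<in>?cw N. if 2 * card (gap x ` ?J - {0}) < k then B else 0)"
    proof (rule sum_mono)
      fix x
      show "\<bar>wick m ?J (gap x) - ?c x\<bar> \<le> (if 2 * card (gap x ` ?J - {0}) < k then B else 0)"
        using wick_approx[where w = "gap x", OF finite_lessThan m] unfolding card_lessThan B_def .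
    qed
    also have "\<dots> = B * real (card (?few N))"
      by (simp add: sum.If_cases Int_def)
    also have "\<dots> \<le> B * (C1 * ?E N)" using C1[OF N] B by (rule mult_left_mono)
    finally have 1: "\<bar>(\<Sum>x\<in>?cw N. wick m ?J (gap x)) - (\<Sum>\<pi>\<in>pairings ?J. real (card (?com \<pi> N)))\<bar> \<le> B * (C1 * ?E N)"
      unfolding swap .
    have 2: "\<bar>real (card (?com \<pi> N)) - real (card (pairing_points k \<pi> N))\<bar> \<le> C2 \<pi> * ?E N" if \<pi>: "\<pi> \<in> pairings ?J" for \<pi>
    proof -
      have "?anti \<pi> N \<subseteq> ?com \<pi> N" by (auto simp: gap_eq_iff)
      then have "card (?anti \<pi> N) \<le> card (?com \<pi> N)" by (intro card_mono) auto
      moreover have "?com \<pi> N \<subseteq> ?anti \<pi> N \<union> ?deg \<pi> N" by (auto simp: gap_eq_iff)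
      then have "card (?com \<pi> N) \<le> card (?anti \<pi> N \<union> ?deg \<pi> N)" by (intro card_mono) auto
      then have "card (?com \<pi> N) \<le> card (?anti \<pi> N) + card (?deg \<pi> N)" using card_Un_le le_trans by blast
      ultimately have "\<bar>real (card (?com \<pi> N)) - real (card (?anti \<pi> N))\<bar> \<le> real (card (?deg \<pi> N))" by linarith
      then show ?thesis using C2[OF \<pi> N] card_antisymmetric_walks[OF \<pi>, of N] by simp
    qed
    have "\<bar>(\<Sum>\<pi>\<in>pairings ?J. real (card (?com \<pi> N))) - (\<Sum>\<pi>\<in>pairings ?J. real (card (pairing_points k \<pi> N)))\<bar>
       \<le> (\<Sum>\<pi>\<in>pairings ?J. \<bar>real (card (?com \<pi> N)) - real (card (pairing_points k \<pi> N))\<bar>)"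
      by (simp flip: sum_subtractf add: sum_abs)
    also have "\<dots> \<le> (\<Sum>\<pi>\<in>pairings ?J. C2 \<pi> * ?E N)" using 2 by (rule sum_mono)
    finally have 3: "\<bar>(\<Sum>\<pi>\<in>pairings ?J. real (card (?com \<pi> N))) - (\<Sum>\<pi>\<in>pairings ?J. real (card (pairing_points k \<pi> N)))\<bar>
       \<le> sum C2 (pairings ?J) * ?E N" by (simp add: sum_distrib_right)
    show ?thesis using 1 3 unfolding distrib_right mult.assoc by linarith
  qed
  then show ?thesis by blast
qed

lemma powr_error_tendsto_0:
  assumes "\<And>N. N > 0 \<Longrightarrow> \<bar>f N\<bar> \<le> C * real N powr a" "a < b"
  shows "(\<lambda>N. real N powr (- b) * f N) \<longlonglongrightarrow> 0"
proof (rule Lim_null_comparison)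
  show "eventually (\<lambda>N. norm (real N powr (- b) * f N) \<le> C * real N powr (a - b)) sequentially"
    using eventually_gt_at_top[of 0]
  proof eventually_elim
    case (elim N)
    have "norm (real N powr (- b) * f N) \<le> real N powr (- b) * (C * real N powr a)"
      using assms(1)[OF elim] by (simp add: abs_mult mult_left_mono)
    then show ?case using elim by (simp add: powr_diff powr_minus divide_simps mult_ac)
  qed
  have "(\<lambda>N. real N powr (a - b)) \<longlonglongrightarrow> 0"
    using assms(2) by (intro tendsto_neg_powr filterlim_real_sequentially) auto
  then show "(\<lambda>N. C * real N powr (a - b)) \<longlonglongrightarrow> 0" by (rule tendsto_mult_right_zero)
qed

lemma (in entry_distribution) moment_N_tendsto: "(\<lambda>N. moment_N p k N) \<longlonglongrightarrow> limit_moment k"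
proof -
  let ?W = "\<lambda>N. \<Sum>x\<in>closed_walks k N. wick m {..<k} (gap x)"
  let ?P = "\<lambda>N. \<Sum>\<pi>\<in>pairings {..<k}. real (card (pairing_points k \<pi> N))"
  obtain C where C: "\<And>N. N > 0 \<Longrightarrow> \<bar>?W N - ?P N\<bar> \<le> C * real N powr (real k / 2 + 1 / 2)"
    using wick_sum_approx[of m k] m_1 m_2 by blast
  have "(\<lambda>N. scaling k N * (?W N - ?P N)) \<longlonglongrightarrow> 0"
    using C by (rule powr_error_tendsto_0) auto
  moreover have "(\<lambda>N. scaling k N * ?P N) \<longlonglongrightarrow> limit_moment k"
  proof (rule Lim_transform_eventually)
    show "(\<lambda>N. \<Sum>\<pi>\<in>pairings {..<k}. lattice_density (insert k (walk_openers k \<pi>)) (open_at k \<pi> ` {..k}) N) \<longlonglongrightarrow> limit_moment k"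
      unfolding limit_moment_def by (intro tendsto_sum pairing_density_tendsto)
    show "eventually (\<lambda>N. (\<Sum>\<pi>\<in>pairings {..<k}. lattice_density (insert k (walk_openers k \<pi>)) (open_at k \<pi> ` {..k}) N) = scaling k N * ?P N) sequentially"
      using eventually_gt_at_top[of 0]
      by eventually_elim (auto simp only: sum_distrib_left scaling_pairing_points intro!: sum.cong)
  qed
  ultimately have "(\<lambda>N. scaling k N * (?W N - ?P N) + scaling k N * ?P N) \<longlonglongrightarrow> 0 + limit_moment k"
    by (rule tendsto_add)
  then show ?thesis by (simp add: moment_N_eq algebra_simps)
qed

section \<open>Concentration of the moments\<close>

lemma image_append_at: "append_at k f g ` {..<2 * k} = f ` {..<k} \<union> g ` {..<k}"
proof -
  have "{..<2 * k} = {..<k} \<union> (\<lambda>j. j + k) ` {..<k}"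
  proof (rule Set.set_eqI)
    fix j
    show "j \<in> {..<2 * k} \<longleftrightarrow> j \<in> {..<k} \<union> (\<lambda>j. j + k) ` {..<k}"
    proof (cases "j < k")
      case False
      then obtain i where "j = k + i" by (metis le_add_diff_inverse not_less)
      then show ?thesis by auto
    qed auto
  qed
  then have "append_at k f g ` {..<2 * k} = append_at k f g ` {..<k} \<union> (\<lambda>j. append_at k f g (j + k)) ` {..<k}"
    by (simp only: image_Un image_image)
  moreover have "append_at k f g ` {..<k} = f ` {..<k}"
    by (intro image_cong) (auto simp: append_at_def)
  moreover have "(\<lambda>j. append_at k f g (j + k)) ` {..<k} = g ` {..<k}"
    by (intro image_cong) (auto simp: append_at_def)
  ultimately show ?thesis by simp
qed

lemma mult_of_append_at: "mult_of {..<2 * k} (append_at k f g) v = mult_of {..<k} f v + mult_of {..<k} g v"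
proof -
  have "{j \<in> {..<2 * k}. append_at k f g j = v} = {j \<in> {..<k}. f j = v} \<union> (\<lambda>j. j + k) ` {j \<in> {..<k}. g j = v}"
  proof (rule Set.set_eqI)
    fix j
    show "j \<in> {j \<in> {..<2 * k}. append_at k f g j = v} \<longleftrightarrow> j \<in> {j \<in> {..<k}. f j = v} \<union> (\<lambda>j. j + k) ` {j \<in> {..<k}. g j = v}"
    proof (cases "j < k")
      case True
      then show ?thesis by (auto simp: append_at_def)
    next
      case False
      then obtain i where "j = k + i" by (metis le_add_diff_inverse not_less)
      then show ?thesis by (auto simp: append_at_def)
    qed
  qed
  moreover have "card (\<dots>) = mult_of {..<k} f v + card ((\<lambda>j. j + k) ` {j \<in> {..<k}. g j = v})"
    unfolding mult_of_def by (rule card_Un_disjoint) auto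
  moreover have "card ((\<lambda>j. j + k) ` {j \<in> {..<k}. g j = v}) = mult_of {..<k} g v"
    unfolding mult_of_def by (rule card_image) (auto intro: inj_onI)
  ultimately show ?thesis unfolding mult_of_def by simp
qed

text \<open>Two walks without a common gap involve different, hence independent, entries.\<close>

lemma wick_append_at_disjoint:
  assumes m0: "m 0 = 1" and disj: "f ` {..<k} \<inter> g ` {..<k} = {}"
  shows "wick m {..<2 * k} (append_at k f g) = wick m {..<k} f * wick m {..<k} g"
proof -
  have "(\<Prod>v\<in>f ` {..<k} \<union> g ` {..<k}. m (mult_of {..<k} f v + mult_of {..<k} g v))
     = (\<Prod>v\<in>f ` {..<k}. m (mult_of {..<k} f v + mult_of {..<k} g v)) * (\<Prod>v\<in>g ` {..<k}. m (mult_of {..<k} f v + mult_of {..<k} g v))"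
    using disj by (intro prod.union_disjoint) auto
  also have "(\<Prod>v\<in>f ` {..<k}. m (mult_of {..<k} f v + mult_of {..<k} g v)) = (\<Prod>v\<in>f ` {..<k}. m (mult_of {..<k} f v))"
  proof (rule prod.cong[OF refl])
    fix v assume "v \<in> f ` {..<k}"
    then have "v \<notin> g ` {..<k}" using disj by blast
    then show "m (mult_of {..<k} f v + mult_of {..<k} g v) = m (mult_of {..<k} f v)"
      using mult_of_eq_0_iff[of "{..<k}" g v] by simp
  qed
  also have "(\<Prod>v\<in>g ` {..<k}. m (mult_of {..<k} f v + mult_of {..<k} g v)) = (\<Prod>v\<in>g ` {..<k}. m (mult_of {..<k} g v))"
  proof (rule prod.cong[OF refl])
    fix v assume "v \<in> g ` {..<k}"
    then have "v \<notin> f ` {..<k}" using disj by blast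
    then show "m (mult_of {..<k} f v + mult_of {..<k} g v) = m (mult_of {..<k} g v)"
      using mult_of_eq_0_iff[of "{..<k}" f v] by simp
  qed
  finally show ?thesis unfolding wick_def image_append_at mult_of_append_at by simp
qed

text \<open>Suppose the walks share a gap. If every value occurred at least twice, all would occur
  exactly twice and the shared one would give a crossing pair, which is excluded. So some value
  occurs once, and it annihilates both the joint expectation and that of the walk containing
  it.\<close>

lemma wick_covariance_eq_0:
  fixes f g :: "nat \<Rightarrow> nat"
  assumes m: "m 0 = 1" "m 1 = 0"
    and few: "\<not> 2 * card (append_at k f g ` {..<2 * k} - {0}) < 2 * k"
    and cross: "\<not> (\<exists>\<pi>\<in>pairings {..<2 * k}. (\<forall>j\<in>{..<2 * k}. append_at k f g (\<pi> j) = append_at k f g j) \<and> (\<exists>j<k. k \<le> \<pi> j))"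
  shows "wick m {..<2 * k} (append_at k f g) = wick m {..<k} f * wick m {..<k} g"
proof (cases "f ` {..<k} \<inter> g ` {..<k} = {}")
  case True
  then show ?thesis by (rule wick_append_at_disjoint[where m = m, OF m(1)])
next
  case False
  let ?u = "append_at k f g" and ?J = "{..<2 * k}"
  obtain i j where ij: "i < k" "j < k" "f i = g j" using False by auto
  have "\<not> (\<forall>v\<in>?u ` ?J. mult_of ?J ?u v \<ge> 2)"
  proof
    assume ge2: "\<forall>v\<in>?u ` ?J. mult_of ?J ?u v \<ge> 2"
    have "card ?J \<le> 2 * card (?u ` ?J - {0})" using few by simp
    from exact_pairs(2)[OF finite_lessThan this ge2]
    obtain \<pi> where \<pi>: "{\<pi> \<in> pairings ?J. \<forall>j\<in>?J. ?u (\<pi> j) = ?u j} = {\<pi>}"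
      "\<And>a b. a \<in> ?J \<Longrightarrow> b \<in> ?J \<Longrightarrow> a \<noteq> b \<Longrightarrow> ?u a = ?u b \<Longrightarrow> \<pi> b = a"
      using exact_pairs_pairing[OF finite_lessThan] by blast
    have "\<pi> i = j + k" using ij by (intro \<pi>(2)) (auto simp: append_at_def)
    moreover have "\<pi> \<in> pairings ?J" "\<forall>j\<in>?J. ?u (\<pi> j) = ?u j" using \<pi>(1) by blast+
    ultimately show False using cross ij(1) by (metis le_add2)
  qed
  then obtain v where v: "v \<in> ?u ` ?J" "mult_of ?J ?u v < 2" by (meson not_le)
  then have one: "mult_of ?J ?u v = 1" using mult_of_eq_0_iff[of ?J ?u v] by simp
  have "wick m ?J ?u = 0" by (rule wick_singleton_eq_0[where m = m, OF finite_lessThan m(2) v(1) one])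
  moreover have "wick m {..<k} f = 0 \<or> wick m {..<k} g = 0"
  proof -
    have "mult_of {..<k} f v = 1 \<or> mult_of {..<k} g v = 1"
      using one unfolding mult_of_append_at by linarith
    moreover have "wick m {..<k} h = 0" if "mult_of {..<k} h v = 1" for h :: "nat \<Rightarrow> nat"
    proof (rule wick_singleton_eq_0[where m = m, OF finite_lessThan m(2) _ that])
      show "v \<in> h ` {..<k}" using that mult_of_eq_0_iff[OF finite_lessThan, of k h v] by linarith
    qed
    ultimately show ?thesis by blast
  qed
  ultimately show ?thesis by auto
qed

lemma append_at_gap: "append_at k (gap x) (gap y) j = nat \<bar>append_at k (step x) (step y) j\<bar>"
  by (simp add: append_at_def)

text \<open>Two starting points and at most \<open>k - 1\<close> non-zero gaps are free: one power
  less than the normalization \<open>N ^ (k + 2)\<close> of the variance.\<close>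

lemma card_few_gap_pairs_le:
  assumes k: "k > 0" and N: "N > 0"
  shows "card {(x, y) \<in> closed_walks k N \<times> closed_walks k N.
      2 * card (append_at k (gap x) (gap y) ` {..<2 * k} - {0}) < 2 * k} \<le> 2 ^ (2 * k) * k ^ (2 * k) * N ^ (k + 1)"
proof -
  let ?P = "\<lambda>z :: nat \<Rightarrow> int. 2 * card ((\<lambda>j. nat \<bar>z j\<bar>) ` {..<2 * k} - {0}) < 2 * k"
  have eq: "(\<lambda>j. nat \<bar>restrict (append_at k (step x) (step y)) {..<2 * k} j\<bar>) ` {..<2 * k}
      = append_at k (gap x) (gap y) ` {..<2 * k}" for x y
    by (intro image_cong) (auto simp: append_at_gap)
  have "card {(x, y) \<in> closed_walks k N \<times> closed_walks k N.
        2 * card (append_at k (gap x) (gap y) ` {..<2 * k} - {0}) < 2 * k}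
      = card {(x, y) \<in> closed_walks k N \<times> closed_walks k N. ?P (restrict (append_at k (step x) (step y)) {..<2 * k})}"
    unfolding eq ..
  also have "\<dots> \<le> N ^ 2 * card {z \<in> {..<2 * k} \<rightarrow>\<^sub>E sym_range N. sum z {..<k} = 0 \<and> ?P z}"
    by (rule card_closed_walk_pairs_le)
  also have "card {z \<in> {..<2 * k} \<rightarrow>\<^sub>E sym_range N. sum z {..<k} = 0 \<and> ?P z}
      \<le> card {z \<in> {..<2 * k} \<rightarrow>\<^sub>E sym_range N. card ((\<lambda>j. nat \<bar>z j\<bar>) ` {..<2 * k} - {0}) \<le> k - 1}"
  proof (rule card_mono[OF finite_int_functions])
    have "n \<le> k - 1" if "2 * n < 2 * k" for n using that by linarith
    then show "{z \<in> {..<2 * k} \<rightarrow>\<^sub>E sym_range N. sum z {..<k} = 0 \<and> ?P z}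
        \<subseteq> {z \<in> {..<2 * k} \<rightarrow>\<^sub>E sym_range N. card ((\<lambda>j. nat \<bar>z j\<bar>) ` {..<2 * k} - {0}) \<le> k - 1}"
      by blast
  qed simp
  also have "\<dots> \<le> 2 ^ (2 * k) * k ^ (2 * k) * N ^ (k - 1)"
    using card_few_values_le[of "{..<2 * k}" N "k - 1"] N k by simp
  also have "N ^ 2 * (2 ^ (2 * k) * k ^ (2 * k) * N ^ (k - 1)) = 2 ^ (2 * k) * k ^ (2 * k) * (N ^ (2 + (k - 1)))"
    by (simp only: power_add mult_ac)
  also have "2 + (k - 1) = k + 1" using k by simp
  finally show ?thesis by simp
qed

text \<open>Here \<open>card_degenerate_le\<close> is applied with \<open>K\<close> the indices of
  the first walk. A crossing pair has just one index in \<open>K\<close>, so the closing relation of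
  the first walk is non-trivial.\<close>

lemma card_crossing_pairs_le:
  assumes k: "k > 0" and \<pi>: "\<pi> \<in> pairings {..<2 * k}" and cross: "\<exists>j<k. k \<le> \<pi> j"
  shows "card {(x, y) \<in> closed_walks k N \<times> closed_walks k N.
      \<forall>j\<in>{..<2 * k}. append_at k (gap x) (gap y) (\<pi> j) = append_at k (gap x) (gap y) j} \<le> 2 ^ (2 * k) * N ^ (k + 1)"
proof -
  let ?P = "\<lambda>z :: nat \<Rightarrow> int. \<forall>j\<in>{..<2 * k}. \<bar>z (\<pi> j)\<bar> = \<bar>z j\<bar>"
  have eq: "?P (restrict (append_at k (step x) (step y)) {..<2 * k})
      \<longleftrightarrow> (\<forall>j\<in>{..<2 * k}. append_at k (gap x) (gap y) (\<pi> j) = append_at k (gap x) (gap y) j)" for x y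
    using pairingsD(1)[OF \<pi>] by (intro ball_cong refl) (auto simp: append_at_gap eq_nat_nat_iff)
  have "card {(x, y) \<in> closed_walks k N \<times> closed_walks k N.
        \<forall>j\<in>{..<2 * k}. append_at k (gap x) (gap y) (\<pi> j) = append_at k (gap x) (gap y) j}
      = card {(x, y) \<in> closed_walks k N \<times> closed_walks k N. ?P (restrict (append_at k (step x) (step y)) {..<2 * k})}"
    unfolding eq ..
  also have "\<dots> \<le> N ^ 2 * card {z \<in> {..<2 * k} \<rightarrow>\<^sub>E sym_range N. sum z {..<k} = 0 \<and> ?P z}"
    by (rule card_closed_walk_pairs_le)
  also have "{z \<in> {..<2 * k} \<rightarrow>\<^sub>E sym_range N. sum z {..<k} = 0 \<and> ?P z}
      = {z \<in> {..<2 * k} \<rightarrow>\<^sub>E sym_range N. ?P z \<and> sum z {..<k} = 0 \<and> (\<exists>j\<in>{..<k}. \<pi> j \<notin> {..<k} \<or> z (\<pi> j) = z j)}"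
    using cross by (auto simp: not_less)
  also have "card \<dots> \<le> 2 ^ k * (2 * N) ^ (k - 1)"
    using card_degenerate_le[OF finite_lessThan \<pi>, of "{..<k}" N] card_openers[OF finite_lessThan \<pi>] by simp
  also have "N ^ 2 * (2 ^ k * (2 * N) ^ (k - 1)) = 2 ^ (k + (k - 1)) * N ^ (2 + (k - 1))"
    by (simp only: power_add mult_ac power_mult_distrib)
  also have "2 + (k - 1) = k + 1" using k by simp
  also have "2 ^ (k + (k - 1)) * N ^ (k + 1) \<le> 2 ^ (2 * k) * N ^ (k + 1)"
    by (intro mult_right_mono power_increasing) auto
  finally show ?thesis by simp
qed

text \<open>Covariances are uniformly bounded and vanish outside two exceptional families: pairs of
  walks with few gaps, and those compatible with a crossing pairing.\<close>

lemma covariance_sum_le: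
  assumes m: "m 0 = 1" "m 1 = 0"
  shows "\<exists>C. \<forall>N>0. \<bar>\<Sum>x\<in>closed_walks k N. \<Sum>y\<in>closed_walks k N.
      wick m {..<2 * k} (append_at k (gap x) (gap y)) - wick m {..<k} (gap x) * wick m {..<k} (gap y)\<bar>
    \<le> C * real N powr (real k + 1)"
proof -
  let ?J = "{..<2 * k}"
  define cov where "cov = (\<lambda>(x, y). wick m ?J (append_at k (gap x) (gap y)) - wick m {..<k} (gap x) * wick m {..<k} (gap y))"
  define few where "few = (\<lambda>N. {(x, y) \<in> closed_walks k N \<times> closed_walks k N.
      2 * card (append_at k (gap x) (gap y) ` ?J - {0}) < 2 * k})"
  define comp where "comp = (\<lambda>\<pi> N. {(x, y) \<in> closed_walks k N \<times> closed_walks k N.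
      \<forall>j\<in>?J. append_at k (gap x) (gap y) (\<pi> j) = append_at k (gap x) (gap y) j})"
  define X where "X = {\<pi> \<in> pairings ?J. \<exists>j<k. k \<le> \<pi> j}"
  have fX: "finite X" unfolding X_def using finite_pairings[of ?J] by simp
  have fc: "finite (comp \<pi> N)" "finite (few N)" for \<pi> N
    by (rule finite_subset[of _ "closed_walks k N \<times> closed_walks k N"]; force simp: comp_def few_def)+
  define B where "B = wick_bound m (2 * k) + wick_bound m k * wick_bound m k"
  have B: "\<bar>cov v\<bar> \<le> B" for v
  proof -
    obtain x y where v: "v = (x, y)" by fastforce
    have wb: "wick_bound m k \<ge> 0" by (simp add: wick_bound_def sum_nonneg)
    have "\<bar>wick m ?J (append_at k (gap x) (gap y))\<bar> \<le> wick_bound m (2 * k)"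
      using abs_wick_le[of ?J m] by simp
    moreover have "\<bar>wick m {..<k} (gap x) * wick m {..<k} (gap y)\<bar> \<le> wick_bound m k * wick_bound m k"
      unfolding abs_mult using abs_wick_le[of "{..<k}" m] wb by (intro mult_mono) auto
    ultimately show ?thesis unfolding v cov_def B_def prod.case by linarith
  qed
  then have B0: "B \<ge> 0" using abs_ge_zero order_trans by blast
  define C where "C = 2 ^ (2 * k) * k ^ (2 * k) + card X * 2 ^ (2 * k)"
  have "\<bar>\<Sum>x\<in>closed_walks k N. \<Sum>y\<in>closed_walks k N.
      wick m ?J (append_at k (gap x) (gap y)) - wick m {..<k} (gap x) * wick m {..<k} (gap y)\<bar>
    \<le> (B * real C) * real N powr (real k + 1)" if N: "N > 0" for N
  proof -
    let ?D = "closed_walks k N \<times> closed_walks k N"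
    let ?bad = "few N \<union> (\<Union>\<pi>\<in>X. comp \<pi> N)"
    have card: "card ?bad \<le> C * N ^ (k + 1)"
    proof (cases "k = 0")
      case True
      then have "?bad = {}" by (auto simp: few_def X_def)
      then show ?thesis by (metis card.empty zero_le)
    next
      case False
      then have k: "k > 0" by simp
      have "card (\<Union>\<pi>\<in>X. comp \<pi> N) \<le> (\<Sum>\<pi>\<in>X. card (comp \<pi> N))" by (rule card_UN_le[OF fX])
      also have "\<dots> \<le> (\<Sum>\<pi>\<in>X. 2 ^ (2 * k) * N ^ (k + 1))"
        unfolding comp_def by (intro sum_mono card_crossing_pairs_le k) (auto simp: X_def)
      finally have 1: "card (\<Union>\<pi>\<in>X. comp \<pi> N) \<le> card X * (2 ^ (2 * k) * N ^ (k + 1))" by simp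
      have 2: "card (few N) \<le> 2 ^ (2 * k) * k ^ (2 * k) * N ^ (k + 1)"
        unfolding few_def by (rule card_few_gap_pairs_le[OF k N])
      have "card ?bad \<le> card (few N) + card (\<Union>\<pi>\<in>X. comp \<pi> N)" by (rule card_Un_le)
      also have "\<dots> \<le> 2 ^ (2 * k) * k ^ (2 * k) * N ^ (k + 1) + card X * (2 ^ (2 * k) * N ^ (k + 1))"
        using 1 2 by (rule add_mono[rotated])
      also have "\<dots> = C * N ^ (k + 1)" by (simp only: C_def distrib_right mult.assoc)
      finally show ?thesis .
    qed
    have fin: "finite ?bad" using fX fc by simp
    have zero: "cov v = 0" if "v \<in> ?D - ?bad" for v
    proof -
      obtain x y where v: "v = (x, y)" by fastforce
      have "wick m ?J (append_at k (gap x) (gap y)) = wick m {..<k} (gap x) * wick m {..<k} (gap y)"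
      proof (rule wick_covariance_eq_0[where m = m, OF m])
        show "\<not> 2 * card (append_at k (gap x) (gap y) ` ?J - {0}) < 2 * k"
          using that unfolding v few_def by blast
        show "\<not> (\<exists>\<pi>\<in>pairings ?J. (\<forall>j\<in>?J. append_at k (gap x) (gap y) (\<pi> j) = append_at k (gap x) (gap y) j) \<and> (\<exists>j<k. k \<le> \<pi> j))"
          using that unfolding v comp_def X_def by blast
      qed
      then show ?thesis by (simp add: v cov_def)
    qed
    have "(\<Sum>x\<in>closed_walks k N. \<Sum>y\<in>closed_walks k N.
      wick m ?J (append_at k (gap x) (gap y)) - wick m {..<k} (gap x) * wick m {..<k} (gap y)) = sum cov ?D"
      unfolding cov_def by (rule sum.cartesian_product)
    also have "\<dots> = sum cov ?bad"
      by (rule sum.mono_neutral_right) (use zero in \<open>auto simp: few_def comp_def\<close>)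
    finally have "\<bar>\<Sum>x\<in>closed_walks k N. \<Sum>y\<in>closed_walks k N.
      wick m ?J (append_at k (gap x) (gap y)) - wick m {..<k} (gap x) * wick m {..<k} (gap y)\<bar> = \<bar>sum cov ?bad\<bar>" by simp
    also have "\<dots> \<le> (\<Sum>v\<in>?bad. \<bar>cov v\<bar>)" by (rule sum_abs)
    also have "\<dots> \<le> real (card ?bad) * B" using B by (intro sum_bounded_above)
    also have "\<dots> \<le> (real C * real N ^ (k + 1)) * B"
    proof (rule mult_right_mono[OF _ B0])
      show "real (card ?bad) \<le> real C * real N ^ (k + 1)"
        using card unfolding of_nat_mult[symmetric] of_nat_power[symmetric] of_nat_le_iff .
    qed
    also have "real N ^ (k + 1) = real N powr (real k + 1)"
      using N powr_realpow[of "real N" "k + 1"] by (simp add: add.commute)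
    finally show ?thesis by (simp only: mult_ac)
  qed
  then show ?thesis by blast
qed

context entry_distribution
begin

lemma variance_moment_AN_tendsto_0:
  "(\<lambda>N. \<integral>b. (moment_AN k N b - moment_N p k N)\<^sup>2 \<partial>toeplitz_space p N) \<longlonglongrightarrow> 0"
proof -
  let ?S = "\<lambda>N. \<Sum>x\<in>closed_walks k N. \<Sum>y\<in>closed_walks k N.
      wick m {..<2 * k} (append_at k (gap x) (gap y)) - wick m {..<k} (gap x) * wick m {..<k} (gap y)"
  obtain C where C: "\<And>N. N > 0 \<Longrightarrow> \<bar>?S N\<bar> \<le> C * real N powr (real k + 1)"
    using covariance_sum_le[of m k, OF m_0 m_1] by blast
  have "(\<lambda>N. real N powr (- (real k + 2)) * ?S N) \<longlonglongrightarrow> 0"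
  proof (rule powr_error_tendsto_0)
    show "\<bar>?S N\<bar> \<le> C * real N powr (real k + 1)" if "N > 0" for N using C[OF that] .
    show "real k + 1 < real k + 2" by (rule add_strict_left_mono) simp
  qed
  moreover have "(scaling k N)\<^sup>2 = real N powr (- (real k + 2))" for N
    by (simp add: power2_eq_square powr_add[symmetric])
  ultimately show ?thesis unfolding variance_moment_AN by simp
qed

lemma moment_AN_tendsto_in_probability:
  assumes "\<delta> > 0"
  shows "(\<lambda>N. measure (toeplitz_space p N) {b \<in> space (toeplitz_space p N). \<bar>moment_AN k N b - limit_moment k\<bar> > \<delta>}) \<longlonglongrightarrow> 0"
proof (rule Lim_null_comparison)
  let ?V = "\<lambda>N. \<integral>b. (moment_AN k N b - moment_N p k N)\<^sup>2 \<partial>toeplitz_space p N"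
  show "(\<lambda>N. ?V N / (\<delta> / 2)\<^sup>2) \<longlonglongrightarrow> 0"
    using tendsto_divide[OF variance_moment_AN_tendsto_0 tendsto_const, of "(\<delta> / 2)\<^sup>2"] assms by simp
  \<comment> \<open>Half of \<open>\<delta>\<close> absorbs the distance between mean and limit; the
    other half is left for Chebyshev's inequality.\<close>
  have "eventually (\<lambda>N. \<bar>moment_N p k N - limit_moment k\<bar> < \<delta> / 2) sequentially"
    using tendstoD[OF moment_N_tendsto[of k], of "\<delta> / 2"] assms by (simp add: dist_real_def)
  then show "eventually (\<lambda>N. norm (measure (toeplitz_space p N) {b \<in> space (toeplitz_space p N). \<bar>moment_AN k N b - limit_moment k\<bar> > \<delta>}) \<le> ?V N / (\<delta> / 2)\<^sup>2) sequentially"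
  proof eventually_elim
    case (elim N)
    interpret T: prob_space "toeplitz_space p N" by (rule space_prob)
    have meas[measurable]: "moment_AN k N \<in> borel_measurable (toeplitz_space p N)"
      using integrable_moment_AN by (rule borel_measurable_integrable)
    have "T.prob {b \<in> space (toeplitz_space p N). \<bar>moment_AN k N b - limit_moment k\<bar> > \<delta>}
        \<le> T.prob {b \<in> space (toeplitz_space p N). \<delta> / 2 \<le> \<bar>moment_AN k N b - moment_N p k N\<bar>}"
    proof (rule T.finite_measure_mono)
      have "\<delta> / 2 \<le> \<bar>v - moment_N p k N\<bar>" if "\<bar>v - limit_moment k\<bar> > \<delta>" for v
        using elim that by linarith
      then show "{b \<in> space (toeplitz_space p N). \<bar>moment_AN k N b - limit_moment k\<bar> > \<delta>}
          \<subseteq> {b \<in> space (toeplitz_space p N). \<delta> / 2 \<le> \<bar>moment_AN k N b - moment_N p k N\<bar>}"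
        by blast
    qed measurable
    also have "\<dots> \<le> ?V N / (\<delta> / 2)\<^sup>2"
      unfolding moment_N_def using assms integrable_moment_AN_square meas
      by (intro T.Chebyshev_inequality) auto
    finally show ?case by simp
  qed
qed

end

section \<open>Growth of the limiting moments\<close>

text \<open>A pairing is determined by its set of openers and their partners. The exact number is a
  double factorial, but only the order \<open>m ^ m\<close> up to exponential factors
  matters.\<close>

lemma card_pairings_le: "card (pairings {..<2 * m}) \<le> 2 ^ (2 * m) * (2 * m) ^ m"
proof -
  let ?J = "{..<2 * m}"
  let ?f = "\<lambda>\<pi>. (openers \<pi> ?J, restrict \<pi> (openers \<pi> ?J))"
  have "inj_on ?f (pairings ?J)"
  proof (rule inj_onI)
    fix \<pi> \<sigma> assume \<pi>: "\<pi> \<in> pairings ?J" and \<sigma>: "\<sigma> \<in> pairings ?J" and "?f \<pi> = ?f \<sigma>"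
    then have R: "openers \<pi> ?J = openers \<sigma> ?J"
      and res: "restrict \<pi> (openers \<pi> ?J) = restrict \<sigma> (openers \<sigma> ?J)"
      unfolding prod.inject by blast+
    have on: "\<pi> r = \<sigma> r" if "r \<in> openers \<pi> ?J" for r
      using fun_cong[OF res, of r] that R by simp
    have "\<pi> j = \<sigma> j" if "j \<in> ?J" for j
    proof -
      have "j \<in> openers \<pi> ?J \<union> \<pi> ` openers \<pi> ?J" unfolding pairing_split(1)[OF \<pi>] by (rule that)
      then consider "j \<in> openers \<pi> ?J" | r where "r \<in> openers \<pi> ?J" "j = \<pi> r" by blast
      then show ?thesis
      proof cases
        case 2
        then have "r \<in> ?J" by (simp add: openers_def)
        then show ?thesis using 2(2) on[OF 2(1)] pairingsD(3)[OF \<pi>, of r] pairingsD(3)[OF \<sigma>, of r] by metis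
      qed (rule on)
    qed
    then show "\<pi> = \<sigma>" using \<pi> \<sigma> by (intro PiE_ext[of \<pi> ?J "\<lambda>_. ?J"]) (auto simp: pairings_def)
  qed
  moreover have "?f ` pairings ?J \<subseteq> Sigma {R. R \<subseteq> ?J \<and> card R = m} (\<lambda>R. R \<rightarrow>\<^sub>E ?J)"
  proof (rule image_subsetI)
    fix \<pi> assume \<pi>: "\<pi> \<in> pairings ?J"
    have "card (openers \<pi> ?J) = m" using card_openers[OF finite_lessThan \<pi>] by simp
    moreover have "openers \<pi> ?J \<subseteq> ?J" by (auto simp: openers_def)
    moreover have "restrict \<pi> (openers \<pi> ?J) \<in> openers \<pi> ?J \<rightarrow>\<^sub>E ?J"
      using pairingsD(1)[OF \<pi>] by (intro restrict_PiE_iff[THEN iffD2] ballI) (auto simp: openers_def)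
    ultimately show "?f \<pi> \<in> Sigma {R. R \<subseteq> ?J \<and> card R = m} (\<lambda>R. R \<rightarrow>\<^sub>E ?J)" by simp
  qed
  moreover have fin: "finite {R. R \<subseteq> ?J \<and> card R = m}" "\<And>R. R \<subseteq> ?J \<Longrightarrow> finite (R \<rightarrow>\<^sub>E ?J)"
    by (auto intro!: finite_PiE intro: finite_subset)
  ultimately have "card (pairings ?J) \<le> card (Sigma {R. R \<subseteq> ?J \<and> card R = m} (\<lambda>R. R \<rightarrow>\<^sub>E ?J))"
    by (intro card_inj_on_le) auto
  also have "\<dots> = (\<Sum>R | R \<subseteq> ?J \<and> card R = m. card (R \<rightarrow>\<^sub>E ?J))"
    using fin by (intro card_SigmaI) auto
  also have "\<dots> = (\<Sum>R | R \<subseteq> ?J \<and> card R = m. (2 * m) ^ m)"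
  proof (rule sum.cong[OF refl])
    fix R assume R: "R \<in> {R. R \<subseteq> ?J \<and> card R = m}"
    then have "finite R" by (auto intro: finite_subset)
    then show "card (R \<rightarrow>\<^sub>E ?J) = (2 * m) ^ m" using R by (simp add: card_PiE)
  qed
  also have "\<dots> = card {R. R \<subseteq> ?J \<and> card R = m} * (2 * m) ^ m" by simp
  also have "card {R. R \<subseteq> ?J \<and> card R = m} \<le> card (Pow ?J)" by (intro card_mono) auto
  also have "card (Pow ?J) = 2 ^ (2 * m)" by (simp add: card_Pow)
  finally show ?thesis by simp
qed

lemma lattice_volume_le:
  assumes I: "finite I" "I \<noteq> {}" and S: "finite \<S>" "\<And>S. S \<in> \<S> \<Longrightarrow> S \<subseteq> I \<and> S \<noteq> {}"
  shows "lattice_volume I \<S> \<le> 2 ^ card I"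
proof -
  note lim = lattice_density_tendsto[OF I S]
  have "card (lattice_points I \<S> N) \<le> card (I \<rightarrow>\<^sub>E {- int N..<int N})" for N
    using I by (intro card_mono finite_PiE) (auto simp: lattice_points_def)
  then have le: "card (lattice_points I \<S> N) \<le> (2 * N) ^ card I" for N
  proof -
    have "card {- int N..<int N} = 2 * N" by simp
    then have "card (I \<rightarrow>\<^sub>E {- int N..<int N}) = (2 * N) ^ card I" using I by (simp only: card_PiE prod_constant)
    then show ?thesis using \<open>\<And>N. card (lattice_points I \<S> N) \<le> card (I \<rightarrow>\<^sub>E {- int N..<int N})\<close>[of N] by (simp only:)
  qed
  have "lattice_density I \<S> N \<le> 2 ^ card I" if "N > 0" for N
  proof -
    have "real (card (lattice_points I \<S> N)) \<le> (2 * real N) ^ card I"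
    proof -
      have "real (card (lattice_points I \<S> N)) \<le> real ((2 * N) ^ card I)" using le[of N] by (simp only: of_nat_le_iff)
      then show ?thesis by simp
    qed
    then show ?thesis using that by (simp add: lattice_density_def power_mult_distrib divide_le_eq)
  qed
  then show ?thesis
    by (intro LIMSEQ_le_const2[OF lim] exI[of _ 1]) auto
qed

lemma pairing_volume_le:
  assumes "\<pi> \<in> pairings {..<2 * m}"
  shows "pairing_volume (2 * m) \<pi> \<le> 2 ^ (m + 1)"
proof -
  have "real (card (insert (2 * m) (walk_openers (2 * m) \<pi>))) = real (m + 1)"
    using card_index_set[OF assms] by simp
  then have "card (insert (2 * m) (walk_openers (2 * m) \<pi>)) = m + 1" by (simp only: of_nat_eq_iff)
  then show ?thesis
    using lattice_volume_le[of "insert (2 * m) (walk_openers (2 * m) \<pi>)" "open_at (2 * m) \<pi> ` {..2 * m}"]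
    by (auto simp: open_at_def)
qed

text \<open>The 16 is \<open>4 * 2 * 2\<close>: the choice of openers, the 2 in
  \<open>(2 * m) ^ m\<close>, and the box side 2 for each opener. The leading 2 comes from the
  starting coordinate.\<close>

lemma limit_moment_even_le: "limit_moment (2 * m) \<le> 2 * (16 * real m) ^ m"
proof -
  have "limit_moment (2 * m) \<le> real (card (pairings {..<2 * m})) * 2 ^ (m + 1)"
    unfolding limit_moment_def by (intro sum_bounded_above pairing_volume_le)
  also have "\<dots> \<le> real (2 ^ (2 * m) * (2 * m) ^ m) * 2 ^ (m + 1)"
    using card_pairings_le[of m] by (intro mult_right_mono) (simp_all only: of_nat_le_iff, simp)
  also have "\<dots> = 2 * (16 * real m) ^ m"
  proof -
    have "(16 :: real) ^ m = 2 ^ (2 * m) * 2 ^ m * 2 ^ m" by (simp add: power_mult flip: power_mult_distrib)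
    then show ?thesis by (simp add: power_mult_distrib)
  qed
  finally show ?thesis .
qed

section \<open>Lower bound for the even limiting moments\<close>

text \<open>The bound \<open>3 n\<^sup>2 D\<^sup>4\<close> for the fourth moment of a sum of \<open>n\<close> independent variables, uniform
  on \<open>{-D..D}\<close>; the sums over \<open>q\<close> are unnormalised expectations.\<close>
lemma sum_fourth_power_le:
  assumes R: "finite R" and A: "A \<subseteq> R"
  shows "(\<Sum>q\<in>R \<rightarrow>\<^sub>E {- int D..int D}. (sum q A) ^ 2) \<le> int (card A * D ^ 2 * (2 * D + 1) ^ card R) \<and>
    (\<Sum>q\<in>R \<rightarrow>\<^sub>E {- int D..int D}. (sum q A) ^ 4) \<le> int (3 * card A ^ 2 * D ^ 4 * (2 * D + 1) ^ card R)"
proof -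
  let ?Q = "R \<rightarrow>\<^sub>E {- int D..int D}"
  have "card {- int D..int D} = 2 * D + 1" by simp
  then have cQ: "card ?Q = (2 * D + 1) ^ card R" using R by (simp only: card_PiE prod_constant)
  have "finite A" using R A by (rule finite_subset[rotated])
  then show ?thesis using A
  proof (induction A)
    case empty
    then show ?case by simp
  next
    case (insert a A)
    then have a: "a \<in> R" and IH2: "(\<Sum>q\<in>?Q. (sum q A) ^ 2) \<le> int (card A * D ^ 2 * card ?Q)"
      and IH4: "(\<Sum>q\<in>?Q. (sum q A) ^ 4) \<le> int (3 * card A ^ 2 * D ^ 4 * card ?Q)"
      unfolding cQ by auto
    \<comment> \<open>Reflecting the coordinate \<open>a\<close> preserves the cube and, as
      \<open>a\<close> is outside \<open>A\<close>, also \<open>sum q A\<close>; odd terms change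
      sign.\<close>
    have odd_zero: "(\<Sum>q\<in>?Q. sum q A ^ i * q a ^ j) = 0" if "odd j" for i j
    proof -
      have upd: "sum (q(a := c)) A = sum q A" for q and c :: int
        using insert.hyps(2) by (intro sum.cong) auto
      have "(\<Sum>q\<in>?Q. sum q A ^ i * q a ^ j) = (\<Sum>q\<in>?Q. - (sum q A ^ i * q a ^ j))"
        by (rule sum.reindex_bij_witness[of _ "\<lambda>q. q(a := - q a)" "\<lambda>q. q(a := - q a)"])
           (use a that upd in \<open>auto simp: PiE_def Pi_def extensional_def\<close>)
      then show ?thesis by (simp add: sum_negf)
    qed
    have sq: "q a ^ 2 \<le> int D ^ 2" "q a ^ 4 \<le> int D ^ 4" if "q \<in> ?Q" for q
    proof -
      have "\<bar>q a\<bar> \<le> int D" using that a by (auto simp: PiE_def Pi_def abs_le_iff minus_le_iff)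
      then show "q a ^ 2 \<le> int D ^ 2" "q a ^ 4 \<le> int D ^ 4"
        using power_mono[of "\<bar>q a\<bar>" "int D" 2] power_mono[of "\<bar>q a\<bar>" "int D" 4] by (simp_all add: power_even_abs)
    qed
    have ins: "sum q (insert a A) = q a + sum q A" for q :: "_ \<Rightarrow> int" using insert.hyps by simp
    have cA: "card (insert a A) = card A + 1" using insert.hyps by simp
    have s2: "(\<Sum>q\<in>?Q. q a ^ 2) \<le> int (D ^ 2 * card ?Q)"
      using sum_bounded_above[of ?Q "\<lambda>q. q a ^ 2" "int D ^ 2"] sq by (simp add: mult.commute)
    have s4: "(\<Sum>q\<in>?Q. q a ^ 4) \<le> int (D ^ 4 * card ?Q)"
      using sum_bounded_above[of ?Q "\<lambda>q. q a ^ 4" "int D ^ 4"] sq by (simp add: mult.commute)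
    have s22: "(\<Sum>q\<in>?Q. sum q A ^ 2 * q a ^ 2) \<le> int (card A * D ^ 4 * card ?Q)"
    proof -
      have "(\<Sum>q\<in>?Q. sum q A ^ 2 * q a ^ 2) \<le> (\<Sum>q\<in>?Q. sum q A ^ 2 * int D ^ 2)"
        using sq(1) by (intro sum_mono mult_left_mono) auto
      also have "\<dots> = (\<Sum>q\<in>?Q. sum q A ^ 2) * int D ^ 2" by (rule sum_distrib_right[symmetric])
      also have "\<dots> \<le> int (card A * D ^ 2 * card ?Q) * int D ^ 2"
        using IH2 by (rule mult_right_mono) simp
      also have "\<dots> = int (card A * D ^ 4 * card ?Q)"
        by (simp add: power2_eq_square power4_eq_xxxx)
      finally show ?thesis .
    qed
    have "(\<Sum>q\<in>?Q. (sum q (insert a A)) ^ 2)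
        = (\<Sum>q\<in>?Q. sum q A ^ 2) + 2 * (\<Sum>q\<in>?Q. sum q A ^ 1 * q a ^ 1) + (\<Sum>q\<in>?Q. q a ^ 2)"
      unfolding ins sum_distrib_left sum.distrib[symmetric]
      by (intro sum.cong refl) (simp add: power2_eq_square algebra_simps)
    also have "\<dots> \<le> int (card A * D ^ 2 * card ?Q) + int (D ^ 2 * card ?Q)"
      using odd_zero[of 1 1] IH2 s2 by simp
    also have "\<dots> = int (card (insert a A) * D ^ 2 * card ?Q)" unfolding cA by (simp add: algebra_simps)
    finally have 2: "(\<Sum>q\<in>?Q. (sum q (insert a A)) ^ 2) \<le> int (card (insert a A) * D ^ 2 * card ?Q)" .
    have "(\<Sum>q\<in>?Q. (sum q (insert a A)) ^ 4)
        = (\<Sum>q\<in>?Q. sum q A ^ 4) + 4 * (\<Sum>q\<in>?Q. sum q A ^ 3 * q a ^ 1) + 6 * (\<Sum>q\<in>?Q. sum q A ^ 2 * q a ^ 2)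
          + 4 * (\<Sum>q\<in>?Q. sum q A ^ 1 * q a ^ 3) + (\<Sum>q\<in>?Q. q a ^ 4)"
      unfolding ins sum_distrib_left sum.distrib[symmetric]
      by (intro sum.cong refl) (simp add: power2_eq_square power3_eq_cube power4_eq_xxxx algebra_simps)
    also have "\<dots> \<le> int (3 * card A ^ 2 * D ^ 4 * card ?Q) + 6 * int (card A * D ^ 4 * card ?Q) + int (D ^ 4 * card ?Q)"
      using odd_zero[of 1 3] odd_zero[of 3 1] IH4 s22 s4 by simp
    also have "\<dots> = int ((3 * card A ^ 2 + 6 * card A + 1) * (D ^ 4 * card ?Q))"
      by (simp add: algebra_simps)
    \<comment> \<open>The constant 3 closes the induction: \<open>3 * n ^ 2 + 6 * n + 1\<close> is
      at most \<open>3 * (n + 1) ^ 2\<close>.\<close>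
    also have "\<dots> \<le> int (3 * card (insert a A) ^ 2 * (D ^ 4 * card ?Q))"
      unfolding cA of_nat_le_iff by (intro mult_right_mono) (simp_all add: power2_eq_square)
    also have "\<dots> = int (3 * card (insert a A) ^ 2 * D ^ 4 * card ?Q)" by (simp only: mult.assoc)
    finally show ?case using 2 unfolding cQ by blast
  qed
qed

text \<open>Markov's inequality for the fourth power, in counting form.\<close>

lemma card_large_sum_le:
  assumes R: "finite R" and A: "A \<subseteq> R"
  shows "H ^ 4 * card {q \<in> R \<rightarrow>\<^sub>E {- int D..int D}. \<bar>sum q A\<bar> > int H} \<le> 3 * card R ^ 2 * D ^ 4 * (2 * D + 1) ^ card R"
proof -
  let ?Q = "R \<rightarrow>\<^sub>E {- int D..int D}"
  let ?L = "{q \<in> ?Q. \<bar>sum q A\<bar> > int H}"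
  have fQ: "finite ?Q" using R by (intro finite_PiE) auto
  have "int (H ^ 4 * card ?L) = (\<Sum>q\<in>?L. int H ^ 4)" by (simp add: mult.commute)
  also have "\<dots> \<le> (\<Sum>q\<in>?L. (sum q A) ^ 4)"
  proof (rule sum_mono)
    fix q assume "q \<in> ?L"
    then have "int H ^ 4 \<le> \<bar>sum q A\<bar> ^ 4" by (intro power_mono) auto
    then show "int H ^ 4 \<le> (sum q A) ^ 4" by (simp add: power_even_abs)
  qed
  also have "\<dots> \<le> (\<Sum>q\<in>?Q. (sum q A) ^ 4)" using fQ by (intro sum_mono2) auto
  also have "\<dots> \<le> int (3 * card A ^ 2 * D ^ 4 * (2 * D + 1) ^ card R)"
    using sum_fourth_power_le[OF R A, of D] by blast
  also have "\<dots> \<le> int (3 * card R ^ 2 * D ^ 4 * (2 * D + 1) ^ card R)"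
    unfolding of_nat_le_iff using card_mono[OF R A] by (intro mult_right_mono mult_left_mono power_mono) auto
  finally show ?thesis unfolding of_nat_le_iff .
qed

text \<open>Walks that start in the middle half of the range and move at most a quarter of it away
  stay inside. Taking \<open>m = s ^ 4\<close> makes \<open>m powr (3 / 4)\<close> the integer
  \<open>s ^ 3\<close>.\<close>

lemma card_pairing_points_ge:
  assumes \<pi>: "\<pi> \<in> pairings {..<2 * m}" and m: "m = s ^ 4" and s: "s > 0" and D: "D > 0"
  shows "8 * s ^ 3 * D * (2 * D) ^ m \<le> 8 * card (pairing_points (2 * m) \<pi> (8 * s ^ 3 * D))"
proof -
  let ?k = "2 * m"
  let ?R = "walk_openers ?k \<pi>"
  let ?Q = "?R \<rightarrow>\<^sub>E {- int D..int D}"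
  define N where "N = 8 * s ^ 3 * D"
  define H where "H = 2 * s ^ 3 * D"
  define A where "A = (\<lambda>j. {r \<in> ?R. r < j \<and> j \<le> \<pi> r})"
  define large where "large = (\<lambda>j. {q \<in> ?Q. \<bar>sum q (A j)\<bar> > int H})"
  define T where "T = (2 * D + 1) ^ m"
  have NH: "N = 4 * H" by (simp add: N_def H_def)
  have cR: "card ?R = m" using card_openers[OF finite_lessThan \<pi>] by simp
  have fQ: "finite ?Q" by (intro finite_PiE) auto
  have "card {- int D..int D} = 2 * D + 1" by simp
  then have cQ: "card ?Q = T" by (simp only: card_PiE prod_constant cR T_def finite_walk_openers)
  have H: "H > 0" using s D by (simp add: H_def)
  \<comment> \<open>As \<open>H ^ 4 = 16 * m ^ 3 * D ^ 4\<close>, the fourth moment bound makes at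
    most the fraction \<open>3 / (16 * m)\<close> of the step vectors bad at a given time.\<close>
  have large: "16 * m * card (large j) \<le> 3 * T" for j
  proof -
    have "H ^ 4 * card (large j) \<le> 3 * m ^ 2 * D ^ 4 * T"
      using card_large_sum_le[of ?R "A j" H D] unfolding cR T_def large_def by (auto simp: A_def)
    moreover have "H ^ 4 * card (large j) = (m ^ 2 * D ^ 4) * (16 * m * card (large j))"
      by (simp add: H_def m power_mult_distrib flip: power_mult power_add)
    moreover have "3 * m ^ 2 * D ^ 4 * T = (m ^ 2 * D ^ 4) * (3 * T)" by (simp only: mult_ac)
    ultimately have "(m ^ 2 * D ^ 4) * (16 * m * card (large j)) \<le> (m ^ 2 * D ^ 4) * (3 * T)" by argo
    moreover have "m ^ 2 * D ^ 4 > 0" using m s D by simp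
    ultimately show ?thesis by (simp only: mult_le_cancel1)
  qed
  \<comment> \<open>There are \<open>2 * m + 1 <= 3 * m\<close> times, so at most
    \<open>9 / 16\<close> of the step vectors are bad and more than a quarter are good.\<close>
  have "card (\<Union>j\<in>{..?k}. large j) \<le> (\<Sum>j\<le>?k. card (large j))" by (rule card_UN_le) simp
  then have "16 * m * card (\<Union>j\<in>{..?k}. large j) \<le> (\<Sum>j\<le>?k. 16 * m * card (large j))"
    by (simp add: sum_distrib_left[symmetric])
  also have "\<dots> \<le> (\<Sum>j\<le>?k. 3 * T)" using large by (rule sum_mono)
  also have "\<dots> = (2 * m + 1) * (3 * T)" by simp
  also have "\<dots> \<le> (3 * m) * (3 * T)" using m s by (intro mult_right_mono) (auto simp: Suc_le_eq)
  finally have "m * (16 * card (\<Union>j\<in>{..?k}. large j)) \<le> m * (9 * T)" by (simp add: algebra_simps)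
  then have bad: "16 * card (\<Union>j\<in>{..?k}. large j) \<le> 9 * T" using m s by simp
  define good where "good = ?Q - (\<Union>j\<in>{..?k}. large j)"
  have sub: "(\<Union>j\<in>{..?k}. large j) \<subseteq> ?Q" by (auto simp: large_def)
  have "card good = T - card (\<Union>j\<in>{..?k}. large j)"
    unfolding good_def using card_Diff_subset[OF finite_subset[OF sub fQ] sub] cQ by simp
  then have good: "T \<le> 4 * card good" using bad by linarith
  have kR: "?k \<notin> ?R" by (simp add: openers_def)
  let ?f = "\<lambda>(a, q). q(?k := a)"
  have "inj_on ?f ({int H..<3 * int H} \<times> good)"
  proof (rule inj_onI, clarify)
    fix a b and q q' :: "nat \<Rightarrow> int" assume q: "q \<in> good" "q' \<in> good" and eq: "q(?k := a) = q'(?k := b)"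
    have "a = b" using fun_cong[OF eq, of ?k] by simp
    moreover have "q i = q' i" if "i \<in> ?R" for i using fun_cong[OF eq, of i] that kR by (auto split: if_splits)
    then have "q = q'" using q by (intro PiE_ext[of q ?R "\<lambda>_. {- int D..int D}" q']) (auto simp: good_def)
    ultimately show "a = b \<and> q = q'" by simp
  qed
  moreover have "?f ` ({int H..<3 * int H} \<times> good) \<subseteq> pairing_points ?k \<pi> N"
  proof (rule image_subsetI)
    fix v assume "v \<in> {int H..<3 * int H} \<times> good"
    then obtain a q where v: "v = (a, q)" and a: "int H \<le> a" "a < 3 * int H" and q: "q \<in> good" by auto
    have qQ: "q \<in> ?Q" using q by (simp add: good_def)
    have DN: "D \<le> H" using s by (simp add: H_def)
    have "?f v \<in> insert ?k ?R \<rightarrow>\<^sub>E {- int N..<int N}"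
    proof (rule PiE_I)
      fix i assume i: "i \<in> insert ?k ?R"
      show "?f v i \<in> {- int N..<int N}"
      proof (cases "i = ?k")
        case True
        then show ?thesis using a H by (simp add: v NH)
      next
        case False
        then have "q i \<in> {- int D..int D}" using qQ i by blast
        then show ?thesis using False DN H by (simp add: v NH)
      qed
    next
      fix i assume "i \<notin> insert ?k ?R"
      then show "?f v i = undefined" using qQ by (auto simp: v PiE_def extensional_def)
    qed
    moreover have "0 \<le> sum (?f v) (open_at ?k \<pi> j) \<and> sum (?f v) (open_at ?k \<pi> j) < int N" if "j \<le> ?k" for j
    proof -
      have "?k \<notin> A j" by (auto simp: A_def openers_def)
      moreover have "finite (A j)" "open_at ?k \<pi> j = insert ?k (A j)" by (simp_all add: A_def open_at_def)
      ultimately have "sum (?f v) (open_at ?k \<pi> j) = a + sum (q(?k := a)) (A j)"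
        unfolding v by simp
      also have "sum (q(?k := a)) (A j) = sum q (A j)"
        using \<open>?k \<notin> A j\<close> by (intro sum.cong) auto
      finally have e: "sum (?f v) (open_at ?k \<pi> j) = a + sum q (A j)" .
      have "\<bar>sum q (A j)\<bar> \<le> int H" using q that by (force simp: good_def large_def)
      then show ?thesis unfolding e using a by (simp add: NH abs_le_iff)
    qed
    ultimately show "?f v \<in> pairing_points ?k \<pi> N" by (auto simp: lattice_points_def)
  qed
  ultimately have "card ({int H..<3 * int H} \<times> good) \<le> card (pairing_points ?k \<pi> N)"
    by (intro card_inj_on_le finite_lattice_points) auto
  moreover have "card {int H..<3 * int H} = 2 * H" by simp
  ultimately have "2 * H * card good \<le> card (pairing_points ?k \<pi> N)" by (simp only: card_cartesian_product)
  moreover have "N * T \<le> N * (4 * card good)" using good by (rule mult_left_mono) simp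
  moreover have "(2 * D) ^ m \<le> T" unfolding T_def by (intro power_mono) auto
  then have "N * (2 * D) ^ m \<le> N * T" by (rule mult_left_mono) simp
  ultimately have "N * (2 * D) ^ m \<le> 8 * card (pairing_points ?k \<pi> N)" unfolding NH by linarith
  then show ?thesis by (simp only: N_def)
qed

text \<open>The limit is taken along the scales \<open>8 * s ^ 3 * Suc D\<close>, where the ratio of
  the step range \<open>2 * Suc D\<close> to the scale is constantly
  \<open>1 / (4 * s ^ 3)\<close>.\<close>

lemma pairing_volume_ge:
  assumes \<pi>: "\<pi> \<in> pairings {..<2 * m}" and m: "m = s ^ 4" and s: "s > 0"
  shows "1 / 8 * (1 / (4 * real s ^ 3)) ^ m \<le> pairing_volume (2 * m) \<pi>"
proof -
  let ?k = "2 * m"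
  let ?g = "lattice_density (insert ?k (walk_openers ?k \<pi>)) (open_at ?k \<pi> ` {..?k})"
  define f where "f = (\<lambda>D. 8 * s ^ 3 * Suc D)"
  have "strict_mono f" unfolding f_def using s by (intro strict_monoI) simp
  then have lim: "(\<lambda>D. ?g (f D)) \<longlonglongrightarrow> pairing_volume ?k \<pi>"
    using LIMSEQ_subseq_LIMSEQ[OF pairing_density_tendsto] by (simp add: o_def)
  have "real (card (insert ?k (walk_openers ?k \<pi>))) = real (m + 1)"
    using card_index_set[OF \<pi>] by simp
  then have cI: "card (insert ?k (walk_openers ?k \<pi>)) = m + 1" by (simp only: of_nat_eq_iff)
  have "1 / 8 * (1 / (4 * real s ^ 3)) ^ m \<le> ?g (f D)" for D
  proof -
    have "f D * (2 * Suc D) ^ m \<le> 8 * card (pairing_points ?k \<pi> (f D))"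
      using card_pairing_points_ge[OF \<pi> m s, of "Suc D"] unfolding f_def by simp
    then have "real (f D * (2 * Suc D) ^ m) \<le> real (8 * card (pairing_points ?k \<pi> (f D)))" by (simp only: of_nat_le_iff)
    then have le: "real (f D) * (2 * real (Suc D)) ^ m / 8 \<le> real (card (pairing_points ?k \<pi> (f D)))" by simp
    have "f D > 0" using s by (simp add: f_def)
    then have f0: "real (f D) > 0" by (simp only: of_nat_0_less_iff)
    have "real (f D) = 4 * real s ^ 3 * (2 * real (Suc D))" by (simp add: f_def algebra_simps)
    then have "1 / (4 * real s ^ 3) = 2 * real (Suc D) / real (f D)" by (simp del: of_nat_Suc)
    then have "1 / 8 * (1 / (4 * real s ^ 3)) ^ m = (real (f D) * (2 * real (Suc D)) ^ m / 8) / real (f D) ^ (m + 1)"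
      using f0 by (simp add: power_divide)
    also have "\<dots> \<le> real (card (pairing_points ?k \<pi> (f D))) / real (f D) ^ (m + 1)"
      using le f0 by (intro divide_right_mono) auto
    finally show ?thesis by (simp only: lattice_density_def cI)
  qed
  then show ?thesis by (intro LIMSEQ_le_const[OF lim] exI[of _ 0]) auto
qed

text \<open>Each permutation of \<open>m\<close> points gives a pairing that matches the lower half
  of the indices with the upper half.\<close>

lemma fact_le_card_pairings: "fact m \<le> card (pairings {..<2 * m})"
proof -
  let ?f = "\<lambda>p. \<lambda>j\<in>{..<2 * m}. if j < m then m + p j else Hilbert_Choice.inv p (j - m)"
  have P: "?f p \<in> pairings {..<2 * m}" if "p permutes {..<m}" for p
  proof -
    have r: "p i < m" "Hilbert_Choice.inv p i < m" if "i < m" for i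
      using permutes_in_image[OF \<open>p permutes _\<close>, of i] permutes_in_image[OF permutes_inv[OF \<open>p permutes _\<close>], of i] that by auto
    have "?f p \<in> {..<2 * m} \<rightarrow>\<^sub>E {..<2 * m}"
    proof (rule restrict_PiE_iff[THEN iffD2], rule ballI)
      fix j assume "j \<in> {..<2 * m}"
      then show "(if j < m then m + p j else Hilbert_Choice.inv p (j - m)) \<in> {..<2 * m}"
      proof (cases "j < m")
        case True
        then show ?thesis using r(1)[OF True] by simp
      next
        case False
        then have "j - m < m" using \<open>j \<in> {..<2 * m}\<close> unfolding lessThan_iff by linarith
        then show ?thesis using False r(2)[of "j - m"] by simp
      qed
    qed
    moreover have "?f p j \<noteq> j \<and> ?f p (?f p j) = j" if "j < 2 * m" for j
    proof (cases "j < m")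
      case True
      then show ?thesis using r(1)[of j] permutes_inverses(2)[OF \<open>p permutes _\<close>] by simp
    next
      case False
      then have "j - m < m" using that by simp
      then show ?thesis using False that r(2)[of "j - m"] permutes_inverses(1)[OF \<open>p permutes _\<close>] by simp
    qed
    ultimately show ?thesis by (simp add: pairings_def)
  qed
  have "inj_on ?f {p. p permutes {..<m}}"
  proof (rule inj_onI)
    fix p q assume p: "p \<in> {p. p permutes {..<m}}" and q: "q \<in> {p. p permutes {..<m}}" and eq: "?f p = ?f q"
    show "p = q"
    proof
      fix j show "p j = q j"
      proof (cases "j < m")
        case True
        then show ?thesis using fun_cong[OF eq, of j] by simp
      next
        case False
        then show ?thesis using p q by (simp add: permutes_not_in)
      qed
    qed
  qed
  then have "card {p. p permutes {..<m}} \<le> card (pairings {..<2 * m})"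
    using P by (intro card_inj_on_le finite_pairings) auto
  then show ?thesis using card_permutations[of "{..<m}" m] by simp
qed

text \<open>The induction step rests on \<open>(1 + 1 / m) ^ m <= exp 1 <= 3\<close>.\<close>

lemma fact_ge_power: "(real m / 3) ^ m \<le> fact m"
proof (induction m)
  case 0
  then show ?case by simp
next
  case (Suc m)
  have "(real (Suc m) / 3) ^ m \<le> 3 * (real m / 3) ^ m"
  proof (cases "m = 0")
    case False
    have "(1 + 1 / real m) ^ m \<le> exp 1" using False by (intro exp_ge_one_plus_x_over_n_power_n) auto
    then have "(1 + 1 / real m) ^ m \<le> 3" using exp_le by linarith
    then have "(1 + 1 / real m) ^ m * (real m / 3) ^ m \<le> 3 * (real m / 3) ^ m" by (intro mult_right_mono) auto
    moreover have "(1 + 1 / real m) * (real m / 3) = real (Suc m) / 3" using False by (simp add: field_simps)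
    ultimately show ?thesis by (simp only: power_mult_distrib[symmetric])
  qed simp
  then have "(real (Suc m) / 3) ^ Suc m \<le> real (Suc m) / 3 * (3 * (real m / 3) ^ m)"
    unfolding power_Suc by (intro mult_left_mono) auto
  also have "\<dots> = real (Suc m) * (real m / 3) ^ m" by simp
  also have "\<dots> \<le> real (Suc m) * fact m" using Suc by (intro mult_left_mono) auto
  finally show ?case by simp
qed

text \<open>The number of pairings contributes \<open>m / 3 = s ^ 4 / 3\<close> to the base and the
  volume \<open>1 / (4 * s ^ 3)\<close>; their product \<open>s / 12\<close> is unbounded in
  \<open>s\<close>.\<close>

lemma limit_moment_ge:
  assumes m: "m = s ^ 4" and s: "s > 0"
  shows "1 / 8 * (real s / 12) ^ m \<le> limit_moment (2 * m)"
proof -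
  have eq: "real s / 12 = (real m / 3) * (1 / (4 * real s ^ 3))"
    using s by (simp add: m field_simps power4_eq_xxxx power3_eq_cube)
  have "1 / 8 * (real s / 12) ^ m = (real m / 3) ^ m * (1 / 8 * (1 / (4 * real s ^ 3)) ^ m)"
    unfolding eq power_mult_distrib by (simp only: mult_ac)
  also have "\<dots> \<le> real (card (pairings {..<2 * m})) * (1 / 8 * (1 / (4 * real s ^ 3)) ^ m)"
  proof (rule mult_right_mono)
    have "(fact m :: real) \<le> real (card (pairings {..<2 * m}))"
      using fact_le_card_pairings[of m] by (metis of_nat_fact of_nat_le_iff)
    then show "(real m / 3) ^ m \<le> real (card (pairings {..<2 * m}))" using fact_ge_power[of m] by linarith
  qed simp
  also have "\<dots> \<le> limit_moment (2 * m)"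
    unfolding limit_moment_def using pairing_volume_ge[OF _ m s] by (intro sum_bounded_below)
  finally show ?thesis .
qed

section \<open>The moment problem and weak convergence\<close>

text \<open>Moments that grow slowly enough for the characteristic function to be determined by them.\<close>
definition moment_growth :: "(nat \<Rightarrow> real) \<Rightarrow> bool" where
  "moment_growth c \<longleftrightarrow> (\<exists>K a. \<forall>n. c (2 * n) \<le> K * (a * real n) ^ n)"

definition has_moments :: "real measure \<Rightarrow> (nat \<Rightarrow> real) \<Rightarrow> bool" where
  "has_moments M c \<longleftrightarrow> real_distribution M \<and> (\<forall>k. integrable M (\<lambda>x. x ^ k) \<and> (\<integral>x. x ^ k \<partial>M) = c k)"

lemma fact_double_ge: "fact n * real n ^ n \<le> fact (2 * n)"
proof -
  have "fact n * real n ^ j \<le> fact (n + j)" for j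
  proof (induction j)
    case (Suc j)
    have "fact n * real n ^ Suc j = (fact n * real n ^ j) * real n" by simp
    also have "\<dots> \<le> fact (n + j) * real (Suc (n + j))" using Suc by (intro mult_mono) auto
    finally show ?case by (simp add: mult.commute)
  qed simp
  from this[of n] show ?thesis by (simp add: mult_2)
qed

text \<open>The Taylor polynomials \<open>S n\<close> depend on the moments alone. Since
  \<open>fact (2 * n)\<close> is at least \<open>fact n * n ^ n\<close>, the growth bound sends
  their error to 0 at every \<open>t\<close>, so no analytic continuation is involved.\<close>

lemma moments_determine_distribution:
  assumes growth: "moment_growth c" and M: "has_moments M c" and M': "has_moments M' c"
  shows "M = M'"
proof (rule Levy_uniqueness)
  show d: "real_distribution M" "real_distribution M'" using M M' by (auto simp: has_moments_def)
  obtain K a where Ka: "\<And>n. c (2 * n) \<le> K * (a * real n) ^ n" using growth by (auto simp: moment_growth_def)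
  show "char M = char M'"
  proof
    fix t
    define S where "S = (\<lambda>n. \<Sum>k\<le>2 * n. (\<i> * complex_of_real t) ^ k / fact k * complex_of_real (c k))"
    have approx: "cmod (char M t - S n) \<le> 2 * \<bar>t\<bar> ^ (2 * n) / fact (2 * n) * c (2 * n)" if "has_moments M c" for M n
      using real_distribution.char_approx1[of M "2 * n" t] that by (simp add: has_moments_def S_def power_even_abs)
    let ?e = "\<lambda>n. 4 * \<bar>K\<bar> * ((\<bar>a\<bar> * t\<^sup>2) ^ n / fact n)"
    have "cmod (char M t - char M' t) \<le> ?e n" if n: "n > 0" for n
    proof -
      have "cmod (char M t - char M' t) \<le> cmod (char M t - S n) + cmod (char M' t - S n)"
        using norm_triangle_ineq4[of "char M t - S n" "char M' t - S n"] by simp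
      also have "\<dots> \<le> 4 * \<bar>t\<bar> ^ (2 * n) / fact (2 * n) * c (2 * n)"
        using approx[OF M, of n] approx[OF M', of n] by simp
      also have "\<dots> \<le> 4 * \<bar>t\<bar> ^ (2 * n) / fact (2 * n) * (\<bar>K\<bar> * (\<bar>a\<bar> * real n) ^ n)"
      proof (rule mult_left_mono)
        have "K * (a * real n) ^ n \<le> \<bar>K * (a * real n) ^ n\<bar>" by (rule abs_ge_self)
        then show "c (2 * n) \<le> \<bar>K\<bar> * (\<bar>a\<bar> * real n) ^ n"
          using Ka[of n] by (simp add: abs_mult power_abs)
      qed simp
      also have "\<dots> = 4 * \<bar>K\<bar> * (\<bar>a\<bar> * t\<^sup>2) ^ n * (real n ^ n / fact (2 * n))"
      proof -
        have "\<bar>t\<bar> ^ (2 * n) = (t\<^sup>2) ^ n" by (simp add: power_mult)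
        then show ?thesis by (simp add: power_mult_distrib)
      qed
      also have "\<dots> \<le> 4 * \<bar>K\<bar> * (\<bar>a\<bar> * t\<^sup>2) ^ n * (1 / fact n)"
        using fact_double_ge[of n] by (intro mult_left_mono) (auto simp: field_simps)
      finally show ?thesis by simp
    qed
    moreover have "?e \<longlonglongrightarrow> 0"
      using summable_LIMSEQ_zero[OF summable_exp[of "\<bar>a\<bar> * t\<^sup>2"]]
      by (intro tendsto_mult_right_zero) (simp add: field_simps)
    ultimately have "cmod (char M t - char M' t) \<le> 0"
      by (intro LIMSEQ_le_const[where X = ?e] exI[of _ 1]) auto
    then show "char M t = char M' t" by simp
  qed
qed

section \<open>Weak limits of measures with convergent moments\<close>

lemma power_le_one_plus_even: "\<bar>x ^ k\<bar> \<le> 1 + x ^ (2 * k)" for x :: real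
proof -
  have "0 \<le> (\<bar>x ^ k\<bar> - 1)\<^sup>2" by simp
  then have "2 * \<bar>x ^ k\<bar> \<le> 1 + \<bar>x ^ k\<bar>\<^sup>2" by (simp add: power2_diff)
  moreover have "\<bar>x ^ k\<bar>\<^sup>2 = x ^ (2 * k)" by (simp add: power_mult[symmetric] mult.commute)
  ultimately show ?thesis using abs_ge_zero[of "x ^ k"] by linarith
qed

text \<open>Where the truncation acts, \<open>\<bar>x ^ k\<bar>\<close> exceeds \<open>T\<close> and
  so is at most its square divided by \<open>T\<close>.\<close>

lemma truncation_error:
  fixes x T :: real
  assumes "T > 0"
  shows "\<bar>x ^ k - max (- T) (min T (x ^ k))\<bar> \<le> x ^ (2 * k) / T"
proof (cases "\<bar>x ^ k\<bar> \<le> T")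
  case True
  then have "max (- T) (min T (x ^ k)) = x ^ k" by auto
  then show ?thesis using assms by (simp add: power_mult)
next
  case False
  have "\<bar>y - max (- T) (min T y)\<bar> \<le> \<bar>y\<bar>" for y using assms by (simp add: max_def min_def)
  then have "\<bar>x ^ k - max (- T) (min T (x ^ k))\<bar> \<le> \<bar>x ^ k\<bar>" .
  also have "\<dots> \<le> \<bar>x ^ k\<bar> * \<bar>x ^ k\<bar> / T"
    using False assms mult_left_mono[of T "\<bar>x ^ k\<bar>" "\<bar>x ^ k\<bar>"] by (simp add: le_divide_eq)
  also have "\<bar>x ^ k\<bar> * \<bar>x ^ k\<bar> = x ^ (2 * k)" by (simp add: mult_2 power_add)
  finally show ?thesis .
qed

text \<open>Convergence of all moments, without assuming that the limits are the moments of a measure.\<close>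
locale moments_converge =
  fixes \<nu> :: "nat \<Rightarrow> real measure" and c :: "nat \<Rightarrow> real"
  assumes dist: "\<And>n. real_distribution (\<nu> n)"
    and int: "\<And>n k. integrable (\<nu> n) (\<lambda>x. x ^ k)"
    and conv: "\<And>k. (\<lambda>n. \<integral>x. x ^ k \<partial>\<nu> n) \<longlonglongrightarrow> c k"
begin

text \<open>Second moments are bounded because they converge, and Markov's inequality then controls
  the tails uniformly.\<close>

lemma tight_sequence: "tight \<nu>"
  unfolding tight_def
proof (intro conjI allI impI)
  show "real_distribution (\<nu> n)" for n by (rule dist)
  fix \<epsilon> :: real assume \<epsilon>: "\<epsilon> > 0"
  have "Bseq (\<lambda>n. \<integral>x. x ^ 2 \<partial>\<nu> n)" using conv[of 2] by (intro convergent_imp_Bseq) (auto simp: convergent_def)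
  then obtain B where B: "B > 0" "\<And>n. \<bar>\<integral>x. x ^ 2 \<partial>\<nu> n\<bar> \<le> B" by (auto simp: Bseq_def)
  \<comment> \<open>This makes \<open>B / r ^ 2\<close> equal to
    \<open>\<epsilon> / 2\<close>.\<close>
  define r where "r = sqrt (2 * B / \<epsilon>)"
  have r: "r > 0" "r\<^sup>2 = 2 * B / \<epsilon>" using B(1) \<epsilon> by (auto simp: r_def)
  show "\<exists>a b. a < b \<and> (\<forall>n. 1 - \<epsilon> < measure (\<nu> n) {a<..b})"
  proof (rule exI[of _ "- r"], rule exI[of _ r], intro conjI allI)
    fix n
    interpret N: real_distribution "\<nu> n" by (rule dist)
    have "measure (\<nu> n) {x \<in> space (\<nu> n). x ^ 2 \<ge> r\<^sup>2} \<le> (\<integral>x. x ^ 2 \<partial>\<nu> n) / r\<^sup>2"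
      using int r(1) by (intro integral_Markov_inequality_measure[where A = "{}"]) auto
    also have "\<dots> \<le> B / r\<^sup>2" using B(2)[of n] by (intro divide_right_mono) auto
    also have "\<dots> < \<epsilon>" using B(1) \<epsilon> by (simp add: r(2))
    finally have "measure (\<nu> n) {x \<in> space (\<nu> n). x ^ 2 \<ge> r\<^sup>2} < \<epsilon>" .
    moreover have "measure (\<nu> n) (space (\<nu> n) - {- r<..r}) \<le> measure (\<nu> n) {x \<in> space (\<nu> n). x ^ 2 \<ge> r\<^sup>2}"
    proof (rule N.finite_measure_mono)
      show "space (\<nu> n) - {- r<..r} \<subseteq> {x \<in> space (\<nu> n). x ^ 2 \<ge> r\<^sup>2}"
        using r(1) by (auto simp: abs_le_square_iff[symmetric])
    qed simp
    moreover have "measure (\<nu> n) (space (\<nu> n) - {- r<..r}) = 1 - measure (\<nu> n) {- r<..r}"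
      by (rule N.prob_compl) simp
    ultimately show "1 - \<epsilon> < measure (\<nu> n) {- r<..r}" by linarith
  qed (use r in simp)
qed

text \<open>Truncated even powers are bounded and continuous, so their integrals pass to the weak
  limit and stay below \<open>c (2 * k)\<close>; monotone convergence removes the
  truncation.\<close>

lemma weak_limit_even_integrable:
  assumes M: "real_distribution M" and w: "weak_conv_m \<nu> M"
  shows "integrable M (\<lambda>x. x ^ (2 * k))"
proof -
  interpret M: real_distribution M by (rule M)
  let ?h = "\<lambda>(T :: nat) (x :: real). min (real T) (x ^ (2 * k))"
  have bnd: "\<bar>?h T x\<bar> \<le> real T" for T x by simp
  have iM: "integrable M (?h T)" for T
    by (rule M.integrable_const_bound[where B = "real T"]) (use bnd in auto)
  have le: "(\<integral>x. ?h T x \<partial>M) \<le> c (2 * k)" for T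
  proof (rule LIMSEQ_le)
    show "(\<lambda>n. \<integral>x. ?h T x \<partial>\<nu> n) \<longlonglongrightarrow> (\<integral>x. ?h T x \<partial>M)"
      by (rule weak_conv_imp_integral_bdd_continuous_conv[OF dist M w, where B = "real T"])
         (use bnd in \<open>auto intro!: continuous_intros\<close>)
    show "(\<lambda>n. \<integral>x. x ^ (2 * k) \<partial>\<nu> n) \<longlonglongrightarrow> c (2 * k)" by (rule conv)
    have "(\<integral>x. ?h T x \<partial>\<nu> n) \<le> (\<integral>x. x ^ (2 * k) \<partial>\<nu> n)" for n
    proof (rule integral_mono[OF _ int])
      interpret N: real_distribution "\<nu> n" by (rule dist)
      show "integrable (\<nu> n) (?h T)"
        by (rule N.integrable_const_bound[where B = "real T"]) (use bnd in auto)
    qed simp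
    then show "\<exists>N. \<forall>n\<ge>N. (\<integral>x. ?h T x \<partial>\<nu> n) \<le> (\<integral>x. x ^ (2 * k) \<partial>\<nu> n)" by blast
  qed
  have "incseq (\<lambda>T. \<integral>x. ?h T x \<partial>M)"
    by (intro incseq_SucI integral_mono iM) auto
  moreover have "\<And>T. (\<integral>x. ?h T x \<partial>M) \<le> c (2 * k)" by (rule le)
  ultimately obtain L where L: "(\<lambda>T. \<integral>x. ?h T x \<partial>M) \<longlonglongrightarrow> L"
    using incseq_convergent by metis
  show ?thesis
  proof (rule integrable_monotone_convergence[OF iM _ _ L])
    show "AE x in M. mono (\<lambda>T. ?h T x)" by (auto simp: mono_def min_def)
    show "AE x in M. (\<lambda>T. ?h T x) \<longlonglongrightarrow> x ^ (2 * k)"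
    proof (rule AE_I2)
      fix x :: real
      obtain T0 :: nat where "x ^ (2 * k) \<le> real T0" using real_arch_simple by blast
      then have "eventually (\<lambda>T. ?h T x = x ^ (2 * k)) sequentially"
        by (intro eventually_sequentiallyI[of T0]) (auto simp: min_def)
      then show "(\<lambda>T. ?h T x) \<longlonglongrightarrow> x ^ (2 * k)" by (rule tendsto_eventually)
    qed
  qed simp
qed

text \<open>Weak convergence handles only bounded functions. The next even moment bounds the cost of
  truncating \<open>x ^ k\<close> at \<open>T\<close>, uniformly along the sequence, and the cost
  vanishes as \<open>T\<close> grows.\<close>

lemma weak_limit_has_moments:
  assumes M: "real_distribution M" and w: "weak_conv_m \<nu> M"
  shows "has_moments M c"
  unfolding has_moments_def
proof (intro conjI allI)
  show "real_distribution M" by (rule M)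
  interpret M: real_distribution M by (rule M)
  note even = weak_limit_even_integrable[OF M w]
  fix k
  show ik: "integrable M (\<lambda>x. x ^ k)"
  proof (rule Bochner_Integration.integrable_bound)
    show "integrable M (\<lambda>x. 1 + x ^ (2 * k))" using even by simp
    show "AE x in M. norm (x ^ k) \<le> norm (1 + x ^ (2 * k))"
    proof (rule AE_I2)
      fix x :: real
      show "norm (x ^ k) \<le> norm (1 + x ^ (2 * k))"
        using power_le_one_plus_even[of x k] by (simp only: real_norm_def abs_of_nonneg)
    qed
  qed simp
  \<comment> \<open>The two summands bound the truncation cost for \<open>M\<close> and, in the
    limit, along the sequence.\<close>
  define D where "D = (\<integral>x. x ^ (2 * k) \<partial>M) + c (2 * k)"
  have close: "\<bar>(\<integral>x. x ^ k \<partial>M) - c k\<bar> \<le> D / T" if T: "T > 0" for T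
  proof -
    let ?g = "\<lambda>x :: real. max (- T) (min T (x ^ k))"
    have bnd: "\<bar>?g x\<bar> \<le> T" for x using T by auto
    have diff: "\<bar>(\<integral>x. x ^ k \<partial>N) - (\<integral>x. ?g x \<partial>N)\<bar> \<le> (\<integral>x. x ^ (2 * k) \<partial>N) / T"
      if N: "real_distribution N" and ik: "integrable N (\<lambda>x. x ^ k)" and i2k: "integrable N (\<lambda>x. x ^ (2 * k))" for N
    proof -
      interpret N: real_distribution N by (rule N)
      have ig: "integrable N ?g" by (rule N.integrable_const_bound[where B = T]) (use bnd in auto)
      have "\<bar>(\<integral>x. x ^ k \<partial>N) - (\<integral>x. ?g x \<partial>N)\<bar> = \<bar>\<integral>x. x ^ k - ?g x \<partial>N\<bar>"
        by (subst Bochner_Integration.integral_diff[OF ik ig]) simp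
      also have "\<dots> \<le> (\<integral>x. \<bar>x ^ k - ?g x\<bar> \<partial>N)" by (rule integral_abs_bound)
      also have "\<dots> \<le> (\<integral>x. x ^ (2 * k) / T \<partial>N)"
        using ik ig i2k T by (intro integral_mono integrable_abs Bochner_Integration.integrable_diff truncation_error) auto
      finally show ?thesis by simp
    qed
    have "(\<lambda>n. \<integral>x. ?g x \<partial>\<nu> n) \<longlonglongrightarrow> (\<integral>x. ?g x \<partial>M)"
      by (rule weak_conv_imp_integral_bdd_continuous_conv[OF dist M w, where B = T])
         (use bnd in \<open>auto intro!: continuous_intros\<close>)
    then have lim: "(\<lambda>n. \<bar>(\<integral>x. x ^ k \<partial>\<nu> n) - (\<integral>x. ?g x \<partial>\<nu> n)\<bar>) \<longlonglongrightarrow> \<bar>c k - (\<integral>x. ?g x \<partial>M)\<bar>"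
      by (intro tendsto_rabs tendsto_diff conv)
    have "\<bar>c k - (\<integral>x. ?g x \<partial>M)\<bar> \<le> c (2 * k) / T"
    proof (rule LIMSEQ_le[OF lim])
      show "(\<lambda>n. (\<integral>x. x ^ (2 * k) \<partial>\<nu> n) / T) \<longlonglongrightarrow> c (2 * k) / T"
        using T by (intro tendsto_divide conv tendsto_const) auto
      show "\<exists>N. \<forall>n\<ge>N. \<bar>(\<integral>x. x ^ k \<partial>\<nu> n) - (\<integral>x. ?g x \<partial>\<nu> n)\<bar> \<le> (\<integral>x. x ^ (2 * k) \<partial>\<nu> n) / T"
        using diff[OF dist int int] by blast
    qed
    then show ?thesis using diff[OF M ik even[of k]] by (simp add: D_def add_divide_distrib)
  qed
  have "\<bar>(\<integral>x. x ^ k \<partial>M) - c k\<bar> \<le> 0"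
  proof (rule LIMSEQ_le_const)
    show "(\<lambda>n. D / real n) \<longlonglongrightarrow> 0" by (rule lim_const_over_n)
    show "\<exists>N. \<forall>n\<ge>N. \<bar>(\<integral>x. x ^ k \<partial>M) - c k\<bar> \<le> D / real n"
      using close by (intro exI[of _ 1]) auto
  qed
  then show "(\<integral>x. x ^ k \<partial>M) = c k" by simp
qed

end

lemma moments_converge_subseq:
  assumes "moments_converge \<nu> c" "strict_mono s"
  shows "moments_converge (\<nu> \<circ> s) c"
proof -
  interpret moments_converge \<nu> c by (rule assms(1))
  show ?thesis
  proof (rule moments_converge.intro)
    show "real_distribution ((\<nu> \<circ> s) n)" for n using dist by simp
    show "integrable ((\<nu> \<circ> s) n) (\<lambda>x. x ^ k)" for n k using int by simp
    show "(\<lambda>n. \<integral>x. x ^ k \<partial>(\<nu> \<circ> s) n) \<longlonglongrightarrow> c k" for k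
      using LIMSEQ_subseq_LIMSEQ[OF conv[of k] assms(2)] by (simp add: o_def)
  qed
qed

text \<open>Existence in the moment problem comes from tightness here, not from positivity of Hankel
  forms.\<close>

lemma moment_limit_exists:
  assumes "moments_converge \<nu> c"
  shows "\<exists>M. has_moments M c"
proof -
  obtain r M where r: "strict_mono r" "real_distribution M" "weak_conv_m (\<nu> \<circ> id \<circ> r) M"
    using tight_imp_convergent_subsubsequence[OF moments_converge.tight_sequence[OF assms], of id]
    by (auto simp: strict_mono_def)
  then have "has_moments M c"
    using moments_converge.weak_limit_has_moments[OF moments_converge_subseq[OF assms r(1)]] by simp
  then show ?thesis by blast
qed

text \<open>Every subsequential weak limit has the moments \<open>c\<close>, so by determinacy it is
  \<open>M\<close>; tightness turns this into convergence of the whole sequence.\<close>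

lemma moments_converge_imp_weak_conv:
  assumes \<nu>: "moments_converge \<nu> c" and growth: "moment_growth c" and M: "has_moments M c"
  shows "weak_conv_m \<nu> M"
proof (rule tight_subseq_weak_converge)
  show "\<And>n. real_distribution (\<nu> n)" by (rule moments_converge.dist[OF \<nu>])
  show "real_distribution M" using M by (simp add: has_moments_def)
  show "tight \<nu>" by (rule moments_converge.tight_sequence[OF \<nu>])
  fix s M' assume s: "strict_mono s" and M': "real_distribution M'" "weak_conv_m (\<nu> \<circ> s) M'"
  have "has_moments M' c"
    by (rule moments_converge.weak_limit_has_moments[OF moments_converge_subseq[OF \<nu> s] M'])
  then have "M' = M" using moments_determine_distribution[OF growth _ M] by blast
  then show "weak_conv_m (\<nu> \<circ> s) M" using M' by simp
qed

text \<open>Only finitely many moments are compared, so that a union bound can enforce the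
  condition. Integrability is explicit because the integral of a non-integrable function is 0 by
  default.\<close>

abbreviation moments_close :: "(nat \<Rightarrow> real) \<Rightarrow> nat \<Rightarrow> real \<Rightarrow> real measure \<Rightarrow> bool" where
  "moments_close c K \<delta> \<nu> \<equiv> real_distribution \<nu> \<and> (\<forall>k. integrable \<nu> (\<lambda>x. x ^ k)) \<and>
     (\<forall>k\<le>K. \<bar>(\<integral>x. x ^ k \<partial>\<nu>) - c k\<bar> \<le> \<delta>)"

lemma moments_close_imp_converge:
  assumes "\<And>n. moments_close c n (1 / real (Suc n)) (\<nu> n)"
  shows "moments_converge \<nu> c"
proof (rule moments_converge.intro)
  fix k
  have "(\<lambda>n. (\<integral>x. x ^ k \<partial>\<nu> n) - c k) \<longlonglongrightarrow> 0"
  proof (rule Lim_null_comparison)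
    show "eventually (\<lambda>n. norm ((\<integral>x. x ^ k \<partial>\<nu> n) - c k) \<le> 1 / real (Suc n)) sequentially"
      using assms by (intro eventually_sequentiallyI[of k]) auto
    show "(\<lambda>n. 1 / real (Suc n)) \<longlonglongrightarrow> 0" by (rule LIMSEQ_Suc[OF lim_const_over_n])
  qed
  then show "(\<lambda>n. \<integral>x. x ^ k \<partial>\<nu> n) \<longlonglongrightarrow> c k" by (simp add: LIM_zero_iff)
qed (use assms in auto)

lemma moments_close_imp_exists:
  assumes "\<And>K \<delta>. \<delta> > 0 \<Longrightarrow> \<exists>\<nu>. moments_close c K \<delta> \<nu>"
  shows "\<exists>M. has_moments M c"
proof -
  have "\<forall>n. \<exists>\<nu>. moments_close c n (1 / real (Suc n)) \<nu>" using assms by simp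
  then obtain \<nu> where "\<And>n. moments_close c n (1 / real (Suc n)) (\<nu> n)" by metis
  then show ?thesis by (intro moment_limit_exists[of \<nu>] moments_close_imp_converge)
qed

text \<open>If no \<open>K\<close> and \<open>\<delta>\<close> served, the choices \<open>n\<close>
  and \<open>1 / Suc n\<close> would give measures whose moments converge to \<open>c\<close> while
  their integrals of \<open>f\<close> stay away from that of \<open>M\<close>.\<close>

lemma moments_close_imp_integral_close:
  fixes f :: "real \<Rightarrow> real"
  assumes growth: "moment_growth c" and M: "has_moments M c"
    and f: "continuous_on UNIV f" "bounded (range f)" and \<epsilon>: "\<epsilon> > 0"
  obtains K \<delta> where "\<delta> > 0" "\<And>\<nu>. moments_close c K \<delta> \<nu> \<Longrightarrow> \<bar>(\<integral>x. f x \<partial>\<nu>) - (\<integral>x. f x \<partial>M)\<bar> \<le> \<epsilon>"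
proof (rule ccontr)
  assume neg: "\<not> thesis"
  have "\<exists>\<nu>. moments_close c n (1 / real (Suc n)) \<nu> \<and> \<not> \<bar>(\<integral>x. f x \<partial>\<nu>) - (\<integral>x. f x \<partial>M)\<bar> \<le> \<epsilon>" for n
    using neg that[of "1 / real (Suc n)" n] by fastforce
  then obtain \<nu> where \<nu>: "\<And>n. moments_close c n (1 / real (Suc n)) (\<nu> n)"
    "\<And>n. \<not> \<bar>(\<integral>x. f x \<partial>\<nu> n) - (\<integral>x. f x \<partial>M)\<bar> \<le> \<epsilon>" by metis
  have mc: "moments_converge \<nu> c" using \<nu>(1) by (rule moments_close_imp_converge)
  obtain B where "\<And>x. norm (f x) \<le> B" using f(2) by (auto simp: bounded_iff)
  moreover have "isCont f x" for x using f(1) by (simp add: continuous_on_eq_continuous_at)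
  moreover have "real_distribution M" using M by (simp add: has_moments_def)
  ultimately have "(\<lambda>n. \<integral>x. f x \<partial>\<nu> n) \<longlonglongrightarrow> (\<integral>x. f x \<partial>M)"
    using weak_conv_imp_integral_bdd_continuous_conv[OF moments_converge.dist[OF mc] _ moments_converge_imp_weak_conv[OF mc growth M]] by blast
  then have "eventually (\<lambda>n. dist (\<integral>x. f x \<partial>\<nu> n) (\<integral>x. f x \<partial>M) < \<epsilon>) sequentially"
    using \<epsilon> by (rule tendstoD)
  then obtain n where "dist (\<integral>x. f x \<partial>\<nu> n) (\<integral>x. f x \<partial>M) < \<epsilon>"
    using eventually_happens'[OF sequentially_bot] by blast
  then show False using \<nu>(2)[of n] by (simp add: dist_real_def)
qed

text \<open>Each compact shell outside the support is covered by finitely many null balls, and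
  countably many shells exhaust the outside; so \<open>M\<close> lives on
  \<open>{- r..r}\<close>.\<close>

lemma bounded_support_moment_bound:
  assumes M: "has_moments M c" and b: "bounded (msupport M)"
  obtains r where "r > 0" "\<And>n. c (2 * n) \<le> r ^ (2 * n)"
proof -
  interpret M: real_distribution M using M by (simp add: has_moments_def)
  obtain r where r: "r > 0" "\<And>x. x \<in> msupport M \<Longrightarrow> \<bar>x\<bar> < r"
    using b by (auto simp: bounded_pos_less)
  have null: "AE x in M. \<not> (r \<le> \<bar>x\<bar> \<and> \<bar>x\<bar> \<le> real n)" for n :: nat
  proof -
    let ?C = "{x :: real. r \<le> \<bar>x\<bar> \<and> \<bar>x\<bar> \<le> real n}"
    have "?C = ({- real n..- r} \<union> {r..real n})" using r(1) by (auto simp: abs_if)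
    then have cC: "compact ?C" by (simp add: compact_Un)
    have "\<exists>e>0. measure M (ball x e) = 0" if "x \<in> ?C" for x
    proof -
      have "x \<notin> msupport M" using r(2) that by force
      then show ?thesis unfolding msupport_def by (auto simp: not_less) (metis measure_le_0_iff)
    qed
    then obtain e where e: "\<And>x. x \<in> ?C \<Longrightarrow> e x > 0 \<and> measure M (ball x (e x)) = 0" by metis
    obtain F where F: "F \<subseteq> ?C" "finite F" "?C \<subseteq> (\<Union>x\<in>F. ball x (e x))"
    proof (rule compactE_image[OF cC, of ?C "\<lambda>x. ball x (e x)"])
      show "?C \<subseteq> (\<Union>x\<in>?C. ball x (e x))" using e by force
    qed auto
    have "AE x in M. x \<notin> ball y (e y)" if "y \<in> F" for y
    proof -
      have "measure M (ball y (e y)) = 0" using e that F(1) by blast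
      then have "ball y (e y) \<in> null_sets M" by (simp add: null_sets_def M.emeasure_eq_measure)
      then show ?thesis by (rule AE_not_in)
    qed
    then have "AE x in M. \<forall>y\<in>F. x \<notin> ball y (e y)" using F(2) by (intro AE_finite_allI)
    then show ?thesis
    proof eventually_elim
      case (elim x)
      then show ?case using F(3) by blast
    qed
  qed
  have "AE x in M. \<forall>n :: nat. \<not> (r \<le> \<bar>x\<bar> \<and> \<bar>x\<bar> \<le> real n)" unfolding AE_all_countable using null by blast
  then have ae: "AE x in M. \<bar>x\<bar> \<le> r"
  proof eventually_elim
    case (elim x)
    obtain n :: nat where "\<bar>x\<bar> \<le> real n" using real_arch_simple by blast
    then show ?case using elim by force
  qed
  have "c (2 * n) \<le> r ^ (2 * n)" for n
  proof -
    have "(\<integral>x. x ^ (2 * n) \<partial>M) \<le> (\<integral>x. r ^ (2 * n) \<partial>M)"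
    proof (rule integral_mono_AE)
      show "integrable M (\<lambda>x. x ^ (2 * n))" using M by (simp add: has_moments_def)
      show "AE x in M. x ^ (2 * n) \<le> r ^ (2 * n)" using ae
      proof eventually_elim
        case (elim x)
        then have "\<bar>x\<bar> ^ (2 * n) \<le> r ^ (2 * n)" by (intro power_mono) auto
        then show ?case by (simp add: power_even_abs)
      qed
    qed simp
    then show ?thesis using M M.prob_space by (simp add: has_moments_def)
  qed
  then show ?thesis using that r(1) by blast
qed

section \<open>The limiting spectral measure\<close>

text \<open>The spectral measure is the image of the uniform distribution on the positions in a list
  of the eigenvalues, so that multiplicities count.\<close>

lemma empirical_measure:
  assumes N: "N > 0"
  obtains \<nu> where "real_distribution \<nu>" "\<And>k. integrable \<nu> (\<lambda>x. x ^ k)"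
    "\<And>k. (\<integral>x. x ^ k \<partial>\<nu>) = moment_AN k N b"
    "\<And>f. f \<in> borel_measurable borel \<Longrightarrow> (\<integral>x. f x \<partial>\<nu>) = esm_integral N b f"
proof -
  obtain es where es: "eigenvalues_ms (toeplitz_mat N b) = mset es" "length es = N"
    "\<And>k. mat_trace (toeplitz_mat N b ^\<^sub>m k) = (\<Sum>e\<leftarrow>es. e ^ k)"
    using eigenvalues_ms_toeplitz[of N b] by metis
  have esm: "esm_integral N b f = (\<Sum>e\<leftarrow>es. f (e / sqrt (real N))) / real N" for f
    unfolding esm_integral_def es(1) mset_map[symmetric] sum_mset_sum_list by simp
  define P where "P = pmf_of_set {..<N}"
  have fin: "finite (set_pmf P)" using N by (simp add: P_def set_pmf_of_set lessThan_empty_iff)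
  let ?X = "\<lambda>i. es ! i / sqrt (real N)"
  define \<nu> where "\<nu> = distr (measure_pmf P) borel ?X"
  have int: "(\<integral>x. f x \<partial>\<nu>) = esm_integral N b f" if "f \<in> borel_measurable borel" for f :: "real \<Rightarrow> real"
  proof -
    have "(\<integral>x. f x \<partial>\<nu>) = measure_pmf.expectation P (\<lambda>i. f (?X i))"
      unfolding \<nu>_def by (rule integral_distr) (use that in auto)
    also have "\<dots> = (\<Sum>i<N. f (?X i)) / real N"
      using N by (simp add: P_def integral_pmf_of_set lessThan_empty_iff)
    also have "(\<Sum>i<N. f (?X i)) = (\<Sum>e\<leftarrow>es. f (e / sqrt (real N)))"
      by (simp add: sum_list_sum_nth es(2) atLeast0LessThan)
    also have "\<dots> / real N = esm_integral N b f"
      by (rule esm[symmetric])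
    finally show ?thesis .
  qed
  have "(\<integral>x. x ^ k \<partial>\<nu>) = moment_AN k N b" for k
  proof -
    have "sqrt (real N) ^ k = real N powr (real k / 2)"
      using N by (simp add: powr_half_sqrt[symmetric] powr_powr powr_realpow[symmetric])
    then have eq: "(1 / real N) * inverse (sqrt (real N) ^ k) = real N powr (- (real k / 2 + 1))"
      using N by (simp only: powr_minus powr_add inverse_mult_distrib) (simp add: field_simps)
    have "(\<Sum>e\<leftarrow>es. (e / sqrt (real N)) ^ k) = inverse (sqrt (real N) ^ k) * (\<Sum>e\<leftarrow>es. e ^ k)"
      unfolding sum_list_const_mult[symmetric] by (simp add: power_mult_distrib power_inverse divide_inverse mult.commute)
    then have "esm_integral N b (\<lambda>x. x ^ k) = real N powr (- (real k / 2 + 1)) * (\<Sum>e\<leftarrow>es. e ^ k)"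
      unfolding esm eq[symmetric] by simp
    then show ?thesis using int[of "\<lambda>x. x ^ k"] by (simp add: moment_AN_def es(3))
  qed
  moreover have "real_distribution \<nu>"
    unfolding \<nu>_def by (intro prob_space.real_distribution_distr measure_pmf.prob_space_axioms) simp
  moreover have "integrable \<nu> (\<lambda>x. x ^ k)" for k
    unfolding \<nu>_def by (subst integrable_distr_eq) (auto intro!: integrable_measure_pmf_finite fin)
  ultimately show ?thesis using that[of \<nu>] int by blast
qed

text \<open>A concrete admissible density supplies the realizations from which the limiting measure
  is built.\<close>

lemma admissible_normal_density: "admissible_density std_normal_density"
proof -
  have "prob_space (density lborel (\<lambda>x. ennreal (std_normal_density x)))"
    using prob_space_normal_density[of 1 0] by simp
  moreover have "integrable (density lborel (\<lambda>x. ennreal (std_normal_density x))) (\<lambda>x. x ^ k)" for k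
    by (rule integrable_std_normal_distribution_moment)
  moreover have "(\<integral>x. x \<partial>(density lborel (\<lambda>x. ennreal (std_normal_density x)))) = 0"
    using integral_std_normal_distribution_moment_odd[of 1] by simp
  moreover have "(\<integral>x. x ^ 2 \<partial>(density lborel (\<lambda>x. ennreal (std_normal_density x)))) = 1"
    using std_normal_distribution_even_moments[of 1] by simp
  ultimately show ?thesis by (simp add: admissible_density_def)
qed

lemma limit_moment_growth: "moment_growth limit_moment"
  unfolding moment_growth_def using limit_moment_even_le by blast

context entry_distribution
begin

lemma prob_some_moment_far_tendsto_0:
  assumes "\<delta> > 0"
  shows "(\<lambda>N. \<Sum>k\<le>K. measure (toeplitz_space p N) {b \<in> space (toeplitz_space p N). \<bar>moment_AN k N b - limit_moment k\<bar> > \<delta>}) \<longlonglongrightarrow> 0"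
  using tendsto_sum[of "{..K}", OF moment_AN_tendsto_in_probability[OF assms]] by simp

text \<open>\<open>S\<close> need not be measurable, so the measurability of the eigenvalues in \<open>b\<close> plays no role.\<close>
lemma prob_not_close_le:
  assumes "S \<subseteq> (\<Union>k\<le>K. {b \<in> space (toeplitz_space p N). \<bar>moment_AN k N b - limit_moment k\<bar> > \<delta>})"
  shows "measure (toeplitz_space p N) S \<le> (\<Sum>k\<le>K. measure (toeplitz_space p N) {b \<in> space (toeplitz_space p N). \<bar>moment_AN k N b - limit_moment k\<bar> > \<delta>})"
proof -
  interpret T: prob_space "toeplitz_space p N" by (rule space_prob)
  have [measurable]: "moment_AN k N \<in> borel_measurable (toeplitz_space p N)" for k
    using integrable_moment_AN by (rule borel_measurable_integrable)
  have "T.prob S \<le> T.prob (\<Union>k\<in>{..K}. {b \<in> space (toeplitz_space p N). \<bar>moment_AN k N b - limit_moment k\<bar> > \<delta>})"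
    using assms by (intro T.finite_measure_mono) measurable
  also have "\<dots> \<le> (\<Sum>k\<in>{..K}. T.prob {b \<in> space (toeplitz_space p N). \<bar>moment_AN k N b - limit_moment k\<bar> > \<delta>})"
    by (intro T.finite_measure_subadditive_finite) auto
  finally show ?thesis .
qed

text \<open>For large \<open>N\<close> the realizations with a distant moment have total probability
  below 1, so some realization avoids them; its spectral measure is the witness.\<close>

lemma close_realization_exists:
  assumes "\<delta> > 0"
  shows "\<exists>\<nu>. moments_close limit_moment K \<delta> \<nu>"
proof -
  let ?far = "\<lambda>k N. {b \<in> space (toeplitz_space p N). \<bar>moment_AN k N b - limit_moment k\<bar> > \<delta>}"
  have "eventually (\<lambda>N. (\<Sum>k\<le>K. measure (toeplitz_space p N) (?far k N)) < 1) sequentially"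
    by (rule order_tendstoD(2)[OF prob_some_moment_far_tendsto_0[OF assms]]) simp
  then have "eventually (\<lambda>N. (\<Sum>k\<le>K. measure (toeplitz_space p N) (?far k N)) < 1 \<and> N > 0) sequentially"
    using eventually_gt_at_top[of 0] by (rule eventually_conj)
  then obtain N where N: "(\<Sum>k\<le>K. measure (toeplitz_space p N) (?far k N)) < 1" "N > 0"
    using eventually_happens'[OF sequentially_bot] by blast
  interpret T: prob_space "toeplitz_space p N" by (rule space_prob)
  have "\<not> space (toeplitz_space p N) \<subseteq> (\<Union>k\<le>K. ?far k N)"
    using prob_not_close_le[where S = "space (toeplitz_space p N)" and K = K and N = N and \<delta> = \<delta>] N(1) T.prob_space by linarith
  then obtain b where "b \<in> space (toeplitz_space p N)" "b \<notin> (\<Union>k\<le>K. ?far k N)" by blast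
  then have b: "\<And>k. k \<le> K \<Longrightarrow> \<bar>moment_AN k N b - limit_moment k\<bar> \<le> \<delta>" by (auto simp: not_less)
  obtain \<nu> where "real_distribution \<nu>" "\<And>k. integrable \<nu> (\<lambda>x. x ^ k)"
    "\<And>k. (\<integral>x. x ^ k \<partial>\<nu>) = moment_AN k N b"
    using empirical_measure[OF N(2)] by metis
  then show ?thesis using b by (intro exI[of _ \<nu>]) auto
qed

text \<open>The \<open>K\<close> and \<open>\<delta>\<close> of
  \<open>moments_close_imp_integral_close\<close> serve all realizations at once: a deviation of the
  integral forces one of finitely many moments to deviate.\<close>

lemma esm_converges_in_probability:
  fixes f :: "real \<Rightarrow> real"
  assumes M: "has_moments M limit_moment" and f: "continuous_on UNIV f" "bounded (range f)" and \<epsilon>: "\<epsilon> > 0"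
  shows "(\<lambda>N. measure (toeplitz_space p N) {b \<in> space (toeplitz_space p N).
      \<bar>esm_integral N b f - (\<integral>x. f x \<partial>M)\<bar> > \<epsilon>}) \<longlonglongrightarrow> 0"
proof -
  obtain K \<delta> where \<delta>: "\<delta> > 0"
    and close: "\<And>\<nu>. moments_close limit_moment K \<delta> \<nu> \<Longrightarrow> \<bar>(\<integral>x. f x \<partial>\<nu>) - (\<integral>x. f x \<partial>M)\<bar> \<le> \<epsilon>"
    using moments_close_imp_integral_close[OF limit_moment_growth M f \<epsilon>] by metis
  have fb: "f \<in> borel_measurable borel" using f(1) by (rule borel_measurable_continuous_onI)
  let ?far = "\<lambda>k N. {b \<in> space (toeplitz_space p N). \<bar>moment_AN k N b - limit_moment k\<bar> > \<delta>}"
  show ?thesis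
  proof (rule Lim_null_comparison[OF _ prob_some_moment_far_tendsto_0[OF \<delta>, of K]])
    show "eventually (\<lambda>N. norm (measure (toeplitz_space p N) {b \<in> space (toeplitz_space p N).
        \<bar>esm_integral N b f - (\<integral>x. f x \<partial>M)\<bar> > \<epsilon>}) \<le> (\<Sum>k\<le>K. measure (toeplitz_space p N) (?far k N))) sequentially"
      using eventually_gt_at_top[of 0]
    proof eventually_elim
      case (elim N)
      have "b \<in> (\<Union>k\<le>K. ?far k N)"
        if b: "b \<in> space (toeplitz_space p N)" "\<bar>esm_integral N b f - (\<integral>x. f x \<partial>M)\<bar> > \<epsilon>" for b
      proof (rule ccontr)
        assume "b \<notin> (\<Union>k\<le>K. ?far k N)"
        then have le: "\<And>k. k \<le> K \<Longrightarrow> \<bar>moment_AN k N b - limit_moment k\<bar> \<le> \<delta>" using b(1) by (auto simp: not_less)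
        obtain \<nu> where \<nu>: "real_distribution \<nu>" "\<And>k. integrable \<nu> (\<lambda>x. x ^ k)"
          "\<And>k. (\<integral>x. x ^ k \<partial>\<nu>) = moment_AN k N b"
          "\<And>f. f \<in> borel_measurable borel \<Longrightarrow> (\<integral>x. f x \<partial>\<nu>) = esm_integral N b f"
          using empirical_measure[OF elim] by blast
        have "\<bar>(\<integral>x. f x \<partial>\<nu>) - (\<integral>x. f x \<partial>M)\<bar> \<le> \<epsilon>" by (rule close) (use \<nu> le in auto)
        then show False using b(2) \<nu>(4)[OF fb] by simp
      qed
      then have "{b \<in> space (toeplitz_space p N). \<bar>esm_integral N b f - (\<integral>x. f x \<partial>M)\<bar> > \<epsilon>} \<subseteq> (\<Union>k\<le>K. ?far k N)"
        by blast
      from prob_not_close_le[OF this] show ?case by simp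
    qed
  qed
qed

end

lemma limit_moments_unbounded_support:
  assumes M: "has_moments M limit_moment"
  shows "\<not> bounded (msupport M)"
proof
  assume "bounded (msupport M)"
  then obtain r where r: "r > 0" "\<And>n. limit_moment (2 * n) \<le> r ^ (2 * n)"
    using bounded_support_moment_bound[OF M] by blast
  \<comment> \<open>Since \<open>24 * 4 = 12 * 8\<close>, this gives
    \<open>s / 12 >= 8 * (1 + r ^ 2)\<close>: the 8 pays for the factor \<open>1 / 8\<close> in
    \<open>limit_moment_ge\<close>, and the 1 makes the final comparison strict.\<close>
  obtain s :: nat where "real s > max 1 (24 * (1 + r\<^sup>2) * 4)" using reals_Archimedean2 by blast
  then have "1 < real s" "24 * (1 + r\<^sup>2) * 4 < real s" by (simp_all only: max_less_iff_conj)
  then have s: "s > 0" "real s / 12 \<ge> 8 * (1 + r\<^sup>2)" by (simp_all add: field_simps)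
  define m where "m = s ^ 4"
  have m: "m > 0" using s by (simp add: m_def)
  have "8 * (1 + r\<^sup>2) ^ m \<le> 8 ^ m * (1 + r\<^sup>2) ^ m"
    using m by (intro mult_right_mono self_le_power) auto
  also have "\<dots> = (8 * (1 + r\<^sup>2)) ^ m" by (simp only: power_mult_distrib)
  also have "\<dots> \<le> (real s / 12) ^ m" using s(2) by (intro power_mono) auto
  finally have "(1 + r\<^sup>2) ^ m \<le> 1 / 8 * (real s / 12) ^ m" by simp
  also have "\<dots> \<le> r ^ (2 * m)"
    using limit_moment_ge[OF m_def s(1)] r(2)[of m] by linarith
  also have "\<dots> = (r\<^sup>2) ^ m" by (simp add: power_mult)
  finally have "(1 + r\<^sup>2) ^ m \<le> (r\<^sup>2) ^ m" .
  moreover have "(r\<^sup>2) ^ m < (1 + r\<^sup>2) ^ m" using m by (intro power_strict_mono) auto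
  ultimately show False by simp
qed

theorem mainTheorem11:
  shows "\<exists>\<mu> :: real measure.
     prob_space \<mu> \<and> sets \<mu> = sets borel \<and>
     \<not> bounded (msupport \<mu>) \<and>
     (\<forall>k::nat. integrable \<mu> (\<lambda>x. x ^ k)) \<and>
     (\<forall>\<nu> :: real measure. prob_space \<nu> \<and> sets \<nu> = sets borel \<and>
        (\<forall>k::nat. integrable \<nu> (\<lambda>x. x ^ k) \<and>
                  (\<integral>x. x ^ k \<partial>\<nu>) = (\<integral>x. x ^ k \<partial>\<mu>)) \<longrightarrow> \<nu> = \<mu>) \<and>
     (\<forall>p. admissible_density p \<longrightarrow>
        (\<forall>k::nat. (\<lambda>N. moment_N p k N) \<longlonglongrightarrow> (\<integral>x. x ^ k \<partial>\<mu>)) \<and>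
        (\<forall>f :: real \<Rightarrow> real. continuous_on UNIV f \<and> bounded (range f) \<longrightarrow>
          (\<forall>\<epsilon>>0. (\<lambda>N. measure (toeplitz_space p N)
                     {b \<in> space (toeplitz_space p N).
                        \<bar>esm_integral N b f - (\<integral>x. f x \<partial>\<mu>)\<bar> > \<epsilon>})
                   \<longlonglongrightarrow> 0)))"
proof -
  \<comment> \<open>As \<open>limit_moment\<close> does not mention the density, the measure
    obtained from this one serves every admissible \<open>p\<close>.\<close>
  interpret gauss: entry_distribution std_normal_density
    by unfold_locales (rule admissible_normal_density)
  obtain \<mu> where \<mu>: "has_moments \<mu> limit_moment"
    using moments_close_imp_exists[OF gauss.close_realization_exists] by blast
  interpret \<mu>: real_distribution \<mu> using \<mu> by (simp add: has_moments_def)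
  have moments: "(\<integral>x. x ^ k \<partial>\<mu>) = limit_moment k" "integrable \<mu> (\<lambda>x. x ^ k)" for k
    using \<mu> by (auto simp: has_moments_def)
  have unique: "\<nu> = \<mu>" if "prob_space \<nu> \<and> sets \<nu> = sets borel \<and>
      (\<forall>k::nat. integrable \<nu> (\<lambda>x. x ^ k) \<and> (\<integral>x. x ^ k \<partial>\<nu>) = (\<integral>x. x ^ k \<partial>\<mu>))" for \<nu>
  proof (rule moments_determine_distribution[OF limit_moment_growth _ \<mu>])
    interpret \<nu>: prob_space \<nu> using that by blast
    have "real_distribution \<nu>" using that sets_eq_imp_space_eq[of \<nu> borel] by unfold_locales auto
    then show "has_moments \<nu> limit_moment" using that moments by (auto simp: has_moments_def)
  qed
  show ?thesis
  proof (intro exI[of _ \<mu>] conjI allI impI)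
    show "prob_space \<mu>" by (rule \<mu>.prob_space_axioms)
    show "sets \<mu> = sets borel" by simp
    show "\<not> bounded (msupport \<mu>)" by (rule limit_moments_unbounded_support[OF \<mu>])
    show "integrable \<mu> (\<lambda>x. x ^ k)" for k by (rule moments(2))
    fix p :: "real \<Rightarrow> real" assume "admissible_density p"
    then interpret entry_distribution p by unfold_locales
    show "(\<lambda>N. moment_N p k N) \<longlonglongrightarrow> (\<integral>x. x ^ k \<partial>\<mu>)" for k
      unfolding moments(1) by (rule moment_N_tendsto)
    fix f :: "real \<Rightarrow> real" and \<epsilon> :: real assume "continuous_on UNIV f \<and> bounded (range f)" "\<epsilon> > 0"
    then show "(\<lambda>N. measure (toeplitz_space p N) {b \<in> space (toeplitz_space p N).
        \<bar>esm_integral N b f - (\<integral>x. f x \<partial>\<mu>)\<bar> > \<epsilon>}) \<longlonglongrightarrow> 0"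
      using esm_converges_in_probability[OF \<mu>] by blast
  qed (use unique in blast)+
qed

end
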